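(* Let $S$ be an inverse semigroup and $R$ a commutative ring with unit. (1) $RS$ is Noetherian if and only if $S$ has finitely many idempotents and $RG$ is Noetherian for each maximal subgroup $G$ of $S$. (2) $RS$ is Artinian if and only if $R$ is Artinian and $S$ is finite. (3) $RS$ is semisimple if and only if $S$ is finite and $R$ is a finite direct product of fields whose characteristics divide the order of no maximal subgroup of $S$. In any of these cases, $RS$ is isomorphic to a finite direct product of matrix algebras over group algebras (over $R$) of maximal subgroups of $S$.
   Context: An inverse semigroup is a semigroup $S$ such that for each $s\in S$ there is a unique $s^*\in S$ with $ss^*s=s$ and $s^*ss^*=s^*$. $E(S)$ denotes the set of idempotents of $S$. A maximal subgroup of $S$ is the group of units of a monoid $eSe$ with $e\in E(S)$. $RS$ is the semigroup algebra of $S$ over $R$: the free $R$-module on $S$ with the product extending that of $S$ bilinearly (not necessarily unital). $RG$ is the usual group algebra of a group $G$. A (not necessarily unital) ring is Noetherian (resp. Artinian) if it satisfies the ascending (resp. descending) chain condition on left ideals; for $RS$ the left and right conditions are equivalent because it has an involution. A ring is semisimple if it is unital and semisimple as a left module over itself. *)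

theory Defs
  imports "HOL-Algebra.Algebra" "HOL-Algebra.Algebraic_Closure_Type" "HOL-Library.Poly_Mapping"
begin

section \<open>Inverse semigroups and their maximal subgroups\<close>

class inverse_semigroup = semigroup_mult +
  assumes ex1_inverse: "\<exists>!t. s * t * s = s \<and> t * s * t = t"

definition idempotents :: "'s::semigroup_mult set"
  where "idempotents = {e. e * e = e}"

definition local_monoid :: "'s::semigroup_mult \<Rightarrow> 's monoid"
  where "local_monoid e = \<lparr>carrier = {e * s * e | s. True}, monoid.mult = (*), one = e\<rparr>"

definition maximal_subgroups :: "'s::semigroup_mult set set"
  where "maximal_subgroups = {Units (local_monoid e) | e. e \<in> idempotents}"


section \<open>Semigroup algebras\<close>

definition convolution ::
    "('s::semigroup_mult \<Rightarrow>\<^sub>0 'r::comm_ring_1) \<Rightarrow> ('s \<Rightarrow>\<^sub>0 'r) \<Rightarrow> ('s \<Rightarrow>\<^sub>0 'r)"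
  where "convolution f g =
    (\<Sum>s\<in>Poly_Mapping.keys f. \<Sum>t\<in>Poly_Mapping.keys g.
       Poly_Mapping.single (s * t) (Poly_Mapping.lookup f s * Poly_Mapping.lookup g t))"

lemma convolution_single:
  "convolution (Poly_Mapping.single s a) (Poly_Mapping.single t b) =
     Poly_Mapping.single (s * t) (a * b)"
  by (simp add: convolution_def)

text \<open>
  The algebra of a subsemigroup \<open>G\<close> over the ring \<open>'r\<close>, with basis the elements of \<open>G\<close>; for a
  subgroup \<open>G\<close> it is the group algebra.  It need not be unital: the field \<open>one\<close> is the identity
  element when there is one and is meaningless otherwise.  The left ideals, chain conditions and
  semisimplicity below do not refer to it.
\<close>

definition semigroup_algebra ::
    "'r::comm_ring_1 itself \<Rightarrow> 's::semigroup_mult set \<Rightarrow> ('r, 's \<Rightarrow>\<^sub>0 'r) module"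
  where "semigroup_algebra _ G =
    \<lparr>carrier = {f. Poly_Mapping.keys f \<subseteq> G},
     monoid.mult = convolution,
     one = (THE u. Poly_Mapping.keys u \<subseteq> G \<and>
                   (\<forall>f. Poly_Mapping.keys f \<subseteq> G \<longrightarrow> convolution u f = f \<and> convolution f u = f)),
     ring.zero = 0,
     add = (+),
     module.smult = (\<lambda>r. Poly_Mapping.map (\<lambda>a. r * a))\<rparr>"


section \<open>Chain conditions and semisimplicity for rings that need not be unital\<close>

definition left_ideal :: "('a, 'm) ring_scheme \<Rightarrow> 'a set \<Rightarrow> bool"
  where "left_ideal A I \<longleftrightarrow>
    additive_subgroup I A \<and> (\<forall>a\<in>carrier A. \<forall>x\<in>I. a \<otimes>\<^bsub>A\<^esub> x \<in> I)"

definition left_noetherian :: "('a, 'm) ring_scheme \<Rightarrow> bool"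
  where "left_noetherian A \<longleftrightarrow>
    (\<forall>I :: nat \<Rightarrow> 'a set. (\<forall>n. left_ideal A (I n)) \<and> (\<forall>n. I n \<subseteq> I (Suc n)) \<longrightarrow>
       (\<exists>N. \<forall>n\<ge>N. I n = I N))"

definition left_artinian :: "('a, 'm) ring_scheme \<Rightarrow> bool"
  where "left_artinian A \<longleftrightarrow>
    (\<forall>I :: nat \<Rightarrow> 'a set. (\<forall>n. left_ideal A (I n)) \<and> (\<forall>n. I (Suc n) \<subseteq> I n) \<longrightarrow>
       (\<exists>N. \<forall>n\<ge>N. I n = I N))"

definition unital :: "('a, 'm) ring_scheme \<Rightarrow> bool"
  where "unital A \<longleftrightarrow> (\<exists>u\<in>carrier A. \<forall>x\<in>carrier A. u \<otimes>\<^bsub>A\<^esub> x = x \<and> x \<otimes>\<^bsub>A\<^esub> u = x)"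

definition simple_left_ideal :: "('a, 'm) ring_scheme \<Rightarrow> 'a set \<Rightarrow> bool"
  where "simple_left_ideal A L \<longleftrightarrow>
    left_ideal A L \<and> L \<noteq> {\<zero>\<^bsub>A\<^esub>} \<and>
    (\<forall>J. left_ideal A J \<and> J \<subseteq> L \<longrightarrow> J = {\<zero>\<^bsub>A\<^esub>} \<or> J = L)"

definition is_direct_sum :: "('a, 'm) ring_scheme \<Rightarrow> 'a set set \<Rightarrow> bool"
  where "is_direct_sum A \<L> \<longleftrightarrow>
    (\<forall>x\<in>carrier A. \<exists>!f. f \<in> (\<Pi>\<^sub>E L\<in>\<L>. L) \<and> finite {L \<in> \<L>. f L \<noteq> \<zero>\<^bsub>A\<^esub>} \<and>
       x = (\<Oplus>\<^bsub>A\<^esub>L\<in>{L \<in> \<L>. f L \<noteq> \<zero>\<^bsub>A\<^esub>}. f L))"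

text \<open>The submodules of a unital ring as a left module over itself are its left ideals.\<close>

definition semisimple_ring :: "('a, 'm) ring_scheme \<Rightarrow> bool"
  where "semisimple_ring A \<longleftrightarrow>
    unital A \<and> (\<exists>\<L>. (\<forall>L\<in>\<L>. simple_left_ideal A L) \<and> is_direct_sum A \<L>)"

definition ring_characteristic :: "('a, 'm) ring_scheme \<Rightarrow> nat"
  where "ring_characteristic A =
    (if \<exists>n::nat. n > 0 \<and> [n] \<cdot>\<^bsub>A\<^esub> \<one>\<^bsub>A\<^esub> = \<zero>\<^bsub>A\<^esub>
     then LEAST n. n > 0 \<and> [n] \<cdot>\<^bsub>A\<^esub> \<one>\<^bsub>A\<^esub> = \<zero>\<^bsub>A\<^esub>
     else 0)"


section \<open>Matrix algebras, products and isomorphisms of algebras\<close>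

definition matrix_algebra :: "nat \<Rightarrow> ('r, 'a) module \<Rightarrow> ('r, nat \<times> nat \<Rightarrow> 'a) module"
  where "matrix_algebra n A =
    \<lparr>carrier = {..<n} \<times> {..<n} \<rightarrow>\<^sub>E carrier A,
     monoid.mult = (\<lambda>M N. \<lambda>(i, j)\<in>{..<n} \<times> {..<n}. \<Oplus>\<^bsub>A\<^esub>k\<in>{..<n}. M (i, k) \<otimes>\<^bsub>A\<^esub> N (k, j)),
     one = (\<lambda>(i, j)\<in>{..<n} \<times> {..<n}. if i = j then \<one>\<^bsub>A\<^esub> else \<zero>\<^bsub>A\<^esub>),
     ring.zero = (\<lambda>_\<in>{..<n} \<times> {..<n}. \<zero>\<^bsub>A\<^esub>),
     add = (\<lambda>M N. \<lambda>p\<in>{..<n} \<times> {..<n}. M p \<oplus>\<^bsub>A\<^esub> N p),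
     module.smult = (\<lambda>r M. \<lambda>p\<in>{..<n} \<times> {..<n}. r \<odot>\<^bsub>A\<^esub> M p)\<rparr>"

definition product_algebra :: "('r, 'a) module list \<Rightarrow> ('r, 'a list) module"
  where "product_algebra As =
    ring.extend (RDirProd_list As) (module.fields (\<lambda>r xs. map2 (\<lambda>A x. r \<odot>\<^bsub>A\<^esub> x) As xs))"

text \<open>As \<^const>\<open>ring_iso\<close> asks for the identity to be preserved, this is for unital algebras.\<close>

definition algebra_isomorphic :: "('r, 'a) module \<Rightarrow> ('r, 'b) module \<Rightarrow> bool"
  where "algebra_isomorphic A B \<longleftrightarrow>
    (\<exists>h\<in>ring_iso A B. \<forall>r. \<forall>x\<in>carrier A. h (r \<odot>\<^bsub>A\<^esub> x) = r \<odot>\<^bsub>B\<^esub> h x)"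

end

theory Submission
  imports Defs "HOL-Library.Ramsey"
begin

text \<open>
  If \<open>S\<close> has finitely many idempotents, the map sending \<open>s\<close> to the sum of all \<open>t \<le> s\<close> is an isomorphism
  from \<open>RS\<close> onto the algebra of the groupoid of \<open>S\<close> (invertible by Moebius inversion), and the latter
  is a product of matrix algebras over the group algebras of representatives of the maximal
  subgroups.  This gives the decomposition, and also the sufficiency of the three conditions: chain
  conditions are checked coordinate by coordinate, and semisimplicity is Maschke's averaging.

  Conversely, in an infinite semilattice there is by Ramsey's theorem an infinite increasing or
  decreasing sequence or an infinite antichain, and each of them violates both chain conditions in
  \<open>RS\<close>.  For a subgroup \<open>G\<close>, left ideals of \<open>RG\<close> extend to left ideals of \<open>RS\<close> with the same trace
  on \<open>RG\<close>, so \<open>RG\<close> inherits the chain conditions.  It remains to see that \<open>G\<close> is finite if \<open>RG\<close> is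
  Artinian.  Otherwise there is an infinite subgroup all of whose proper subgroups are finite; it is not
  abelian, its centre \<open>Z\<close> is finite, and its noncentral elements have infinitely many conjugates.  Let \<open>P\<close>
  be a prime ideal of \<open>R\<close>, let \<open>I\<close> be the elements of \<open>RG\<close> that vanish in \<open>(R/P)(G/Z)\<close> and let
  \<open>\<omega>\<close> be those with augmentation in \<open>P\<close>.  Take a left ideal \<open>M\<close> minimal among those that contain \<open>I\<close>
  and are not contained in \<open>\<omega>\<close>, and a minimal \<open>L\<close> with \<open>I \<subset> L \<subseteq> M\<close>.  As \<open>(R/P)(G/Z)\<close> is prime,
  \<open>Mk\<close> is not contained in \<open>I\<close> for some \<open>k\<close> in \<open>L\<close>; then right multiplication by \<open>k\<close> maps \<open>M \<inter> \<omega>\<close> to \<open>I\<close>, so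
  that \<open>L/I\<close> contains a nonzero element invariant under \<open>G\<close>, whose support must be finite and all of \<open>G/Z\<close>.
\<close>

section \<open>Left ideals, chain conditions and right units\<close>

text \<open>Semisimplicity is handled in the form \<open>right_units\<close>: every left ideal
  \<open>I\<close> contains some \<open>u\<close> with \<open>x u = x\<close> for all
  \<open>x\<close> in \<open>I\<close>. This speaks only of left ideals and the product, so it
  passes from \<open>RS\<close> to \<open>R\<close> and to each \<open>RG\<close> and moves along
  isomorphisms just as the chain conditions do; one pattern of transfer serves all three
  equivalences. It also implies the ascending chain condition, which gives finitely many idempotents
  in the semisimple case. The hard point is the finiteness of \<open>G\<close> when
  \<open>RG\<close> is Artinian. If all proper subgroups of the infinite group are finite, then
  centralizers of noncentral elements are finite, which is what makes the algebra over
  \<open>G/Z\<close> prime. A prime ideal \<open>P\<close> of \<open>R\<close> is factored out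
  because zero divisors of \<open>R\<close> would destroy primeness. No quotient is built:
  membership in the kernel is tested on coefficient sums over cosets of \<open>Z\<close>. The ideal
  \<omega> enters because \<open>G\<close> acts trivially modulo \<omega>: each
  \<open>h m - m\<close> lies in \<omega>, so a product \<open>m k\<close> becomes invariant as soon
  as \<open>k\<close> sends the part of \<open>M\<close> inside \<omega> to the kernel.\<close>

definition lideal :: "('m::ab_group_add \<Rightarrow> 'm \<Rightarrow> 'm) \<Rightarrow> 'm set \<Rightarrow> 'm set \<Rightarrow> bool"
  where "lideal m C I \<longleftrightarrow>
    I \<subseteq> C \<and> 0 \<in> I \<and> (\<forall>x\<in>I. \<forall>y\<in>I. x - y \<in> I) \<and> (\<forall>a\<in>C. \<forall>x\<in>I. m a x \<in> I)"

definition set_chain :: "bool \<Rightarrow> (nat \<Rightarrow> 'a set) \<Rightarrow> bool"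
  where "set_chain asc I \<longleftrightarrow> (\<forall>n. if asc then I n \<subseteq> I (Suc n) else I (Suc n) \<subseteq> I n)"

definition stabilizes :: "(nat \<Rightarrow> 'a) \<Rightarrow> bool"
  where "stabilizes I \<longleftrightarrow> (\<exists>N. \<forall>n\<ge>N. I n = I N)"

text \<open>The ascending (\<open>asc = True\<close>) or descending (\<open>asc = False\<close>) chain condition on left ideals.\<close>

definition chain_condition :: "bool \<Rightarrow> ('m::ab_group_add \<Rightarrow> 'm \<Rightarrow> 'm) \<Rightarrow> 'm set \<Rightarrow> bool"
  where "chain_condition asc m C \<longleftrightarrow>
    (\<forall>I. (\<forall>n. lideal m C (I n)) \<and> set_chain asc I \<longrightarrow> stabilizes I)"

text \<open>Such a \<open>u\<close> is idempotent and generates \<open>I\<close>. In a unital ring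
  this makes \<open>I\<close> a direct summand, with complement the elements killed by right
  multiplication by \<open>u\<close>.\<close>

definition right_units :: "('m::ab_group_add \<Rightarrow> 'm \<Rightarrow> 'm) \<Rightarrow> 'm set \<Rightarrow> bool"
  where "right_units m C \<longleftrightarrow> (\<forall>I. lideal m C I \<longrightarrow> (\<exists>u\<in>I. \<forall>x\<in>I. m x u = x))"

lemma lidealD:
  assumes "lideal m C I"
  shows "I \<subseteq> C" "0 \<in> I" "\<And>x y. x \<in> I \<Longrightarrow> y \<in> I \<Longrightarrow> x - y \<in> I"
    "\<And>x y. x \<in> I \<Longrightarrow> y \<in> I \<Longrightarrow> x + y \<in> I" "\<And>x. x \<in> I \<Longrightarrow> - x \<in> I"
    "\<And>a x. a \<in> C \<Longrightarrow> x \<in> I \<Longrightarrow> m a x \<in> I"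
proof -
  show "I \<subseteq> C" "0 \<in> I" and diff: "\<And>x y. x \<in> I \<Longrightarrow> y \<in> I \<Longrightarrow> x - y \<in> I"
    and "\<And>a x. a \<in> C \<Longrightarrow> x \<in> I \<Longrightarrow> m a x \<in> I"
    using assms by (auto simp: lideal_def)
  then show uminus: "\<And>x. x \<in> I \<Longrightarrow> - x \<in> I"
    by (metis diff_0)
  show "x + y \<in> I" if "x \<in> I" "y \<in> I" for x y
    using diff[OF that(1) uminus[OF that(2)]] by simp
qed

lemma lidealI:
  assumes "I \<subseteq> C" "0 \<in> I" "\<And>x y. x \<in> I \<Longrightarrow> y \<in> I \<Longrightarrow> x - y \<in> I"
    "\<And>a x. a \<in> C \<Longrightarrow> x \<in> I \<Longrightarrow> m a x \<in> I"
  shows "lideal m C I"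
  using assms by (auto simp: lideal_def)

lemma lideal_sum:
  assumes "lideal m C I" "\<And>i. i \<in> A \<Longrightarrow> f i \<in> I"
  shows "sum f A \<in> I"
  using assms(2) by (induction A rule: infinite_finite_induct) (auto intro: lidealD[OF assms(1)])

lemma lideal_Int: "lideal m C I \<Longrightarrow> lideal m C J \<Longrightarrow> lideal m C (I \<inter> J)"
  by (auto simp: lideal_def)

lemma stabilizesI: "(\<And>n. n \<ge> N \<Longrightarrow> I n = I N) \<Longrightarrow> stabilizes I"
  by (auto simp: stabilizes_def)

lemma stabilizes_compose:
  assumes "stabilizes I" shows "stabilizes (\<lambda>n. F (I n))"
proof -
  obtain N where N: "\<forall>n\<ge>N. I n = I N"
    using assms by (auto simp only: stabilizes_def)
  show ?thesis
    unfolding stabilizes_def by (intro exI[of _ N] allI impI arg_cong[of _ _ F] N[rule_format])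
qed

lemma stabilizes_common:
  assumes "stabilizes I" "stabilizes J"
  shows "\<exists>N. \<forall>n\<ge>N. I n = I N \<and> J n = J N"
proof -
  obtain N M where N: "\<And>n. n \<ge> N \<Longrightarrow> I n = I N" and M: "\<And>n. n \<ge> M \<Longrightarrow> J n = J M"
    using assms unfolding stabilizes_def by blast
  have "I n = I (max N M) \<and> J n = J (max N M)" if "n \<ge> max N M" for n
    using N[of n] N[of "max N M"] M[of n] M[of "max N M"] that by (auto simp del: max.bounded_iff)
  then show ?thesis by blast
qed

lemma set_chain_mono: "set_chain asc I \<Longrightarrow> mono F \<Longrightarrow> set_chain asc (\<lambda>n. F (I n))"
  by (auto simp: set_chain_def mono_def split: if_splits)

lemma set_chain_le:
  assumes "set_chain asc I" "n \<le> k"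
  shows "if asc then I n \<subseteq> I k else I k \<subseteq> I n"
proof (cases asc)
  case True
  then show ?thesis
    using assms lift_Suc_mono_le[of I] by (auto simp: set_chain_def)
next
  case False
  then show ?thesis
    using assms lift_Suc_antimono_le[of I] by (auto simp: set_chain_def)
qed

text \<open>A monotone \<open>F\<close> with left inverse \<open>G\<close> carries chains in
  \<open>C'\<close> to chains in \<open>C\<close> without collapsing them. The instances of
  \<open>F\<close> are the preimage under the augmentation, the extension of left ideals from a
  subgroup, and the image under an isomorphism.\<close>

lemma chain_condition_transfer:
  assumes "chain_condition asc m C"
    and "\<And>I. lideal m' C' I \<Longrightarrow> lideal m C (F I)" "mono F"
    and "\<And>I. lideal m' C' I \<Longrightarrow> G (F I) = I"
  shows "chain_condition asc m' C'"
  unfolding chain_condition_def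
proof (intro allI impI, elim conjE)
  fix I assume I: "\<forall>n. lideal m' C' (I n)" "set_chain asc I"
  have "stabilizes (\<lambda>n. F (I n))"
    using assms(1)[unfolded chain_condition_def, rule_format, of "\<lambda>n. F (I n)"]
      assms(2) I(1) set_chain_mono[OF I(2) assms(3)] by simp
  then have "stabilizes (\<lambda>n. G (F (I n)))"
    by (rule stabilizes_compose)
  then show "stabilizes I"
    using I(1) assms(4) by simp
qed

lemma no_strict_chain:
  assumes "chain_condition asc m C" "\<And>n::nat. lideal m C (I n)"
    and "\<And>n. if asc then I n \<subset> I (Suc n) else I (Suc n) \<subset> I n"
  shows False
proof -
  have "set_chain asc I"
    unfolding set_chain_def
  proof
    show "if asc then I n \<subseteq> I (Suc n) else I (Suc n) \<subseteq> I n" for n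
      using assms(3)[of n] by (simp split: if_splits)
  qed
  then obtain N where N: "\<forall>n\<ge>N. I n = I N"
    using assms(1)[unfolded chain_condition_def stabilizes_def, rule_format, of I] assms(2) by auto
  have "I (Suc N) = I N"
    by (rule N[rule_format]) simp
  then show False
    using assms(3)[of N] by (auto split: if_splits)
qed

text \<open>Otherwise every member has a strictly larger (or smaller) one, and iterating a choice of
  it yields a strict chain.\<close>

lemma chain_condition_extremal:
  assumes "chain_condition asc m C" "J \<in> \<J>" "\<And>I. I \<in> \<J> \<Longrightarrow> lideal m C I"
  shows "\<exists>M\<in>\<J>. \<forall>I\<in>\<J>. (if asc then M \<subseteq> I else I \<subseteq> M) \<longrightarrow> I = M"
proof (rule ccontr)
  assume "\<not> ?thesis"
  then have step: "\<forall>M\<in>\<J>. \<exists>I\<in>\<J>. (if asc then M \<subset> I else I \<subset> M)"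
    by (cases asc) (simp_all, blast+)
  define nxt where "nxt = (\<lambda>M. SOME I. I \<in> \<J> \<and> (if asc then M \<subset> I else I \<subset> M))"
  have nxt: "nxt M \<in> \<J> \<and> (if asc then M \<subset> nxt M else nxt M \<subset> M)" if "M \<in> \<J>" for M
    unfolding nxt_def by (rule someI_ex) (use step that in blast)
  define f where "f = rec_nat J (\<lambda>_. nxt)"
  have f_simps: "f 0 = J" "f (Suc n) = nxt (f n)" for n
    by (simp_all add: f_def)
  have in_J: "f n \<in> \<J>" for n
    by (induction n) (simp_all add: f_simps assms(2) nxt)
  show False
  proof (rule no_strict_chain[OF assms(1)])
    show "lideal m C (f n)" for n
      using assms(3)[OF in_J] .
    show "if asc then f n \<subset> f (Suc n) else f (Suc n) \<subset> f n" for n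
      using nxt[OF in_J, of n] by (simp add: f_simps)
  qed
qed

lemmas ascending_maximal = chain_condition_extremal[where asc = True, simplified]
lemmas descending_minimal = chain_condition_extremal[where asc = False, simplified]

text \<open>A chain of modules is stationary as soon as its traces on the layers of a finite filtration
  are; the layers here are the successive kernels of the coordinate maps \<open>c t\<close>.\<close>

lemma stabilizes_by_coordinates:
  fixes c :: "'t \<Rightarrow> 'm::ab_group_add \<Rightarrow> 'b::ab_group_add"
  assumes T: "finite T"
    and add: "\<And>t x y. t \<in> T \<Longrightarrow> c t (x - y) = c t x - c t y"
    and Q_diff: "\<And>M x y. Q M \<Longrightarrow> x \<in> M \<Longrightarrow> y \<in> M \<Longrightarrow> x - y \<in> M"
    and Q_kernel: "\<And>M U. Q M \<Longrightarrow> U \<subseteq> T \<Longrightarrow> Q {x \<in> M. \<forall>t\<in>U. c t x = 0}"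
    and Q_stab: "\<And>t M. t \<in> T \<Longrightarrow> (\<And>n. Q (M n)) \<Longrightarrow> set_chain asc M \<Longrightarrow> stabilizes (\<lambda>n. c t ` M n)"
    and inj: "\<And>M x. Q M \<Longrightarrow> x \<in> M \<Longrightarrow> (\<And>t. t \<in> T \<Longrightarrow> c t x = 0) \<Longrightarrow> x = 0"
    and M: "\<And>n. Q (M n)" "\<And>n. 0 \<in> M n" "set_chain asc M"
  shows "stabilizes M"
proof -
  \<comment> \<open>Induction on the set \<open>U\<close> of coordinates that may be nonzero: for
    \<open>U\<close> empty only 0 is left by \<open>inj\<close>, for \<open>U = T\<close> no
    restriction remains.\<close>
  have "stabilizes (\<lambda>n. {x \<in> M n. \<forall>t\<in>T-U. c t x = 0})" if "finite U" "U \<subseteq> T" for U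
    using that
  proof (induction U)
    case empty
    have "{x \<in> M n. \<forall>t\<in>T. c t x = 0} = {0}" for n
    proof -
      have "c t 0 = 0" if "t \<in> T" for t
        using add[OF that, of 0 0] by simp
      then show ?thesis
        using inj[OF M(1)] M(2) by auto
    qed
    then show ?case by (simp add: stabilizes_def)
  next
    case (insert u U)
    define A where "A n = {x \<in> M n. \<forall>t\<in>T-insert u U. c t x = 0}" for n
    define B where "B n = {x \<in> M n. \<forall>t\<in>T-U. c t x = 0}" for n
    have QA: "Q (A n)" for n
      unfolding A_def by (rule Q_kernel) (use M in auto)
    have chA: "set_chain asc A"
      using M(3) by (auto simp: set_chain_def A_def split: if_splits)
    have "stabilizes B"
      unfolding B_def using insert by simp
    moreover have "stabilizes (\<lambda>n. c u ` A n)"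
      using Q_stab[of u A] QA chA insert.prems by blast
    ultimately obtain N where N: "\<And>n. n \<ge> N \<Longrightarrow> B n = B N \<and> c u ` A n = c u ` A N"
      using stabilizes_common by blast
    \<comment> \<open>\<open>B\<close> is the kernel of \<open>c u\<close> on \<open>A\<close>. An
      element of one module is matched in coordinate \<open>u\<close> by an element of the other,
      and the difference lies in the kernel layer, where the two agree.\<close>
    have key: "A k \<subseteq> A n" if "A n \<subseteq> A k" "B k \<subseteq> B n" "c u ` A k \<subseteq> c u ` A n" for n k
    proof
      fix x assume x: "x \<in> A k"
      then obtain y where y: "y \<in> A n" "c u x = c u y"
        using \<open>c u ` A k \<subseteq> c u ` A n\<close> by blast
      have "x - y \<in> A k"
        using Q_diff[OF QA x] y that by blast
      moreover have "c u (x - y) = 0"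
        using y add insert.prems by simp
      ultimately have "x - y \<in> B k"
        by (auto simp: A_def B_def)
      then have "x - y \<in> A n"
        using \<open>B k \<subseteq> B n\<close> by (auto simp: A_def B_def)
      then have "(x - y) - (0 - y) \<in> A n"
        using y Q_diff[OF QA] by (metis add.commute diff_self)
      then show "x \<in> A n" by simp
    qed
    have "A n = A N" if "n \<ge> N" for n
      using key[of n N] key[of N n] set_chain_le[OF chA that] N[OF that] by (auto split: if_splits)
    then show ?case
      by (auto simp: A_def[symmetric] intro: stabilizesI)
  qed
  from this[OF T] show ?thesis by simp
qed

text \<open>The union of the chain is a left ideal. Its right unit \<open>u\<close> already lies in
  some \<open>I N\<close>, and then so does every \<open>x = x u\<close> of the union.\<close>

lemma right_units_ascending:
  assumes "right_units m C"
  shows "chain_condition True m C"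
  unfolding chain_condition_def
proof (intro allI impI, elim conjE)
  fix I assume I: "\<forall>n. lideal m C (I n)" "set_chain True I"
  have le: "I n \<subseteq> I k" if "n \<le> k" for n k
    using set_chain_le[OF I(2) that] by simp
  have "lideal m C (\<Union>n. I n)"
  proof (rule lidealI)
    show "(\<Union>n. I n) \<subseteq> C" "0 \<in> (\<Union>n. I n)"
      using lidealD(1,2)[OF spec[OF I(1)]] by auto
    show "m a x \<in> (\<Union>n. I n)" if "a \<in> C" "x \<in> (\<Union>n. I n)" for a x
      using that lidealD(6)[OF spec[OF I(1)]] by auto
  next
    fix x y assume "x \<in> (\<Union>n. I n)" "y \<in> (\<Union>n. I n)"
    then obtain a b where "x \<in> I a" "y \<in> I b" by blast
    then have "x \<in> I (max a b)" "y \<in> I (max a b)"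
      using le[of a "max a b"] le[of b "max a b"] by auto
    then show "x - y \<in> (\<Union>n. I n)"
      using lidealD(3)[OF spec[OF I(1)]] by blast
  qed
  then obtain u N where u: "u \<in> I N" "\<forall>x\<in>(\<Union>n. I n). m x u = x"
    using assms unfolding right_units_def by blast
  have "I n = I N" if "n \<ge> N" for n
  proof
    show "I n \<subseteq> I N"
    proof
      fix x assume "x \<in> I n"
      then have "x \<in> C" "m x u = x"
        using u lidealD(1)[OF spec[OF I(1)]] by blast+
      then show "x \<in> I N"
        using lidealD(6)[of m C "I N" x u] I(1) u by simp
    qed
  qed (use le that in blast)
  then show "stabilizes I" by (rule stabilizesI)
qed

section \<open>Linear and bilinear extension\<close>

abbreviation coef :: "('s \<Rightarrow>\<^sub>0 'r::zero) \<Rightarrow> 's \<Rightarrow> 'r" where "coef \<equiv> Poly_Mapping.lookup"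

abbreviation supp :: "('s \<Rightarrow>\<^sub>0 'r::zero) \<Rightarrow> 's set" where "supp \<equiv> Poly_Mapping.keys"

abbreviation basis :: "'s \<Rightarrow> 's \<Rightarrow>\<^sub>0 'r::zero_neq_one" where "basis s \<equiv> Poly_Mapping.single s 1"

definition scale :: "'r \<Rightarrow> ('s \<Rightarrow>\<^sub>0 'r) \<Rightarrow> 's \<Rightarrow>\<^sub>0 'r::comm_ring_1"
  where "scale c = Poly_Mapping.map (\<lambda>a. c * a)"

lemma coef_scale [simp]: "coef (scale c f) s = c * coef f s"
  by (simp add: scale_def Poly_Mapping.map.rep_eq when_def)

lemma scale_simps [simp]:
  "scale c (f + g) = scale c f + scale c g" "scale c (f - g) = scale c f - scale c g"
  "scale c 0 = 0" "scale 0 f = 0" "scale 1 f = f" "scale c (scale d f) = scale (c * d) f"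
  "scale c (Poly_Mapping.single s a) = Poly_Mapping.single s (c * a)"
  by (rule poly_mapping_eqI; simp add: lookup_add lookup_minus lookup_single algebra_simps when_def)+

lemma scale_add_left: "scale (c + d) f = scale c f + scale d f"
  by (rule poly_mapping_eqI) (simp add: lookup_add algebra_simps)

lemma scale_diff_left: "scale (c - d) f = scale c f - scale d f"
  by (rule poly_mapping_eqI) (simp add: lookup_minus algebra_simps)

lemma scale_sum: "scale c (sum f A) = (\<Sum>i\<in>A. scale c (f i))"
  by (rule poly_mapping_eqI) (simp add: lookup_sum sum_distrib_left)

lemma supp_scale: "supp (scale c f) \<subseteq> supp f"
  by (auto simp: in_keys_iff)

definition lin :: "('s \<Rightarrow> 't \<Rightarrow>\<^sub>0 'r) \<Rightarrow> ('s \<Rightarrow>\<^sub>0 'r::comm_ring_1) \<Rightarrow> 't \<Rightarrow>\<^sub>0 'r"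
  where "lin \<phi> f = (\<Sum>s\<in>supp f. scale (coef f s) (\<phi> s))"

lemma lin_superset:
  assumes "finite A" "supp f \<subseteq> A"
  shows "lin \<phi> f = (\<Sum>s\<in>A. scale (coef f s) (\<phi> s))"
  unfolding lin_def by (rule sum.mono_neutral_left) (use assms in \<open>auto simp: in_keys_iff\<close>)

lemma lin_add: "lin \<phi> (f + g) = lin \<phi> f + lin \<phi> g"
proof -
  have "supp (f + g) \<subseteq> supp f \<union> supp g"
    by (rule Poly_Mapping.keys_add)
  then show ?thesis
    by (simp add: lin_superset[where A = "supp f \<union> supp g"] lookup_add scale_add_left sum.distrib)
qed

lemma lin_single [simp]: "lin \<phi> (Poly_Mapping.single s a) = scale a (\<phi> s)"
  by (cases "a = 0") (simp_all add: lin_def)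

lemma lin_0 [simp]: "lin \<phi> 0 = 0"
  by (simp add: lin_def)

lemma lin_diff: "lin \<phi> (f - g) = lin \<phi> f - lin \<phi> g"
  using lin_add[of \<phi> "f - g" g] by (simp add: algebra_simps)

lemma lin_sum: "lin \<phi> (sum f A) = (\<Sum>i\<in>A. lin \<phi> (f i))"
  by (induction A rule: infinite_finite_induct) (simp_all add: lin_add)

lemma lin_scale: "lin \<phi> (scale c f) = scale c (lin \<phi> f)"
  by (simp add: lin_superset[OF finite_keys supp_scale] scale_sum) (simp add: lin_def scale_sum)

lemma lin_basis [simp]: "lin basis f = f"
proof (rule poly_mapping_eqI)
  fix k
  have "coef (lin basis f) k = (\<Sum>s\<in>supp f. coef f s * (if s = k then 1 else 0))"
    unfolding lin_def lookup_sum by (intro sum.cong) (auto simp: lookup_single when_def)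
  also have "\<dots> = coef f k"
    by (simp add: if_distrib[where f = "\<lambda>x. _ * x"] in_keys_iff cong: if_cong)
  finally show "coef (lin basis f) k = coef f k" .
qed

lemma lin_cong: "(\<And>s. s \<in> supp f \<Longrightarrow> \<phi> s = \<psi> s) \<Longrightarrow> lin \<phi> f = lin \<psi> f"
  by (simp add: lin_def cong: sum.cong)

lemma lin_lin: "lin \<phi> (lin \<psi> f) = lin (\<lambda>s. lin \<phi> (\<psi> s)) f"
  unfolding lin_def[of \<psi>] by (simp add: lin_sum lin_scale lin_def[of _ f])

lemma lin_swap: "lin (\<lambda>s. lin (\<psi> s) g) f = lin (\<lambda>t. lin (\<lambda>s. \<psi> s t) f) g"
  unfolding lin_def by (simp add: scale_sum mult.commute sum.swap[of _ "supp f"])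

lemma lin_fun:
  "lin (\<lambda>s. 0) f = 0" "lin (\<lambda>s. scale c (\<phi> s)) f = scale c (lin \<phi> f)"
  "lin (\<lambda>s. \<phi> s + \<psi> s) f = lin \<phi> f + lin \<psi> f"
  by (simp_all add: lin_def scale_sum mult.commute sum.distrib)

lemma lin_fun_sum: "lin (\<lambda>s. \<Sum>i\<in>A. \<phi> i s) f = (\<Sum>i\<in>A. lin (\<phi> i) f)"
  by (simp add: lin_def scale_sum sum.swap[of _ A])

lemma coef_lin: "coef (lin \<phi> f) x = (\<Sum>s\<in>supp f. coef f s * coef (\<phi> s) x)"
  by (simp add: lin_def lookup_sum)

lemma supp_lin: "(\<And>s. s \<in> supp f \<Longrightarrow> supp (\<phi> s) \<subseteq> A) \<Longrightarrow> supp (lin \<phi> f) \<subseteq> A"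
proof
  fix x assume sub: "\<And>s. s \<in> supp f \<Longrightarrow> supp (\<phi> s) \<subseteq> A" and "x \<in> supp (lin \<phi> f)"
  then have "(\<Sum>s\<in>supp f. coef f s * coef (\<phi> s) x) \<noteq> 0"
    by (simp add: in_keys_iff coef_lin)
  then obtain s where "s \<in> supp f" "coef f s * coef (\<phi> s) x \<noteq> 0"
    by (meson sum.neutral)
  then show "x \<in> A"
    using sub[of s] by (force simp: in_keys_iff)
qed

lemma supp_add_subset: "supp f \<subseteq> A \<Longrightarrow> supp g \<subseteq> A \<Longrightarrow> supp (f + g) \<subseteq> A"
  using Poly_Mapping.keys_add[of f g] by blast

lemma supp_diff_subset:
  fixes f :: "'s \<Rightarrow>\<^sub>0 'r::comm_ring_1"
  shows "supp f \<subseteq> A \<Longrightarrow> supp g \<subseteq> A \<Longrightarrow> supp (f - g) \<subseteq> A"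
proof
  fix x assume "supp f \<subseteq> A" "supp g \<subseteq> A" "x \<in> supp (f - g)"
  moreover from this(3) have "x \<in> supp f \<or> x \<in> supp g"
    by (auto simp: in_keys_iff lookup_minus)
  ultimately show "x \<in> A" by blast
qed

lemma supp_sum_subset:
  "(\<And>i. i \<in> I \<Longrightarrow> supp (f i) \<subseteq> A) \<Longrightarrow> supp (sum f I) \<subseteq> A"
  by (induction I rule: infinite_finite_induct) (simp_all add: supp_add_subset)

definition bilin :: "('s \<Rightarrow> 't \<Rightarrow> 'u \<Rightarrow>\<^sub>0 'r) \<Rightarrow> ('s \<Rightarrow>\<^sub>0 'r::comm_ring_1) \<Rightarrow> ('t \<Rightarrow>\<^sub>0 'r) \<Rightarrow> 'u \<Rightarrow>\<^sub>0 'r"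
  where "bilin \<phi> f g = lin (\<lambda>s. lin (\<phi> s) g) f"

lemma bilin_single:
  "bilin \<phi> (Poly_Mapping.single s a) (Poly_Mapping.single t b) = scale (a * b) (\<phi> s t)"
  by (simp add: bilin_def)

lemma bilin_basis: "bilin \<phi> (basis s) (basis t) = \<phi> s t"
  by (simp add: bilin_single)

lemma bilin_swap: "bilin \<phi> f g = lin (\<lambda>t. lin (\<lambda>s. \<phi> s t) f) g"
  unfolding bilin_def by (rule lin_swap)

lemma bilin_simps:
  "bilin \<phi> (f + f') g = bilin \<phi> f g + bilin \<phi> f' g" "bilin \<phi> f (g + g') = bilin \<phi> f g + bilin \<phi> f g'"
  "bilin \<phi> (f - f') g = bilin \<phi> f g - bilin \<phi> f' g" "bilin \<phi> f (g - g') = bilin \<phi> f g - bilin \<phi> f g'"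
  "bilin \<phi> 0 g = 0" "bilin \<phi> f 0 = 0"
  "bilin \<phi> (scale c f) g = scale c (bilin \<phi> f g)" "bilin \<phi> f (scale c g) = scale c (bilin \<phi> f g)"
proof -
  show "bilin \<phi> (f + f') g = bilin \<phi> f g + bilin \<phi> f' g" "bilin \<phi> (f - f') g = bilin \<phi> f g - bilin \<phi> f' g"
    "bilin \<phi> 0 g = 0" "bilin \<phi> (scale c f) g = scale c (bilin \<phi> f g)"
    by (simp_all add: bilin_def lin_add lin_diff lin_scale)
  show "bilin \<phi> f (g + g') = bilin \<phi> f g + bilin \<phi> f g'" "bilin \<phi> f (g - g') = bilin \<phi> f g - bilin \<phi> f g'"
    "bilin \<phi> f 0 = 0" "bilin \<phi> f (scale c g) = scale c (bilin \<phi> f g)"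
    by (simp_all add: bilin_swap lin_add lin_diff lin_scale)
qed

lemma bilin_sum:
  "bilin \<phi> (sum f A) g = (\<Sum>i\<in>A. bilin \<phi> (f i) g)" "bilin \<phi> g' (sum f' A) = (\<Sum>i\<in>A. bilin \<phi> g' (f' i))"
  by (induction A rule: infinite_finite_induct) (simp_all add: bilin_simps)

lemma bilin_lin_left: "bilin \<phi> (lin \<psi> f) g = lin (\<lambda>s. bilin \<phi> (\<psi> s) g) f"
  by (simp add: bilin_def lin_lin)

lemma bilin_lin_right: "bilin \<phi> f (lin \<psi> g) = lin (\<lambda>t. bilin \<phi> f (\<psi> t)) g"
  by (simp add: bilin_swap lin_lin)

lemma lin_bilin: "lin \<psi> (bilin \<phi> f g) = bilin (\<lambda>s t. lin \<psi> (\<phi> s t)) f g"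
  by (simp add: bilin_def lin_lin)

lemma bilin_assoc:
  assumes "\<And>s t u. s \<in> supp f \<Longrightarrow> t \<in> supp g \<Longrightarrow> u \<in> supp h \<Longrightarrow>
     bilin \<phi> (\<phi> s t) (basis u) = bilin \<phi> (basis s) (\<phi> t u)"
  shows "bilin \<phi> (bilin \<phi> f g) h = bilin \<phi> f (bilin \<phi> g h)"
proof -
  have "bilin \<phi> (bilin \<phi> f g) h = lin (\<lambda>s. lin (\<lambda>t. bilin \<phi> (\<phi> s t) (lin basis h)) g) f"
    by (simp add: bilin_def lin_lin)
  also have "\<dots> = lin (\<lambda>s. lin (\<lambda>t. lin (\<lambda>u. bilin \<phi> (\<phi> s t) (basis u)) h) g) f"
    by (simp only: bilin_lin_right)
  also have "\<dots> = lin (\<lambda>s. lin (\<lambda>t. lin (\<lambda>u. bilin \<phi> (basis s) (\<phi> t u)) h) g) f"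
    by (intro lin_cong assms)
  also have "\<dots> = bilin \<phi> (lin basis f) (bilin \<phi> g h)"
    by (simp only: bilin_lin_left) (simp add: bilin_def lin_lin)
  finally show ?thesis by simp
qed

lemma supp_bilin:
  "(\<And>s t. s \<in> supp f \<Longrightarrow> t \<in> supp g \<Longrightarrow> supp (\<phi> s t) \<subseteq> A) \<Longrightarrow> supp (bilin \<phi> f g) \<subseteq> A"
  unfolding bilin_def by (intro supp_lin)

lemma bilin_cong:
  "(\<And>s t. s \<in> supp f \<Longrightarrow> t \<in> supp g \<Longrightarrow> \<phi> s t = \<psi> s t) \<Longrightarrow> bilin \<phi> f g = bilin \<psi> f g"
  unfolding bilin_def by (intro lin_cong)

text \<open>The ring homomorphism from \<open>RS\<close> to \<open>R\<close> that sends every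
  element of \<open>S\<close> to 1.\<close>

definition augmentation :: "('s \<Rightarrow>\<^sub>0 'r) \<Rightarrow> 'r::comm_ring_1"
  where "augmentation f = (\<Sum>s\<in>supp f. coef f s)"

lemma coef_lin_augmentation:
  "(\<And>s. coef (\<phi> s) x = 1) \<Longrightarrow> coef (lin \<phi> f) x = augmentation f"
  by (simp add: coef_lin augmentation_def)

lemma augmentation_add: "augmentation (f + g) = augmentation f + augmentation g"
  and augmentation_diff: "augmentation (f - g) = augmentation f - augmentation g"
  and augmentation_scale: "augmentation (scale c f) = c * augmentation f"
proof -
  \<comment> \<open>Over a one-point basis the augmentation is a coefficient of a linear extension,
    so its linearity is inherited from \<open>lin\<close>.\<close>
  have *: "augmentation h = coef (lin (\<lambda>_. basis ()) h) ()" for h :: "'b \<Rightarrow>\<^sub>0 'a"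
    by (simp add: coef_lin_augmentation)
  show "augmentation (f + g) = augmentation f + augmentation g"
    "augmentation (f - g) = augmentation f - augmentation g"
    "augmentation (scale c f) = c * augmentation f"
    unfolding * by (simp_all add: lin_add lin_diff lin_scale lookup_add lookup_minus)
qed

lemma augmentation_single [simp]: "augmentation (Poly_Mapping.single s a) = a"
  by (cases "a = 0") (simp_all add: augmentation_def)

lemma augmentation_0 [simp]: "augmentation 0 = 0"
  by (simp add: augmentation_def)

lemma augmentation_sum: "augmentation (sum f A) = (\<Sum>i\<in>A. augmentation (f i))"
  by (induction A rule: infinite_finite_induct) (simp_all add: augmentation_add)

lemma augmentation_lin: "augmentation (lin \<phi> f) = (\<Sum>s\<in>supp f. coef f s * augmentation (\<phi> s))"
  by (simp add: lin_def augmentation_sum augmentation_scale)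

lemma augmentation_lin_eq:
  "(\<And>s. augmentation (\<phi> s) = c) \<Longrightarrow> augmentation (lin \<phi> f) = augmentation f * c"
  by (simp add: augmentation_lin) (simp add: augmentation_def sum_distrib_right)

lemma augmentation_bilin:
  "(\<And>s t. augmentation (\<phi> s t) = 1) \<Longrightarrow> augmentation (bilin \<phi> f g) = augmentation f * augmentation g"
  unfolding bilin_def by (intro augmentation_lin_eq) (simp add: augmentation_lin_eq)

lemma convolution_bilin: "convolution f g = bilin (\<lambda>s t. basis (s * t)) f g"
  by (simp add: convolution_def bilin_def lin_def scale_sum)

lemma convolution_simps:
  "convolution (f + f') g = convolution f g + convolution f' g"
  "convolution f (g + g') = convolution f g + convolution f g'"
  "convolution (f - f') g = convolution f g - convolution f' g"
  "convolution f (g - g') = convolution f g - convolution f g'"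
  "convolution 0 g = 0" "convolution f 0 = 0"
  "convolution (scale c f) g = scale c (convolution f g)"
  "convolution f (scale c g) = scale c (convolution f g)"
  by (simp_all add: convolution_bilin bilin_simps)

lemma convolution_sum:
  "convolution (sum f A) g = (\<Sum>i\<in>A. convolution (f i) g)"
  "convolution g' (sum f' A) = (\<Sum>i\<in>A. convolution g' (f' i))"
  by (simp_all add: convolution_bilin bilin_sum)

lemma convolution_basis: "convolution (basis s) (basis t) = basis (s * t)"
  by (simp add: convolution_single)

lemma convolution_assoc: "convolution (convolution f g) h = convolution f (convolution g h)"
  unfolding convolution_bilin by (rule bilin_assoc) (simp add: bilin_single mult.assoc)

lemma supp_convolution:
  "(\<And>s t. s \<in> supp f \<Longrightarrow> t \<in> supp g \<Longrightarrow> s * t \<in> A) \<Longrightarrow> supp (convolution f g) \<subseteq> A"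
  unfolding convolution_bilin by (intro supp_bilin) simp

lemma convolution_basis_left: "convolution (basis s) f = lin (\<lambda>t. basis (s * t)) f"
  by (simp add: convolution_bilin bilin_def)

lemma convolution_basis_right: "convolution f (basis t) = lin (\<lambda>s. basis (s * t)) f"
  by (simp add: convolution_bilin bilin_def)

lemma convolution_expand_left: "convolution f g = lin (\<lambda>s. convolution (basis s) g) f"
  by (simp add: convolution_basis_left) (simp add: convolution_bilin bilin_def)

lemma augmentation_convolution: "augmentation (convolution f g) = augmentation f * augmentation g"
  unfolding convolution_bilin by (rule augmentation_bilin) simp

text \<open>With \<open>q = coset H\<close> the target is the free module on the cosets of
  \<open>H\<close>, which stands in for the algebra of the quotient.\<close>

abbreviation push :: "('s \<Rightarrow> 't) \<Rightarrow> ('s \<Rightarrow>\<^sub>0 'r::comm_ring_1) \<Rightarrow> 't \<Rightarrow>\<^sub>0 'r"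
  where "push q \<equiv> lin (\<lambda>s. basis (q s))"

lemma coef_push: "coef (push q f) x = (\<Sum>s\<in>{s \<in> supp f. q s = x}. coef f s)"
  unfolding coef_lin by (simp add: lookup_single when_def sum.If_cases Int_def if_distrib cong: if_cong)

lemma coef_push_inj:
  assumes "inj_on q A" "supp f \<subseteq> A" "s \<in> A"
  shows "coef (push q f) (q s) = coef f s"
proof -
  have "{t \<in> supp f. q t = q s} = (if s \<in> supp f then {s} else {})"
    using assms by (auto dest: inj_onD)
  then show ?thesis
    by (simp add: coef_push in_keys_iff)
qed

lemma augmentation_push [simp]: "augmentation (push q f) = augmentation f"
  by (subst augmentation_lin_eq[where c = 1]) auto

section \<open>Inverse semigroups\<close>

definition sinv :: "'s::inverse_semigroup \<Rightarrow> 's"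
  where "sinv s = (THE t. s * t * s = s \<and> t * s * t = t)"

lemma sinv_mid [simp]: "s * sinv s * s = s" "sinv s * s * sinv s = sinv s"
  and sinv_unique: "s * t * s = s \<Longrightarrow> t * s * t = t \<Longrightarrow> sinv s = t"
proof -
  have "s * sinv s * s = s \<and> sinv s * s * sinv s = sinv s"
    unfolding sinv_def by (rule theI'[OF ex1_inverse])
  then show "s * sinv s * s = s" "sinv s * s * sinv s = sinv s" by auto
  then show "s * t * s = s \<Longrightarrow> t * s * t = t \<Longrightarrow> sinv s = t"
    using ex1_inverse[of s] by blast
qed

lemma sinv_mid_assoc [simp]:
  "s * (sinv s * s) = s" "sinv s * (s * sinv s) = sinv s"
  "s * (sinv s * (s * x)) = s * x" "sinv s * (s * (sinv s * x)) = sinv s * x"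
  using sinv_mid[of s] by (simp_all add: mult.assoc[symmetric])

lemma sinv_sinv [simp]: "sinv (sinv s) = s"
  by (rule sinv_unique) simp_all

lemma sinv_idem: "e * e = e \<Longrightarrow> sinv e = e"
  by (rule sinv_unique) simp_all

text \<open>Let \<open>x\<close> be the inverse of \<open>e f\<close>. As \<open>f x e\<close> is an
  inverse of \<open>e f\<close> too, uniqueness gives \<open>x = f x e\<close>; this makes
  \<open>x\<close> idempotent, hence its own inverse, hence equal to \<open>e f\<close>.\<close>

lemma idem_mult_idem:
  fixes e f :: "'s::inverse_semigroup"
  assumes e: "e * e = e" and f: "f * f = f"
  shows "(e * f) * (e * f) = e * f"
proof -
  define x where "x = sinv (e * f)"
  have ee: "e * (e * y) = e * y" and ff: "f * (f * y) = f * y" for y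
    using e f by (simp_all add: mult.assoc[symmetric])
  have x1: "e * (f * (x * (e * f))) = e * f" and x2: "x * (e * (f * x)) = x"
    using sinv_mid[of "e * f"] by (simp_all add: x_def mult.assoc)
  have x2': "x * (e * (f * (x * y))) = x * y" for y
    using x2 by (metis mult.assoc)
  have "x = f * x * e"
    unfolding x_def by (rule sinv_unique, fold x_def) (use x1 x2' in \<open>simp_all add: mult.assoc ee ff e f\<close>)
  then have "x * x = f * (x * (e * (f * x))) * e"
    by (metis mult.assoc)
  also have "\<dots> = x"
    using x2 \<open>x = f * x * e\<close> by simp
  finally have xx: "x * x = x" .
  then have "sinv x = x"
    by (rule sinv_idem)
  then have "x = e * f"
    by (simp add: x_def)
  then show ?thesis
    using xx by simp
qed

text \<open>\<open>f e\<close> is an inverse of \<open>e f\<close>, but the idempotent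
  \<open>e f\<close> is its own inverse, and inverses are unique.\<close>

lemma idem_commute:
  fixes e f :: "'s::inverse_semigroup"
  assumes e: "e * e = e" and f: "f * f = f"
  shows "e * f = f * e"
proof -
  have ee: "e * (e * y) = e * y" and ff: "f * (f * y) = f * y" for y
    using e f by (simp_all add: mult.assoc[symmetric])
  have "e * (f * (e * f)) = e * f" "f * (e * (f * e)) = f * e"
    using idem_mult_idem[OF e f] idem_mult_idem[OF f e] by (simp_all add: mult.assoc)
  then have "sinv (e * f) = f * e"
    by (intro sinv_unique) (simp_all add: mult.assoc ee ff)
  moreover have "sinv (e * f) = e * f"
    by (rule sinv_idem[OF idem_mult_idem[OF e f]])
  ultimately show ?thesis by simp
qed

text \<open>For partial bijections these are the identities on the domain and on the range of
  \<open>s\<close>; later they are the source and the target of \<open>s\<close> as an arrow of the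
  groupoid.\<close>

abbreviation dm :: "'s::inverse_semigroup \<Rightarrow> 's" where "dm s \<equiv> sinv s * s"

abbreviation rg :: "'s::inverse_semigroup \<Rightarrow> 's" where "rg s \<equiv> s * sinv s"

lemma idempotents_iff: "e \<in> idempotents \<longleftrightarrow> e * e = e"
  by (simp add: idempotents_def)

lemma dm_idem [simp]: "dm s * dm s = dm s" and rg_idem [simp]: "rg s * rg s = rg s"
  by (simp_all add: mult.assoc)

lemma dm_in [simp]: "dm s \<in> idempotents" and rg_in [simp]: "rg s \<in> idempotents"
  by (simp_all only: idempotents_iff dm_idem rg_idem)

lemma sinv_mult: "sinv (s * t) = sinv t * sinv s"
proof (rule sinv_unique)
  \<comment> \<open>The two idempotents meeting in the middle commute; after the swap each stands
    next to the factor that absorbs it.\<close>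
  have c: "rg t * (dm s * y) = dm s * (rg t * y)" for y
    using idem_commute[OF rg_idem[of t] dm_idem[of s]] by (metis mult.assoc)
  have "s * t * (sinv t * sinv s) * (s * t) = s * (rg t * (dm s * t))"
    by (simp add: mult.assoc)
  also have "\<dots> = s * (dm s * (rg t * t))"
    by (simp only: c)
  finally show "s * t * (sinv t * sinv s) * (s * t) = s * t"
    by (simp add: mult.assoc)
  have c': "dm s * (rg t * y) = rg t * (dm s * y)" for y
    using c by simp
  have "sinv t * sinv s * (s * t) * (sinv t * sinv s) = sinv t * (dm s * (rg t * sinv s))"
    by (simp add: mult.assoc)
  also have "\<dots> = sinv t * (rg t * (dm s * sinv s))"
    by (simp only: c')
  finally show "sinv t * sinv s * (s * t) * (sinv t * sinv s) = sinv t * sinv s"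
    by (simp add: mult.assoc)
qed

text \<open>Green's H-class of \<open>e\<close>. For an idempotent \<open>e\<close> it is the group
  of units of \<open>eSe\<close>, described without reference to a monoid record.\<close>

definition hclass :: "'s::inverse_semigroup \<Rightarrow> 's set"
  where "hclass e = {s. rg s = e \<and> dm s = e}"

lemma hclassD:
  assumes "s \<in> hclass e"
  shows "s * sinv s = e" "sinv s * s = e" "e * s = s" "s * e = s" "e * e = e"
proof -
  show rd: "s * sinv s = e" "sinv s * s = e"
    using assms by (auto simp: hclass_def)
  show "e * s = s"
    unfolding rd(1)[symmetric] by simp
  show "s * e = s"
    unfolding rd(2)[symmetric] by simp
  show "e * e = e"
    unfolding rd(2)[symmetric] by simp
qed

lemma hclass_group:
  assumes "e * e = e"
  shows "e \<in> hclass e" "\<And>s. s \<in> hclass e \<Longrightarrow> sinv s \<in> hclass e"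
    "\<And>s t. s \<in> hclass e \<Longrightarrow> t \<in> hclass e \<Longrightarrow> s * t \<in> hclass e"
proof -
  show "e \<in> hclass e"
    using assms by (simp add: hclass_def sinv_idem)
  show "sinv s \<in> hclass e" if "s \<in> hclass e" for s
    using hclassD[OF that] by (simp add: hclass_def)
  show "s * t \<in> hclass e" if s: "s \<in> hclass e" and t: "t \<in> hclass e" for s t
  proof -
    have "s * t * (sinv t * sinv s) = s * (t * sinv t) * sinv s"
      by (simp only: mult.assoc)
    moreover have "(sinv t * sinv s) * (s * t) = sinv t * (sinv s * s) * t"
      by (simp only: mult.assoc)
    ultimately show ?thesis
      using hclassD[OF s] hclassD[OF t] by (simp add: hclass_def sinv_mult mult.assoc)
  qed
qed

lemma hclassI:
  assumes "e * e = e" "s * t = e" "t * s = e" "e * s = s" "e * t = t" "t * e = t"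
  shows "s \<in> hclass e" "sinv s = t"
proof -
  show "sinv s = t"
    by (rule sinv_unique) (use assms in \<open>simp_all add: mult.assoc\<close>)
  then show "s \<in> hclass e"
    using assms by (simp add: hclass_def)
qed

lemma Units_local_monoid:
  fixes e :: "'s::inverse_semigroup"
  assumes e: "e * e = e"
  shows "Units (local_monoid e) = hclass e"
proof
  have ee: "e * (e * y) = e * y" for y
    using e by (simp add: mult.assoc[symmetric])
  show "Units (local_monoid e) \<subseteq> hclass e"
  proof
    fix s assume "s \<in> Units (local_monoid e)"
    then obtain s' t t' where "s = e * s' * e" "t = e * t' * e" "s * t = e" "t * s = e"
      by (auto simp: Units_def local_monoid_def)
    moreover from this(1,2) have "e * s = s" "e * t = t" "t * e = t"
      using e by (simp_all add: mult.assoc ee)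
    ultimately show "s \<in> hclass e"
      using hclassI(1)[OF e] by blast
  qed
  show "hclass e \<subseteq> Units (local_monoid e)"
  proof
    fix s assume s: "s \<in> hclass e"
    have eq: "s = e * s * e" "sinv s = e * sinv s * e"
      using hclassD[OF s] hclassD[OF hclass_group(2)[OF e s]] by simp_all
    have "s \<in> carrier (local_monoid e)" "sinv s \<in> carrier (local_monoid e)"
      unfolding local_monoid_def using eq by fastforce+
    then show "s \<in> Units (local_monoid e)"
      unfolding Units_def using hclassD(1,2)[OF s] by (auto simp: local_monoid_def)
  qed
qed

lemma maximal_subgroups_eq: "maximal_subgroups = hclass ` idempotents"
proof -
  have "maximal_subgroups = (\<lambda>e :: 'a. Units (local_monoid e)) ` idempotents"
    by (auto simp: maximal_subgroups_def)
  also have "\<dots> = hclass ` idempotents"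
    by (rule image_cong) (simp_all add: Units_local_monoid idempotents_iff)
  finally show ?thesis .
qed

definition subgrp :: "'s::inverse_semigroup \<Rightarrow> 's set \<Rightarrow> bool"
  where "subgrp e G \<longleftrightarrow>
    G \<subseteq> hclass e \<and> e \<in> G \<and> (\<forall>s\<in>G. sinv s \<in> G) \<and> (\<forall>s\<in>G. \<forall>t\<in>G. s * t \<in> G)"

lemma subgrp_hclass: "e * e = e \<Longrightarrow> subgrp e (hclass e)"
  by (simp add: subgrp_def hclass_group)

lemma subgrpD:
  assumes "subgrp e G"
  shows "e \<in> G" "e * e = e" "\<And>s. s \<in> G \<Longrightarrow> sinv s \<in> G" "\<And>s t. s \<in> G \<Longrightarrow> t \<in> G \<Longrightarrow> s * t \<in> G"
    "\<And>s. s \<in> G \<Longrightarrow> s * sinv s = e" "\<And>s. s \<in> G \<Longrightarrow> sinv s * s = e"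
    "\<And>s. s \<in> G \<Longrightarrow> e * s = s" "\<And>s. s \<in> G \<Longrightarrow> s * e = s"
    "\<And>s x. s \<in> G \<Longrightarrow> s * (sinv s * x) = e * x" "\<And>s x. s \<in> G \<Longrightarrow> sinv s * (s * x) = e * x"
    "\<And>x. e * (e * x) = e * x"
proof -
  show 1: "e \<in> G" "\<And>s. s \<in> G \<Longrightarrow> sinv s \<in> G" "\<And>s t. s \<in> G \<Longrightarrow> t \<in> G \<Longrightarrow> s * t \<in> G"
    using assms by (auto simp: subgrp_def)
  have H: "s \<in> hclass e" if "s \<in> G" for s
    using assms that by (auto simp: subgrp_def)
  show "e * e = e"
    using hclassD(5)[OF H[OF 1(1)]] .
  then show "\<And>x. e * (e * x) = e * x"
    by (simp add: mult.assoc[symmetric])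
  show *: "\<And>s. s \<in> G \<Longrightarrow> s * sinv s = e" "\<And>s. s \<in> G \<Longrightarrow> sinv s * s = e"
    "\<And>s. s \<in> G \<Longrightarrow> e * s = s" "\<And>s. s \<in> G \<Longrightarrow> s * e = s"
    by (simp_all add: hclassD[OF H])
  show "\<And>s x. s \<in> G \<Longrightarrow> s * (sinv s * x) = e * x" "\<And>s x. s \<in> G \<Longrightarrow> sinv s * (s * x) = e * x"
    using * by (simp_all add: mult.assoc[symmetric])
qed

text \<open>If there is some arrow \<open>x\<close> from \<open>f\<close> to \<open>e\<close>, then
  every such arrow is \<open>h x\<close> with \<open>h\<close> in \<open>hclass e\<close>; and there
  are only finitely many pairs of idempotents.\<close>

lemma finite_inverse_semigroup:
  assumes "finite (idempotents :: 's::inverse_semigroup set)"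
    and "\<And>e. e \<in> idempotents \<Longrightarrow> finite (hclass (e :: 's))"
  shows "finite (UNIV :: 's set)"
proof -
  have fin: "finite {s :: 's. rg s = e \<and> dm s = f}" if "e \<in> idempotents" for e f
  proof (cases "{s :: 's. rg s = e \<and> dm s = f} = {}")
    case False
    then obtain x :: 's where x: "rg x = e" "dm x = f" by blast
    have "s * sinv x \<in> hclass e \<and> s = (s * sinv x) * x" if s: "rg s = e" "dm s = f" for s :: 's
    proof -
      have "s * dm x * sinv s = e" "x * dm s * sinv x = e"
      proof -
        have "y * dm y * sinv y = rg y" for y :: 's
          by (simp add: mult.assoc)
        from this[of s] this[of x] show "s * dm x * sinv s = e" "x * dm s * sinv x = e"
          by (simp_all only: x s)
      qed
      then have "s * sinv x * (x * sinv s) = e" "x * sinv s * (s * sinv x) = e"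
        by (simp_all only: mult.assoc)
      moreover have "s = (s * sinv x) * x"
        using x s by (metis mult.assoc sinv_mid(1))
      ultimately show ?thesis
        by (simp add: hclass_def sinv_mult)
    qed
    then have "{s :: 's. rg s = e \<and> dm s = f} \<subseteq> (\<lambda>h. h * x) ` hclass e"
      by blast
    then show ?thesis
      using assms(2)[OF that] finite_surj by blast
  qed (simp only: finite.emptyI)
  have "(UNIV :: 's set) = (\<Union>e\<in>idempotents. \<Union>f\<in>idempotents. {s. rg s = e \<and> dm s = f})"
    by auto
  also have "finite \<dots>"
    using assms(1) fin by blast
  finally show ?thesis .
qed

section \<open>Chain conditions for semigroup algebras\<close>

definition alg :: "'s set \<Rightarrow> ('s \<Rightarrow>\<^sub>0 'r::comm_ring_1) set"
  where "alg G = {f. supp f \<subseteq> G}"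

lemma alg_UNIV [simp]: "alg UNIV = UNIV"
  by (simp add: alg_def)

lemma left_ideal_iff_lideal:
  fixes A :: "('m::ab_group_add, 'n) ring_scheme"
  assumes A: "add A = (+)" "\<zero>\<^bsub>A\<^esub> = 0" and closed: "\<And>x. x \<in> carrier A \<Longrightarrow> - x \<in> carrier A"
  shows "left_ideal A I \<longleftrightarrow> lideal (monoid.mult A) (carrier A) I"
proof -
  have inv: "inv\<^bsub>add_monoid A\<^esub> x = - x" if "x \<in> carrier A" for x
    unfolding m_inv_def
  proof (rule the_equality)
    show "- x \<in> carrier (add_monoid A) \<and> x \<otimes>\<^bsub>add_monoid A\<^esub> - x = \<one>\<^bsub>add_monoid A\<^esub> \<and>
      - x \<otimes>\<^bsub>add_monoid A\<^esub> x = \<one>\<^bsub>add_monoid A\<^esub>"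
      using that by (simp add: A closed)
  qed (simp add: A eq_neg_iff_add_eq_0 add.commute)
  have "additive_subgroup I A \<longleftrightarrow> I \<subseteq> carrier A \<and> 0 \<in> I \<and> (\<forall>x\<in>I. \<forall>y\<in>I. x - y \<in> I)"
  proof
    assume "additive_subgroup I A"
    then interpret subgroup I "add_monoid A"
      by (simp add: additive_subgroup_def)
    have sub: "I \<subseteq> carrier A" and zero: "0 \<in> I"
      using subset one_closed by (simp_all add: A)
    have "x - y \<in> I" if "x \<in> I" "y \<in> I" for x y
    proof -
      have "y \<in> carrier A"
        using that sub by blast
      then have "- y \<in> I"
        using m_inv_closed[OF that(2)] by (simp only: inv)
      then have "x \<otimes>\<^bsub>add_monoid A\<^esub> (- y) \<in> I"
        by (rule m_closed[OF that(1)])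
      then show ?thesis by (simp add: A)
    qed
    then show "I \<subseteq> carrier A \<and> 0 \<in> I \<and> (\<forall>x\<in>I. \<forall>y\<in>I. x - y \<in> I)"
      using sub zero by blast
  next
    assume I: "I \<subseteq> carrier A \<and> 0 \<in> I \<and> (\<forall>x\<in>I. \<forall>y\<in>I. x - y \<in> I)"
    then have neg: "- x \<in> I" if "x \<in> I" for x
      using that by (metis diff_0)
    have add: "x + y \<in> I" if "x \<in> I" "y \<in> I" for x y
      using I neg[OF that(2)] that(1) by (metis diff_minus_eq_add)
    show "additive_subgroup I A"
      by (unfold_locales) (use I neg add inv in \<open>auto simp: A\<close>)
  qed
  then show ?thesis
    by (auto simp: left_ideal_def lideal_def)
qed

lemma left_ideal_semigroup_algebra:
  "left_ideal (semigroup_algebra R G) I \<longleftrightarrow> lideal convolution (alg G) I"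
proof -
  have "left_ideal (semigroup_algebra R G) I \<longleftrightarrow>
      lideal (monoid.mult (semigroup_algebra R G)) (carrier (semigroup_algebra R G)) I"
    by (rule left_ideal_iff_lideal) (auto simp: semigroup_algebra_def in_keys_iff)
  then show ?thesis
    by (simp add: semigroup_algebra_def alg_def)
qed

lemma left_ideal_ring_of_type:
  "left_ideal (ring_of_type_algebra :: 'r::comm_ring_1 ring) I \<longleftrightarrow> lideal (*) UNIV I"
proof -
  have "left_ideal (ring_of_type_algebra :: 'r ring) I \<longleftrightarrow>
      lideal (monoid.mult ring_of_type_algebra) (carrier (ring_of_type_algebra :: 'r ring)) I"
    by (rule left_ideal_iff_lideal) (auto simp: ring_of_type_algebra_def)
  then show ?thesis
    by (simp add: ring_of_type_algebra_def)
qed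

lemma chain_condition_cong:
  assumes "\<And>I. left_ideal A I \<longleftrightarrow> lideal m C I"
  shows "left_noetherian A \<longleftrightarrow> chain_condition True m C"
    and "left_artinian A \<longleftrightarrow> chain_condition False m C"
  by (simp_all add: left_noetherian_def left_artinian_def chain_condition_def set_chain_def
      stabilizes_def assms)

lemma left_noetherian_iff:
  "left_noetherian (semigroup_algebra (R :: 'r::comm_ring_1 itself) G) \<longleftrightarrow>
     chain_condition True convolution (alg G :: ('s::semigroup_mult \<Rightarrow>\<^sub>0 'r) set)"
  by (rule chain_condition_cong(1)[OF left_ideal_semigroup_algebra])

lemma left_artinian_iff:
  "left_artinian (semigroup_algebra (R :: 'r itself) G) \<longleftrightarrow>
     chain_condition False convolution (alg G :: ('s::semigroup_mult \<Rightarrow>\<^sub>0 'r) set)"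
  "left_artinian (ring_of_type_algebra :: 'r::comm_ring_1 ring) \<longleftrightarrow>
     chain_condition False ((*) :: 'r \<Rightarrow> 'r \<Rightarrow> 'r) UNIV"
  by (rule chain_condition_cong(2)[OF left_ideal_semigroup_algebra],
      rule chain_condition_cong(2)[OF left_ideal_ring_of_type])

section \<open>Passage from the semigroup algebra to its coefficient ring\<close>

lemma augmentation_lideal:
  "lideal (*) UNIV I \<Longrightarrow> lideal convolution UNIV {f :: 's::semigroup_mult \<Rightarrow>\<^sub>0 'r::comm_ring_1. augmentation f \<in> I}"
  by (rule lidealI) (auto simp: augmentation_diff augmentation_convolution dest: lidealD)

lemma augmentation_image:
  "augmentation ` {f :: 's::semigroup_mult \<Rightarrow>\<^sub>0 'r::comm_ring_1. augmentation f \<in> I} = I"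
proof
  show "I \<subseteq> augmentation ` {f :: 's \<Rightarrow>\<^sub>0 'r. augmentation f \<in> I}"
  proof
    fix r assume "r \<in> I"
    \<comment> \<open>Surjectivity of the augmentation: any element of \<open>S\<close> serves as
      the basis element, here the arbitrary value \<open>undefined\<close>.\<close>
    then have "Poly_Mapping.single undefined r \<in> {f :: 's \<Rightarrow>\<^sub>0 'r. augmentation f \<in> I}"
      by simp
    then show "r \<in> augmentation ` {f :: 's \<Rightarrow>\<^sub>0 'r. augmentation f \<in> I}"
      by (metis (no_types) augmentation_single image_eqI)
  qed
qed auto

lemma coefficients_chain_condition:
  assumes "chain_condition asc convolution (UNIV :: ('s::semigroup_mult \<Rightarrow>\<^sub>0 'r::comm_ring_1) set)"
  shows "chain_condition asc ((*) :: 'r \<Rightarrow> 'r \<Rightarrow> 'r) UNIV"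
  by (rule chain_condition_transfer[OF assms augmentation_lideal, where G = "\<lambda>I. augmentation ` I"])
     (auto simp: augmentation_image mono_def)

lemma coefficients_right_units:
  assumes "right_units convolution (UNIV :: ('s::semigroup_mult \<Rightarrow>\<^sub>0 'r::comm_ring_1) set)"
  shows "right_units ((*) :: 'r \<Rightarrow> 'r \<Rightarrow> 'r) UNIV"
  unfolding right_units_def
proof (intro allI impI)
  fix I :: "'r set" assume "lideal (*) UNIV I"
  then have "lideal convolution UNIV {f :: 's \<Rightarrow>\<^sub>0 'r. augmentation f \<in> I}"
    by (rule augmentation_lideal)
  then obtain u :: "'s \<Rightarrow>\<^sub>0 'r" where u: "augmentation u \<in> I"
    "\<And>f. augmentation f \<in> I \<Longrightarrow> convolution f u = f"
    using assms unfolding right_units_def by blast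
  have "x * augmentation u = x" if "x \<in> I" for x
    using arg_cong[OF u(2)[of "Poly_Mapping.single undefined x"], of augmentation] that
    by (simp add: augmentation_convolution)
  then show "\<exists>u\<in>I. \<forall>x\<in>I. x * u = x"
    using u(1) by blast
qed

text \<open>For a subgroup \<open>G\<close> with identity \<open>e\<close>, the projection of \<open>e RS e\<close> onto \<open>RG\<close> along the basis
  is a bimodule map over \<open>RG\<close>: if \<open>g \<in> G\<close> and \<open>s \<in> eSe\<close>, then \<open>s g \<in> G\<close> only if \<open>s \<in> G\<close>.\<close>

definition corner :: "'s::inverse_semigroup \<Rightarrow> 's set \<Rightarrow> ('s \<Rightarrow>\<^sub>0 'r::comm_ring_1) \<Rightarrow> 's \<Rightarrow>\<^sub>0 'r"
  where "corner e G = lin (\<lambda>s. if e * s * e \<in> G then basis (e * s * e) else 0)"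

lemma corner_diff: "corner e G (f - g) = corner e G f - corner e G g"
  by (simp add: corner_def lin_diff)

lemma corner_lin: "corner e G (lin \<phi> f) = lin (\<lambda>s. corner e G (\<phi> s)) f"
  by (simp add: corner_def lin_lin)

lemma bilin_lin_lin:
  "bilin \<phi> (lin \<alpha> f) (lin \<beta> g) = lin (\<lambda>s. lin (\<lambda>t. bilin \<phi> (\<alpha> s) (\<beta> t)) g) f"
  unfolding bilin_lin_left unfolding bilin_lin_right ..

lemma supp_corner: "supp (corner e G f) \<subseteq> G"
  unfolding corner_def by (rule supp_lin) auto

lemma corner_id:
  assumes "subgrp e G" "supp f \<subseteq> G"
  shows "corner e G f = f"
proof -
  have "corner e G f = lin basis f"
    unfolding corner_def by (rule lin_cong) (use assms subgrpD[OF assms(1)] in auto)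
  then show ?thesis by simp
qed

lemma subgrp_cancel:
  assumes G: "subgrp e G" and g: "g \<in> G"
  shows "e * (s * g) * e \<in> G \<longleftrightarrow> e * s * e \<in> G" "e * (g * s) * e \<in> G \<longleftrightarrow> e * s * e \<in> G"
    "e * (s * g) * e = e * s * e * g" "e * (g * s) * e = g * (e * s * e)"
proof -
  note D = subgrpD[OF G]
  show 1: "e * (s * g) * e = e * s * e * g" "e * (g * s) * e = g * (e * s * e)"
    using g D(7,8)[OF g] D(2) by (simp_all add: mult.assoc) (simp_all add: mult.assoc[symmetric])
  have "e * s * e * g * sinv g = e * s * e" "sinv g * (g * (e * s * e)) = e * s * e"
    using D(2,5,6) g by (simp_all add: mult.assoc D)
  then show "e * (s * g) * e \<in> G \<longleftrightarrow> e * s * e \<in> G" "e * (g * s) * e \<in> G \<longleftrightarrow> e * s * e \<in> G"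
    unfolding 1 using D(3,4) g by metis+
qed

lemma corner_convolution:
  assumes G: "subgrp e G" and x: "supp x \<subseteq> G"
  shows "corner e G (convolution a x) = convolution (corner e G a) x"
    and "corner e G (convolution x a) = convolution x (corner e G a)"
proof -
  have "corner e G (convolution a x) = lin (\<lambda>s. lin (\<lambda>g. corner e G (basis (s * g))) x) a"
    by (simp add: convolution_bilin lin_bilin corner_def) (simp add: bilin_def)
  also have "\<dots> = lin (\<lambda>s. lin (\<lambda>g. convolution (corner e G (basis s)) (basis g)) x) a"
    by (intro lin_cong) (use x subgrp_cancel[OF G] in \<open>auto simp: corner_def convolution_basis convolution_simps subset_iff\<close>)
  also have "\<dots> = convolution (corner e G (lin basis a)) (lin basis x)"
    unfolding corner_lin convolution_bilin by (rule bilin_lin_lin[symmetric])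
  finally show "corner e G (convolution a x) = convolution (corner e G a) x"
    by simp
  have "corner e G (convolution x a) = lin (\<lambda>g. lin (\<lambda>s. corner e G (basis (g * s))) a) x"
    by (simp add: convolution_bilin lin_bilin corner_def) (simp add: bilin_def)
  also have "\<dots> = lin (\<lambda>g. lin (\<lambda>s. convolution (basis g) (corner e G (basis s))) a) x"
    by (intro lin_cong) (use x subgrp_cancel[OF G] in \<open>auto simp: corner_def convolution_basis convolution_simps subset_iff\<close>)
  also have "\<dots> = convolution (lin basis x) (corner e G (lin basis a))"
    unfolding corner_lin convolution_bilin by (rule bilin_lin_lin[symmetric])
  finally show "corner e G (convolution x a) = convolution x (corner e G a)"
    by simp
qed

lemma convolution_identity:
  assumes "subgrp e G" "supp x \<subseteq> G"
  shows "convolution (basis e) x = x" "convolution x (basis e) = x"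
proof -
  have "convolution (basis e) x = lin basis x" "convolution x (basis e) = lin basis x"
    unfolding convolution_basis_left convolution_basis_right
    by (intro lin_cong; use assms(2) subgrpD[OF assms(1)] in auto)+
  then show "convolution (basis e) x = x" "convolution x (basis e) = x" by simp_all
qed

lemma supp_group_convolution:
  "subgrp e G \<Longrightarrow> supp x \<subseteq> G \<Longrightarrow> supp y \<subseteq> G \<Longrightarrow> supp (convolution x y) \<subseteq> G"
  by (rule supp_convolution) (meson subsetD subgrpD(4))

text \<open>For a subgroup \<open>G\<close> this is the largest left ideal of \<open>RS\<close> that
  the projection \<open>corner\<close> maps into \<open>L\<close>: quantifying over all left
  multiples makes it a left ideal at once.\<close>

definition extended_ideal :: "'s::inverse_semigroup \<Rightarrow> 's set \<Rightarrow> ('s \<Rightarrow>\<^sub>0 'r::comm_ring_1) set \<Rightarrow> ('s \<Rightarrow>\<^sub>0 'r) set"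
  where "extended_ideal e G L = {f. \<forall>a. corner e G (convolution a f) \<in> L}"

text \<open>For \<open>x\<close> in \<open>L\<close> the bimodule property turns the projection of
  \<open>a x\<close> into the projection of \<open>a\<close> times \<open>x\<close>, which is in
  \<open>L\<close>. Conversely the multiple with \<open>a = basis e\<close> gives back an element of
  \<open>RG\<close> unchanged.\<close>

lemma extended_ideal:
  assumes G: "subgrp e G" and L: "lideal convolution (alg G) L"
  shows "lideal convolution UNIV (extended_ideal e G L)" "extended_ideal e G L \<inter> alg G = L"
proof -
  show "lideal convolution UNIV (extended_ideal e G L)"
  proof (rule lidealI)
    show "0 \<in> extended_ideal e G L"
      using lidealD(2)[OF L] by (simp add: extended_ideal_def convolution_simps corner_def)
    show "x - y \<in> extended_ideal e G L" if "x \<in> extended_ideal e G L" "y \<in> extended_ideal e G L" for x y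
      using that lidealD(3)[OF L] by (auto simp: extended_ideal_def convolution_simps corner_diff)
    show "convolution b x \<in> extended_ideal e G L" if "x \<in> extended_ideal e G L" for b x
      using that by (auto simp: extended_ideal_def convolution_assoc[symmetric])
  qed simp
  show "extended_ideal e G L \<inter> alg G = L"
  proof
    show "L \<subseteq> extended_ideal e G L \<inter> alg G"
    proof
      fix x assume x: "x \<in> L"
      then have "supp x \<subseteq> G"
        using lidealD(1)[OF L] by (auto simp: alg_def)
      then have "corner e G (convolution a x) \<in> L" for a
        using lidealD(6)[OF L _ x, of "corner e G a"] supp_corner[of e G a]
        by (simp add: corner_convolution[OF G] alg_def)
      then show "x \<in> extended_ideal e G L \<inter> alg G"
        using \<open>supp x \<subseteq> G\<close> by (simp add: extended_ideal_def alg_def)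
    qed
    show "extended_ideal e G L \<inter> alg G \<subseteq> L"
    proof
      fix x assume "x \<in> extended_ideal e G L \<inter> alg G"
      then have "corner e G (convolution (basis e) x) \<in> L" "supp x \<subseteq> G"
        by (auto simp: extended_ideal_def alg_def)
      then show "x \<in> L"
        by (simp add: convolution_identity[OF G] corner_id[OF G])
    qed
  qed
qed

lemma subgroup_chain_condition:
  assumes "chain_condition asc convolution (UNIV :: ('s::inverse_semigroup \<Rightarrow>\<^sub>0 'r::comm_ring_1) set)"
    and "subgrp e (G :: 's set)"
  shows "chain_condition asc convolution (alg G :: ('s \<Rightarrow>\<^sub>0 'r) set)"
proof (rule chain_condition_transfer[OF assms(1), where F = "extended_ideal e G" and G = "\<lambda>I. I \<inter> alg G"])
  fix I :: "('s \<Rightarrow>\<^sub>0 'r) set" assume I: "lideal convolution (alg G) I"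
  show "lideal convolution UNIV (extended_ideal e G I)" "extended_ideal e G I \<inter> alg G = I"
    using extended_ideal[OF assms(2) I] by auto
qed (auto simp: mono_def extended_ideal_def)

lemma subgroup_right_units:
  assumes "right_units convolution (UNIV :: ('s::inverse_semigroup \<Rightarrow>\<^sub>0 'r::comm_ring_1) set)"
    and G: "subgrp e (G :: 's set)"
  shows "right_units convolution (alg G :: ('s \<Rightarrow>\<^sub>0 'r) set)"
  unfolding right_units_def
proof (intro allI impI)
  fix L :: "('s \<Rightarrow>\<^sub>0 'r) set" assume L: "lideal convolution (alg G) L"
  note ext = extended_ideal[OF G L]
  obtain u where u: "u \<in> extended_ideal e G L"
    "\<And>x. x \<in> extended_ideal e G L \<Longrightarrow> convolution x u = x"
    using assms(1) ext(1) unfolding right_units_def by blast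
  \<comment> \<open>The right unit \<open>u\<close> of the extended ideal need not lie in
    \<open>RG\<close>. Its projection still works, because projecting commutes with left
    multiplication by elements of \<open>RG\<close>.\<close>
  define v where "v = corner e G (convolution (basis e) u)"
  have "v \<in> L"
    using u(1) by (simp add: v_def extended_ideal_def)
  moreover have "convolution x v = x" if "x \<in> L" for x
  proof -
    have x: "supp x \<subseteq> G" "x \<in> extended_ideal e G L"
      using that ext(2) by (auto simp: alg_def)
    then have "convolution x v = corner e G (convolution x u)"
      by (simp add: v_def corner_convolution(2)[OF G, symmetric] convolution_assoc[symmetric]
          convolution_identity[OF G])
    then show ?thesis
      by (simp add: u(2) x corner_id[OF G])
  qed
  ultimately show "\<exists>u\<in>L. \<forall>x\<in>L. convolution x u = x" by blast
qed

section \<open>Infinitely many idempotents violate both chain conditions\<close>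

lemma idempotent_sequence:
  assumes "infinite (idempotents :: 's::inverse_semigroup set)"
  obtains d :: "nat \<Rightarrow> 's::inverse_semigroup" where "\<And>n. d n * d n = d n" "inj d"
    "(\<forall>i j. i < j \<longrightarrow> d i * d j = d i) \<or> (\<forall>i j. i < j \<longrightarrow> d i * d j = d j) \<or> (\<forall>i j. i \<noteq> j \<longrightarrow> d i * d j \<noteq> d i)"
proof -
  obtain c :: "nat \<Rightarrow> 's" where c: "inj c" "range c \<subseteq> idempotents"
    using infinite_countable_subset[OF assms] by blast
  have idem: "c n * c n = c n" for n
    using c(2) idempotents_iff[of "c n"] by blast
  have comm: "c i * c j = c j * c i" for i j
    by (rule idem_commute[OF idem idem])
  \<comment> \<open>Colours of a pair \<open>i < j\<close> in the semilattice order: 0 if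
    \<open>c i\<close> is below \<open>c j\<close>, 1 if above, 2 if incomparable. Ramsey colours
    unordered pairs, hence the use of \<open>Min\<close> and \<open>Max\<close>.\<close>
  define col where "col U = (let i = Min U; j = Max U in
    if c i * c j = c i then 0 else if c i * c j = c j then 1 else (2::nat))" for U
  have "\<exists>Y t. Y \<subseteq> UNIV \<and> infinite Y \<and> t < 3 \<and> (\<forall>x\<in>Y. \<forall>y\<in>Y. x \<noteq> y \<longrightarrow> col {x, y} = t)"
    by (rule Ramsey2) (auto simp: col_def Let_def)
  then obtain Y t where Y: "infinite Y" "\<forall>x\<in>Y. \<forall>y\<in>Y. x \<noteq> y \<longrightarrow> col {x, y} = t"
    by blast
  define d where "d n = c (enumerate Y n)" for n
  have en: "enumerate Y i \<in> Y" "i < j \<Longrightarrow> enumerate Y i < enumerate Y j" for i j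
    using Y(1) by (simp_all add: enumerate_in_set)
  have t: "t = (if d i * d j = d i then 0 else if d i * d j = d j then 1 else 2)" if "i < j" for i j
  proof -
    have "t = col {enumerate Y i, enumerate Y j}"
      using Y(2) en that by (metis less_irrefl)
    moreover have mm: "Min {enumerate Y i, enumerate Y j} = enumerate Y i"
      "Max {enumerate Y i, enumerate Y j} = enumerate Y j"
      using en(2)[OF that] by simp_all
    ultimately show ?thesis
      by (simp only: col_def Let_def d_def)
  qed
  show thesis
  proof (rule that[of d])
    show "d n * d n = d n" for n
      by (simp add: d_def idem)
    show "inj d"
      unfolding d_def inj_def using c(1) Y(1) en(2) by (metis injD nat_neq_iff)
    have "d i * d j = d j * d i" for i j
      by (simp add: d_def comm)
    then have "d i * d j \<noteq> d i" if "t = 2" "i \<noteq> j" for i j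
      using t[of i j] t[of j i] that by (metis nat_neq_iff numeral_eq_iff zero_neq_numeral one_eq_numeral_iff semiring_norm(85))
    moreover have "d i * d j = d i" if "t = 0" "i < j" for i j
      using t[of i j] that by (auto split: if_splits)
    moreover have "d i * d j = d j" if "t = 1" "i < j" for i j
      using t[of i j] that by (auto split: if_splits)
    moreover have "t = 0 \<or> t = 1 \<or> t = 2"
      using t[of 0 1] by (auto split: if_splits)
    ultimately show "(\<forall>i j. i < j \<longrightarrow> d i * d j = d i) \<or> (\<forall>i j. i < j \<longrightarrow> d i * d j = d j) \<or>
        (\<forall>i j. i \<noteq> j \<longrightarrow> d i * d j \<noteq> d i)"
      by blast
  qed
qed

lemma fixed_lideal: "lideal convolution UNIV {f. convolution f a = f}"
  and annihilator_lideal: "lideal convolution UNIV {f. convolution f a = 0}"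
  by (rule lidealI; simp add: convolution_simps convolution_assoc)+

text \<open>For an idempotent \<open>e\<close> the condition \<open>s * e = s\<close> says that
  \<open>s\<close> lies in \<open>Se\<close>; for a set \<open>U\<close> of idempotents this is
  therefore the left ideal \<open>SU\<close> of the semigroup.\<close>

definition right_fixed :: "'s::semigroup_mult set \<Rightarrow> 's set"
  where "right_fixed U = (\<Union>e\<in>U. {s. s * e = s})"

lemma order_ideal_lideal:
  "lideal convolution UNIV (alg (right_fixed U) :: ('s::semigroup_mult \<Rightarrow>\<^sub>0 'r::comm_ring_1) set)"
proof (rule lidealI)
  have mult: "s * t \<in> right_fixed U" if "t \<in> right_fixed U" for s t
    using that by (auto simp: right_fixed_def mult.assoc) (metis)
  fix a x :: "'s \<Rightarrow>\<^sub>0 'r"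
  assume "x \<in> alg (right_fixed U)"
  then have "supp (convolution a x) \<subseteq> right_fixed U"
    by (intro supp_convolution mult) (auto simp: alg_def)
  then show "convolution a x \<in> alg (right_fixed U)"
    by (simp add: alg_def)
qed (auto simp: alg_def intro: supp_diff_subset[THEN subsetD])

text \<open>Each type of sequence supplies a strictly ascending and a strictly descending chain, so
  that one proof covers both values of \<open>asc\<close>. For monotone sequences these are the left
  ideals \<open>K n\<close> fixed by \<open>d n\<close> on the right and the annihilators
  \<open>N n\<close>, which move in opposite directions; for an antichain they are the ideals
  generated by initial segments and by tails.\<close>

lemma finite_idempotents:
  assumes "chain_condition asc convolution (UNIV :: ('s::inverse_semigroup \<Rightarrow>\<^sub>0 'r::comm_ring_1) set)"
  shows "finite (idempotents :: 's set)"
proof (rule ccontr)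
  assume "infinite (idempotents :: 's set)"
  then show False
  proof (rule idempotent_sequence)
    fix d :: "nat \<Rightarrow> 's" assume idem: "\<And>n. d n * d n = d n" and "inj d" and
      d: "(\<forall>i j. i < j \<longrightarrow> d i * d j = d i) \<or> (\<forall>i j. i < j \<longrightarrow> d i * d j = d j) \<or> (\<forall>i j. i \<noteq> j \<longrightarrow> d i * d j \<noteq> d i)"
    have ne: "d i \<noteq> d j" if "i \<noteq> j" for i j
      using \<open>inj d\<close> that by (auto dest: injD)
    have ne1: "d (Suc n) \<noteq> d n" "d n \<noteq> d (Suc n)" for n
      by (simp_all add: ne)
    define u :: "nat \<Rightarrow> 's \<Rightarrow>\<^sub>0 'r" where "u n = basis (d n)" for n
    define K :: "nat \<Rightarrow> ('s \<Rightarrow>\<^sub>0 'r) set" where "K n = {f. convolution f (u n) = f}" for n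
    define N :: "nat \<Rightarrow> ('s \<Rightarrow>\<^sub>0 'r) set" where "N n = {f. convolution f (u n) = 0}" for n
    define D :: "'s set \<Rightarrow> ('s \<Rightarrow>\<^sub>0 'r) set"
      where "D U = alg (right_fixed U)" for U
    have KND: "lideal convolution UNIV (K n)" "lideal convolution UNIV (N n)" "lideal convolution UNIV (D U)" for n U
      by (simp_all add: K_def N_def D_def fixed_lideal annihilator_lideal order_ideal_lideal)
    have uu: "convolution (u i) (u j) = basis (d i * d j)" for i j
      by (simp add: u_def convolution_basis)
    have u_ne: "u (Suc n) - u n \<noteq> 0" "u n - u (Suc n) \<noteq> 0" for n
      unfolding u_def right_minus_eq by (metis lookup_single_eq lookup_single_not_eq ne1 zero_neq_one)+
    have comm: "d i * d j = d j * d i" for i j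
      by (rule idem_commute[OF idem idem])
    from d consider (inc) "\<And>i j. i < j \<Longrightarrow> d i * d j = d i" | (dec) "\<And>i j. i < j \<Longrightarrow> d i * d j = d j"
      | (anti) "\<And>i j. i \<noteq> j \<Longrightarrow> d i * d j \<noteq> d i"
      by blast
    then show False
    proof cases
      case inc
      have prods: "d n * d (Suc n) = d n" "d (Suc n) * d n = d n" for n
        using inc[of n "Suc n"] comm by simp_all
      have "K n \<subset> K (Suc n)" for n
      proof
        show "K n \<subseteq> K (Suc n)"
          unfolding K_def by clarsimp (metis convolution_assoc prods(1) u_def uu)
        have "u (Suc n) \<in> K (Suc n)" "u (Suc n) \<notin> K n"
          using u_ne by (simp_all add: K_def uu idem prods u_def[symmetric])
        then show "K n \<noteq> K (Suc n)" by blast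
      qed
      moreover have "N (Suc n) \<subset> N n" for n
      proof
        show "N (Suc n) \<subseteq> N n"
          unfolding N_def by clarsimp (metis convolution_assoc convolution_simps(5) prods(2) u_def uu)
        have "u (Suc n) - u n \<in> N n" "u (Suc n) - u n \<notin> N (Suc n)"
          using u_ne by (simp_all add: N_def uu idem prods u_def[symmetric] convolution_simps)
        then show "N (Suc n) \<noteq> N n" by blast
      qed
      ultimately show False
        using no_strict_chain[OF assms, of K] no_strict_chain[OF assms, of N] KND by (cases asc) auto
    next
      case dec
      have prods: "d n * d (Suc n) = d (Suc n)" "d (Suc n) * d n = d (Suc n)" for n
        using dec[of n "Suc n"] comm by simp_all
      have "K (Suc n) \<subset> K n" for n
      proof
        show "K (Suc n) \<subseteq> K n"
          unfolding K_def by clarsimp (metis convolution_assoc prods(2) u_def uu)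
        have "u n \<in> K n" "u n \<notin> K (Suc n)"
          using u_ne by (simp_all add: K_def uu idem prods u_def[symmetric])
        then show "K (Suc n) \<noteq> K n" by blast
      qed
      moreover have "N n \<subset> N (Suc n)" for n
      proof
        show "N n \<subseteq> N (Suc n)"
          unfolding N_def by clarsimp (metis convolution_assoc convolution_simps(5) prods(1) u_def uu)
        have "u n - u (Suc n) \<in> N (Suc n)" "u n - u (Suc n) \<notin> N n"
          using u_ne by (simp_all add: N_def uu idem prods u_def[symmetric] convolution_simps)
        then show "N n \<noteq> N (Suc n)" by blast
      qed
      ultimately show False
        using no_strict_chain[OF assms, of K] no_strict_chain[OF assms, of N] KND by (cases asc) auto
    next
      case anti
      \<comment> \<open>In an antichain \<open>d n\<close> is fixed on the right by no
        \<open>d i\<close> with \<open>i\<close> different from \<open>n\<close>, so the generated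
        ideal remembers its index set.\<close>
      have D_iff: "u n \<in> D (d ` U) \<longleftrightarrow> n \<in> U" for n U
        using idem by (auto simp: D_def u_def alg_def right_fixed_def) (metis anti)
      have "U \<subseteq> V \<Longrightarrow> right_fixed U \<subseteq> right_fixed V" for U V :: "'s set"
        by (auto simp: right_fixed_def)
      then have D_mono: "U \<subseteq> V \<Longrightarrow> D U \<subseteq> D V" for U V
        unfolding D_def alg_def by blast
      have "D (d ` {..n}) \<subset> D (d ` {..Suc n})" "D (d ` {Suc n..}) \<subset> D (d ` {n..})" for n
        using D_iff[of "Suc n" "{..n}"] D_iff[of "Suc n" "{..Suc n}"]
          D_iff[of n "{n..}"] D_iff[of n "{Suc n..}"]
        by (auto intro!: D_mono psubsetI image_mono)
      then show False
        using no_strict_chain[OF assms, of "\<lambda>n. D (d ` {..n})"]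
          no_strict_chain[OF assms, of "\<lambda>n. D (d ` {n..})"] KND by (cases asc) auto
    qed
  qed
qed

section \<open>Subgroups of an inverse semigroup whose algebra is Artinian are finite\<close>

definition coset :: "'s::semigroup_mult set \<Rightarrow> 's \<Rightarrow> 's set"
  where "coset H x = (\<lambda>h. x * h) ` H"

lemma coset_mult_left: "coset H (g * x) = (\<lambda>y. g * y) ` coset H x"
  by (auto simp: coset_def mult.assoc image_image)

lemma coset_self: "subgrp e H \<Longrightarrow> x * e = x \<Longrightarrow> x \<in> coset H x"
  unfolding coset_def using subgrpD(1) by (metis image_eqI)

lemma coset_absorb:
  assumes H: "subgrp e H" and h: "h \<in> H"
  shows "coset H (x * h) = coset H x"
proof -
  note D = subgrpD[OF H]
  have "x * h * k \<in> coset H x" if "k \<in> H" for k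
    using D(4)[OF h that] by (auto simp: coset_def mult.assoc)
  moreover have "x * k \<in> coset H (x * h)" if "k \<in> H" for k
  proof -
    have "x * k = x * h * (sinv h * k)"
      using D(7)[OF that] D(9)[OF h] by (simp add: mult.assoc)
    moreover have "sinv h * k \<in> H"
      using D(3,4) h that by blast
    ultimately show ?thesis
      unfolding coset_def by blast
  qed
  ultimately show ?thesis
    by (auto simp: coset_def)
qed

lemma coset_eq_iff:
  assumes H: "subgrp e H" and "x * e = x" "y * e = y"
  shows "coset H x = coset H y \<longleftrightarrow> (\<exists>h\<in>H. x = y * h)"
proof
  assume "coset H x = coset H y"
  then have "x \<in> coset H y"
    using coset_self[OF H assms(2)] by simp
  then show "\<exists>h\<in>H. x = y * h"
    by (auto simp: coset_def)
qed (use coset_absorb[OF H] in auto)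

definition prime_ideal :: "'r::comm_ring_1 set \<Rightarrow> bool"
  where "prime_ideal P \<longleftrightarrow> lideal (*) UNIV P \<and> 1 \<notin> P \<and> (\<forall>a b. a * b \<in> P \<longrightarrow> a \<in> P \<or> b \<in> P)"

text \<open>The annihilator of a minimal nonzero ideal \<open>I\<close> is prime: \<open>b I\<close>
  is either 0 or all of \<open>I\<close>, and in the second case \<open>a b I = 0\<close> means
  \<open>a I = 0\<close>.\<close>

lemma artinian_prime_ideal:
  assumes "chain_condition False ((*) :: 'r::comm_ring_1 \<Rightarrow> 'r \<Rightarrow> 'r) UNIV"
  obtains P :: "'r::comm_ring_1 set" where "prime_ideal P"
proof -
  let ?J = "{I :: 'r set. lideal (*) UNIV I \<and> I \<noteq> {0}}"
  have "(UNIV :: 'r set) \<noteq> {0}"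
    by (metis UNIV_I singletonD zero_neq_one)
  then have "UNIV \<in> ?J"
    by (auto simp: lideal_def)
  then have "\<exists>I\<in>?J. \<forall>J\<in>?J. J \<subseteq> I \<longrightarrow> J = I"
    by (rule descending_minimal[OF assms]) simp
  then obtain I where I: "I \<in> ?J" and min: "\<forall>J\<in>?J. J \<subseteq> I \<longrightarrow> J = I"
    by blast
  have li: "lideal (*) UNIV I"
    using I by simp
  have mult: "(\<lambda>x. a * x) ` I = {0} \<or> (\<lambda>x. a * x) ` I = I" for a
  proof -
    have "lideal (*) UNIV ((\<lambda>x. a * x) ` I)"
    proof (rule lidealI)
      show "0 \<in> (\<lambda>x. a * x) ` I"
        using lidealD(2)[OF li] by (auto intro!: image_eqI[of _ _ 0])
      show "u - v \<in> (\<lambda>x. a * x) ` I" if "u \<in> (\<lambda>x. a * x) ` I" "v \<in> (\<lambda>x. a * x) ` I" for u v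
        using that lidealD(3)[OF li] by (auto simp: right_diff_distrib[symmetric])
      show "b * u \<in> (\<lambda>x. a * x) ` I" if "u \<in> (\<lambda>x. a * x) ` I" for b u
        using that lidealD(6)[OF li, of b] by (auto simp: mult.left_commute)
    qed simp
    moreover have "(\<lambda>x. a * x) ` I \<subseteq> I"
      using lidealD(6)[OF li] by auto
    ultimately show ?thesis
      using min by auto
  qed
  have "prime_ideal {a. \<forall>x\<in>I. a * x = 0}"
    unfolding prime_ideal_def
  proof (intro conjI allI impI)
    show "lideal (*) UNIV {a. \<forall>x\<in>I. a * x = 0}"
      by (rule lidealI) (auto simp: left_diff_distrib mult.assoc)
    show "1 \<notin> {a. \<forall>x\<in>I. a * x = 0}"
      using I lidealD(2)[OF li] by auto
    fix a b assume ab: "a * b \<in> {a. \<forall>x\<in>I. a * x = 0}"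
    show "a \<in> {a. \<forall>x\<in>I. a * x = 0} \<or> b \<in> {a. \<forall>x\<in>I. a * x = 0}"
      using mult[of b]
    proof
      assume b: "(\<lambda>x. b * x) ` I = {0}"
      have "b * x = 0" if "x \<in> I" for x
        using imageI[OF that, of "\<lambda>x. b * x"] unfolding b by simp
      then show ?thesis by simp
    next
      assume b: "(\<lambda>x. b * x) ` I = I"
      have "a * x = 0" if "x \<in> I" for x
      proof -
        have "x \<in> (\<lambda>x. b * x) ` I"
          unfolding b by (rule that)
        then obtain y where "y \<in> I" "x = b * y"
          by (elim imageE) simp
        then show ?thesis
          using ab by (simp add: mult.assoc[symmetric])
      qed
      then show ?thesis by blast
    qed
  qed
  then show thesis by (rule that)
qed

text \<open>The kernel of the map from \<open>RG\<close> to the free module over \<open>R/P\<close>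
  on the left cosets of \<open>H\<close>: all coefficient sums over cosets lie in \<open>P\<close>.
  For \<open>H = Z\<close> this is the ideal \<open>I\<close> of the overview.\<close>

definition coset_ideal :: "'r set \<Rightarrow> 's set \<Rightarrow> 's::inverse_semigroup set \<Rightarrow> ('s \<Rightarrow>\<^sub>0 'r::comm_ring_1) set"
  where "coset_ideal P H G = {f \<in> alg G. \<forall>C. coef (push (coset H) f) C \<in> P}"

lemma coef_lin_lideal:
  assumes P: "lideal (*) UNIV P" and "\<And>C. coef f C \<in> P"
  shows "coef (lin \<phi> f) C \<in> P"
  unfolding coef_lin using assms(2) lidealD(6)[OF P]
  by (intro lideal_sum[OF P]) (metis UNIV_I mult.commute)

lemma alg_lideal: "subgrp e G \<Longrightarrow> lideal convolution (alg G) (alg G)"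
  by (rule lidealI)
     (simp_all add: alg_def supp_diff_subset supp_group_convolution)

lemma coset_ideal_lideal:
  assumes P: "lideal (*) UNIV P" and G: "subgrp e G"
  shows "lideal convolution (alg G) (coset_ideal P H G)"
proof (rule lidealI)
  show "0 \<in> coset_ideal P H G"
    using lidealD(2)[OF P] by (simp add: coset_ideal_def alg_def)
  show "f - g \<in> coset_ideal P H G" if "f \<in> coset_ideal P H G" "g \<in> coset_ideal P H G" for f g
    using that lidealD(3)[OF P] by (simp add: coset_ideal_def alg_def supp_diff_subset lin_diff lookup_minus)
  show "convolution a f \<in> coset_ideal P H G" if "a \<in> alg G" "f \<in> coset_ideal P H G" for a f
  proof -
    \<comment> \<open>Passing to cosets is equivariant: left multiplication by \<open>s\<close>
      becomes the translation of cosets by \<open>s\<close>.\<close>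
    have "push (coset H) (convolution a f) = bilin (\<lambda>s C. basis ((\<lambda>y. s * y) ` C)) a (push (coset H) f)"
      by (simp add: convolution_bilin lin_bilin coset_mult_left bilin_lin_right)
         (simp add: bilin_swap[of _ a] bilin_swap[of _ _ "basis _"])
    then have "coef (push (coset H) (convolution a f)) C \<in> P" for C
      unfolding bilin_swap by (simp add: coef_lin_lideal[OF P] that(2)[unfolded coset_ideal_def, simplified])
    then show ?thesis
      using that lidealD(6)[OF alg_lideal[OF G]] by (auto simp: coset_ideal_def)
  qed
qed (auto simp: coset_ideal_def)

lemma basis_eq_iff: "basis s = (basis t :: 's \<Rightarrow>\<^sub>0 'r::comm_ring_1) \<longleftrightarrow> s = t"
  by (metis lookup_single_eq lookup_single_not_eq zero_neq_one)

lemma coef_eq_0_iff: "(\<forall>C. coef f C = 0) \<longleftrightarrow> f = 0"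
  by (metis lookup_zero poly_mapping_eqI)

lemma zero_lideal: "lideal (*) UNIV {0 :: 'r::comm_ring_1}"
  by (simp add: lideal_def)

lemma coset_ideal_mono:
  assumes H: "subgrp e H" and K: "subgrp e K" and "H \<subseteq> K" and P: "lideal (*) UNIV P"
  shows "coset_ideal P H G \<subseteq> coset_ideal P K G"
proof
  fix f assume f: "f \<in> coset_ideal P H G"
  \<comment> \<open>A coset of \<open>K\<close> is a function of the coset of \<open>H\<close>
    inside it, so the coset sums for \<open>K\<close> are obtained from those for \<open>H\<close>
    by a linear map.\<close>
  have "(\<Union>y\<in>coset H x. coset K y) = coset K x" for x
    using coset_absorb[OF K, of _ x] assms(3) subgrpD(1)[OF H] by (auto simp: coset_def[of H])
  then have "push (coset K) f = lin (\<lambda>C. basis (\<Union>y\<in>C. coset K y)) (push (coset H) f)"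
    by (simp add: lin_lin)
  then show "f \<in> coset_ideal P K G"
    using f by (simp add: coset_ideal_def coef_lin_lideal[OF P])
qed

text \<open>This recovers \<open>H\<close> from its ideal, so that distinct subgroups have distinct
  ideals. Taking \<open>P = {0}\<close> keeps the basis elements of different cosets apart over any
  \<open>R\<close>.\<close>

lemma coset_ideal_detects:
  assumes G: "subgrp e G" and H: "subgrp e H" "H \<subseteq> G" and h: "h \<in> G"
  shows "basis h - basis e \<in> (coset_ideal {0} H G :: ('s::inverse_semigroup \<Rightarrow>\<^sub>0 'r::comm_ring_1) set) \<longleftrightarrow> h \<in> H"
proof -
  note D = subgrpD[OF G]
  have "supp (basis h - basis e :: 's \<Rightarrow>\<^sub>0 'r) \<subseteq> G"
    using h D(1) by (intro supp_diff_subset) auto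
  then have "basis h - basis e \<in> (coset_ideal {0} H G :: ('s \<Rightarrow>\<^sub>0 'r) set) \<longleftrightarrow>
      push (coset H) (basis h - basis e :: 's \<Rightarrow>\<^sub>0 'r) = 0"
    by (simp add: coset_ideal_def alg_def coef_eq_0_iff)
  also have "\<dots> \<longleftrightarrow> coset H h = coset H e"
    by (simp add: lin_diff basis_eq_iff)
  also have "\<dots> \<longleftrightarrow> (\<exists>k\<in>H. h = e * k)"
    by (rule coset_eq_iff[OF H(1)]) (use D h in auto)
  also have "\<dots> \<longleftrightarrow> h \<in> H"
    using subgrpD(7)[OF H(1)] by auto
  finally show ?thesis .
qed

text \<open>The map from subgroups to coset ideals is monotone and injective, so the descending
  chain condition on left ideals provides a minimal member among the infinite subgroups.\<close>

lemma minimal_infinite_subgroup: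
  assumes G: "subgrp e G" "infinite G"
    and dcc: "chain_condition False convolution (alg G :: ('s::inverse_semigroup \<Rightarrow>\<^sub>0 'r::comm_ring_1) set)"
  obtains H where "subgrp e H" "infinite H" "\<And>K. subgrp e K \<Longrightarrow> K \<subset> H \<Longrightarrow> finite K"
proof -
  let ?F = "{H. subgrp e H \<and> H \<subseteq> G \<and> infinite H}"
  let ?W = "\<lambda>H. coset_ideal {0} H G :: ('s \<Rightarrow>\<^sub>0 'r) set"
  have "?W G \<in> ?W ` ?F"
    using G by blast
  moreover have "lideal convolution (alg G) I" if "I \<in> ?W ` ?F" for I
    using that coset_ideal_lideal[OF zero_lideal G(1)] by blast
  ultimately have "\<exists>M\<in>?W ` ?F. \<forall>I\<in>?W ` ?F. I \<subseteq> M \<longrightarrow> I = M"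
    by (rule descending_minimal[OF dcc])
  then have "\<exists>H\<in>?F. \<forall>K\<in>?F. ?W K \<subseteq> ?W H \<longrightarrow> ?W K = ?W H"
    by (simp only: bex_simps ball_simps)
  then obtain H where H: "subgrp e H" "H \<subseteq> G" "infinite H"
    and min: "\<And>K. K \<in> ?F \<Longrightarrow> ?W K \<subseteq> ?W H \<Longrightarrow> ?W K = ?W H"
    by blast
  show thesis
  proof (rule that[of H])
    fix K assume K: "subgrp e K" "K \<subset> H"
    show "finite K"
    proof (rule ccontr)
      assume "infinite K"
      then have "?W K = ?W H"
        using K H coset_ideal_mono[OF K(1) H(1) _ zero_lideal] by (intro min) auto
      then have "H \<subseteq> K"
        using coset_ideal_detects[OF G(1) H(1,2), where 'r = 'r] coset_ideal_detects[OF G(1) K(1), where 'r = 'r] K(2) H(2)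
        by blast
      then show False
        using K(2) by blast
    qed
  qed (use H in auto)
qed

lemma coef_sum_basis:
  "finite A \<Longrightarrow> coef (\<Sum>y\<in>A. basis y :: 's \<Rightarrow>\<^sub>0 'r::comm_ring_1) x = (if x \<in> A then 1 else 0)"
  by (simp add: lookup_sum lookup_single when_def)

text \<open>The left ideals of elements fixed by right multiplication with \<open>H\<close> shrink
  as \<open>H\<close> grows, which turns the descending chain condition into a maximality statement
  for finite subgroups.\<close>

lemma maximal_finite_subgroup:
  assumes G: "subgrp e G"
    and dcc: "chain_condition False convolution (alg G :: ('s::inverse_semigroup \<Rightarrow>\<^sub>0 'r::comm_ring_1) set)"
  obtains H where "subgrp e H" "H \<subseteq> G" "finite H"
    "\<And>K. subgrp e K \<Longrightarrow> H \<subseteq> K \<Longrightarrow> K \<subseteq> G \<Longrightarrow> finite K \<Longrightarrow> K = H"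
proof -
  note D = subgrpD[OF G]
  let ?F = "{H. subgrp e H \<and> H \<subseteq> G \<and> finite H}"
  let ?B = "\<lambda>H. {f \<in> alg G. \<forall>h\<in>H. convolution f (basis h) = f} :: ('s \<Rightarrow>\<^sub>0 'r) set"
  have "{e} \<in> ?F"
    using D(1,2) G by (auto simp: subgrp_def sinv_idem)
  then have "?B {e} \<in> ?B ` ?F" by blast
  moreover have "lideal convolution (alg G) I" if "I \<in> ?B ` ?F" for I
  proof -
    from that obtain H where "I = ?B H" by blast
    then show ?thesis
      using lidealD[OF alg_lideal[OF G, where 'b = 'r]]
      by (intro lidealI) (auto simp: convolution_simps convolution_assoc)
  qed
  ultimately have "\<exists>M\<in>?B ` ?F. \<forall>I\<in>?B ` ?F. I \<subseteq> M \<longrightarrow> I = M"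
    by (rule descending_minimal[OF dcc])
  then have "\<exists>H\<in>?F. \<forall>K\<in>?F. ?B K \<subseteq> ?B H \<longrightarrow> ?B K = ?B H"
    by (simp only: bex_simps ball_simps)
  then obtain H where "H \<in> ?F" and min: "\<forall>K\<in>?F. ?B K \<subseteq> ?B H \<longrightarrow> ?B K = ?B H" ..
  then have H: "subgrp e H" "H \<subseteq> G" "finite H"
    by simp_all
  show thesis
  proof (rule that[OF H])
    fix K assume K: "subgrp e K" "H \<subseteq> K" "K \<subseteq> G" "finite K"
    \<comment> \<open>The sum over the finite group \<open>H\<close> is fixed by \<open>H\<close>;
      if it is also fixed by \<open>k\<close>, its support \<open>H\<close> is stable under
      \<open>k\<close> and thus contains \<open>k\<close>.\<close>
    define u :: "'s \<Rightarrow>\<^sub>0 'r" where "u = (\<Sum>y\<in>H. basis y)"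
    have u_mult: "convolution u (basis k) = (\<Sum>y\<in>(\<lambda>y. y * k) ` H. basis y)" if "k \<in> K" for k
    proof -
      have "inj_on (\<lambda>y. y * k) H"
        by (rule inj_on_inverseI[of _ "\<lambda>y. y * sinv k"])
           (use subgrpD[OF K(1)] K(2) that in \<open>auto simp: mult.assoc\<close>)
      then show ?thesis
        by (simp add: u_def convolution_sum convolution_basis sum.reindex)
    qed
    have "u \<in> ?B H"
    proof -
      have "(\<lambda>y. y * k) ` H = H" if "k \<in> H" for k
      proof
        show "H \<subseteq> (\<lambda>y. y * k) ` H"
        proof
          fix y assume "y \<in> H"
          then have "y = y * sinv k * k" "y * sinv k \<in> H"
            using subgrpD[OF H(1)] that by (auto simp: mult.assoc)
          then show "y \<in> (\<lambda>y. y * k) ` H" by blast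
        qed
      qed (use subgrpD(4)[OF H(1)] that in auto)
      then have "convolution u (basis k) = u" if "k \<in> H" for k
        using u_mult[of k] that K(2) by (auto simp: u_def)
      moreover have "supp u \<subseteq> G"
        unfolding u_def by (rule supp_sum_subset) (use H(2) in auto)
      ultimately show ?thesis
        by (simp add: alg_def)
    qed
    moreover have "?B K = ?B H"
      using K by (intro min[rule_format]) auto
    ultimately have "u \<in> ?B K" by simp
    have "K \<subseteq> H"
    proof
      fix k assume k: "k \<in> K"
      then have "coef (convolution u (basis k)) k = coef u k"
        using \<open>u \<in> ?B K\<close> by simp
      moreover have "k \<in> (\<lambda>y. y * k) ` H"
        using subgrpD(1)[OF H(1)] subgrpD(7)[OF K(1) k] by force
      ultimately show "k \<in> H"
        unfolding u_mult[OF k] using H(3) by (simp add: coef_sum_basis u_def split: if_splits)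
    qed
    then show "K = H"
      using K(2) by blast
  qed
qed

lemma coef_bilin:
  "coef (bilin \<phi> f g) x = (\<Sum>s\<in>supp f. \<Sum>t\<in>supp g. coef f s * (coef g t * coef (\<phi> s t) x))"
  by (simp add: bilin_def coef_lin sum_distrib_left)

locale minimal_infinite_group =
  fixes e :: "'s::inverse_semigroup" and G :: "'s set" and R :: "'r::comm_ring_1 itself"
  assumes G: "subgrp e G" and infinite_G: "infinite G"
    and proper_finite: "\<And>K. subgrp e K \<Longrightarrow> K \<subset> G \<Longrightarrow> finite K"
    and dcc: "chain_condition False convolution (alg G :: ('s \<Rightarrow>\<^sub>0 'r) set)"
begin

lemmas D = subgrpD[OF G]

lemma subgrpI:
  assumes "K \<subseteq> G" "e \<in> K" "\<And>s. s \<in> K \<Longrightarrow> sinv s \<in> K" "\<And>s t. s \<in> K \<Longrightarrow> t \<in> K \<Longrightarrow> s * t \<in> K"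
  shows "subgrp e K"
  using assms G by (auto simp: subgrp_def)

abbreviation group_of :: "'s monoid"
  where "group_of \<equiv> \<lparr>carrier = G, monoid.mult = (*), one = e\<rparr>"

lemma group_group_of: "group group_of"
proof (rule groupI)
  show "\<exists>y\<in>carrier group_of. y \<otimes>\<^bsub>group_of\<^esub> x = \<one>\<^bsub>group_of\<^esub>" if "x \<in> carrier group_of" for x
    using that D(3,6) by auto
qed (auto simp: D mult.assoc)

lemma inv_group_of:
  assumes "x \<in> G" shows "inv\<^bsub>group_of\<^esub> x = sinv x"
  using group.inv_equality[OF group_group_of, of "sinv x" x] assms D by simp

lemma subgroup_subgrp:
  assumes "subgroup K group_of" shows "subgrp e K"
proof (rule subgrpI)
  show "K \<subseteq> G"
    using subgroup.subset[OF assms] by simp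
  then show "sinv s \<in> K" if "s \<in> K" for s
    using subgroup.m_inv_closed[OF assms that] that inv_group_of[of s] by auto
qed (use subgroup.one_closed[OF assms] subgroup.m_closed[OF assms] in auto)

text \<open>Suppose \<open>x\<close> has infinite order. If \<open>x * x\<close> generates a finite
  group, then \<open>x\<close> has finite order after all. Otherwise that group is all of
  \<open>G\<close>, so \<open>x\<close> is an even power of itself and an odd exponent annihilates
  it, which is impossible as well.\<close>

lemma cyclic_finite:
  assumes x: "x \<in> G"
  shows "finite (generate group_of {x})"
proof (rule ccontr)
  interpret group group_of by (rule group_group_of)
  assume inf: "infinite (generate group_of {x})"
  have ord_x: "ord x = 0"
    using generate_pow_card[of x] x inf by simp
  have gen: "generate group_of {y} = G" if "y \<in> G" "infinite (generate group_of {y})" for y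
  proof -
    have "subgroup (generate group_of {y}) group_of"
      using generate_is_subgroup[of "{y}"] that by simp
    then have "subgrp e (generate group_of {y})" "generate group_of {y} \<subseteq> G"
      using subgroup_subgrp subgroup.subset by fastforce+
    then show ?thesis
      using proper_finite that(2) by blast
  qed
  have xx: "x * x \<in> G"
    using D(4) x by blast
  show False
  proof (cases "finite (generate group_of {x * x})")
    case True
    then have "ord (x * x) \<noteq> 0"
      using generate_pow_card[of "x * x"] xx generate.one[of group_of "{x * x}"] by auto
    moreover have "x [^]\<^bsub>group_of\<^esub> (2 * ord (x * x)) = \<one>\<^bsub>group_of\<^esub>"
      using pow_ord_eq_1[of "x * x"] nat_pow_pow[of x 2 "ord (x * x)"] x xx
      by (simp add: numeral_2_eq_2 D)
    then have "ord x dvd 2 * ord (x * x)"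
      using pow_eq_id[of x] x by simp
    ultimately show False
      using ord_x by simp
  next
    case False
    then have "x \<in> generate group_of {x * x}"
      using gen[OF xx] x by simp
    then obtain k :: int where k: "x = (x * x) [^]\<^bsub>group_of\<^esub> k"
      using generate_pow[of "x * x"] xx by auto
    have "x * x = x [^]\<^bsub>group_of\<^esub> (2::int)"
      using int_pow_mult[of x 1 1] x by simp
    then have "x [^]\<^bsub>group_of\<^esub> (1::int) = x [^]\<^bsub>group_of\<^esub> (2 * k)"
      using k int_pow_pow[of x 2 k] x by simp
    then have "x [^]\<^bsub>group_of\<^esub> (2 * k - 1) = \<one>\<^bsub>group_of\<^esub>"
      using int_pow_diff[of x "2 * k" 1] x by (simp add: inv_group_of D)
    then have "int (ord x) dvd 2 * k - 1"
      using int_pow_eq_id[of x "2 * k - 1"] x by simp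
    then show False
      using ord_x by simp presburger
  qed
qed

text \<open>In the abelian case a maximal finite subgroup \<open>H\<close> could be enlarged: for
  \<open>x\<close> outside \<open>H\<close>, the product of \<open>H\<close> with the finite cyclic
  group of \<open>x\<close> is again a finite subgroup.\<close>

lemma not_abelian: "\<exists>x\<in>G. \<exists>y\<in>G. x * y \<noteq> y * x"
proof (rule ccontr)
  interpret group group_of by (rule group_group_of)
  assume "\<not> ?thesis"
  then have comm: "x * y = y * x" if "x \<in> G" "y \<in> G" for x y
    using that by blast
  obtain H where H: "subgrp e H" "H \<subseteq> G" "finite H"
    and max: "\<And>K. subgrp e K \<Longrightarrow> H \<subseteq> K \<Longrightarrow> K \<subseteq> G \<Longrightarrow> finite K \<Longrightarrow> K = H"
    using maximal_finite_subgroup[OF G dcc] by metis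
  obtain x where x: "x \<in> G" "x \<notin> H"
    using H infinite_G by (metis finite_subset subsetI)
  define C where "C = generate group_of {x}"
  have C: "subgrp e C" "x \<in> C" "finite C"
    using generate_is_subgroup[of "{x}"] x generate.incl[of x "{x}"] cyclic_finite[OF x(1)]
    by (simp_all add: subgroup_subgrp C_def)
  have CG: "C \<subseteq> G"
    using generate_incl[of "{x}"] x by (simp add: C_def)
  define K where "K = (\<lambda>(h, c). h * c) ` (H \<times> C)"
  note DH = subgrpD[OF H(1)] and DC = subgrpD[OF C(1)]
  have KG: "K \<subseteq> G"
    using H(2) CG D(4) by (auto simp: K_def)
  have KI: "h * c \<in> K" if "h \<in> H" "c \<in> C" for h c
    using that by (auto simp: K_def)
  have "subgrp e K"
  proof (rule subgrpI[OF KG])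
    show "e \<in> K"
      using KI[OF DH(1) DC(1)] D(2) by simp
    show "sinv s \<in> K" if s: "s \<in> K" for s
    proof -
      obtain h c where hc: "h \<in> H" "c \<in> C" "s = h * c"
        using s by (auto simp: K_def)
      then have "sinv s = sinv h * sinv c"
        using comm[of "sinv c" "sinv h"] H(2) CG DH(3) DC(3) by (auto simp: sinv_mult)
      then show ?thesis
        using KI DH(3) DC(3) hc by simp
    qed
    show "s * t \<in> K" if s: "s \<in> K" and t: "t \<in> K" for s t
    proof -
      obtain h c h' c' where hc: "h \<in> H" "c \<in> C" "s = h * c" "h' \<in> H" "c' \<in> C" "t = h' * c'"
        using s t by (auto simp: K_def)
      have "s * t = h * (c * h') * c'"
        by (simp add: hc mult.assoc)
      also have "c * h' = h' * c"
        using comm hc H(2) CG by blast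
      finally have "s * t = (h * h') * (c * c')"
        by (simp add: mult.assoc)
      then show ?thesis
        using KI DH(4) DC(4) hc by simp
    qed
  qed
  moreover have "H \<subseteq> K"
    using KI[OF _ DC(1)] DH(8) by (metis subsetI)
  moreover have "finite K"
    using H(3) C(3) by (simp add: K_def)
  ultimately have "K = H"
    using max KG by blast
  moreover have "x \<in> K"
    using KI[OF DH(1) C(2)] D(7)[OF x(1)] by simp
  ultimately show False
    using x by simp
qed

definition Z :: "'s set"
  where "Z = {z \<in> G. \<forall>g\<in>G. z * g = g * z}"

lemma Z: "subgrp e Z" "finite Z" "Z \<subseteq> G"
proof -
  show "Z \<subseteq> G" by (auto simp: Z_def)
  show "subgrp e Z"
  proof (rule subgrpI)
    show "sinv s \<in> Z" if s: "s \<in> Z" for s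
    proof -
      have "sinv s * g = g * sinv s" if g: "g \<in> G" for g
      proof -
        have sG: "s \<in> G" and "s * g = g * s"
          using s g by (auto simp: Z_def)
        then have "sinv s * (s * g) * sinv s = sinv s * (g * s) * sinv s"
          by simp
        then show ?thesis
          using sG g D by (simp add: mult.assoc)
      qed
      then show ?thesis
        using s D(3) by (auto simp: Z_def)
    qed
    show "s * t \<in> Z" if s: "s \<in> Z" and t: "t \<in> Z" for s t
    proof -
      have "s * t * g = g * (s * t)" if g: "g \<in> G" for g
      proof -
        have "s * t * g = s * (t * g)"
          by (simp add: mult.assoc)
        also have "\<dots> = s * g * t"
          using t g by (simp add: Z_def mult.assoc)
        also have "\<dots> = g * (s * t)"
          using s g by (simp add: Z_def mult.assoc)
        finally show ?thesis .
      qed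
      moreover have "s * t \<in> G"
        by (rule D(4)) (use s t in \<open>auto simp: Z_def\<close>)
      ultimately show ?thesis
        unfolding Z_def by blast
    qed
  qed (auto simp: Z_def D)
  moreover have "Z \<subset> G"
    using not_abelian \<open>Z \<subseteq> G\<close> by (auto simp: Z_def)
  ultimately show "finite Z"
    using proper_finite by blast
qed

text \<open>If some \<open>k\<close> conjugates \<open>u\<close> to \<open>w\<close>, all such
  elements form \<open>k\<close> times the centralizer of \<open>u\<close>. As \<open>u\<close> is
  not central, the centralizer is a proper subgroup, hence finite.\<close>

lemma conjugator_finite:
  assumes u: "u \<in> G" "u \<notin> Z" and w: "w \<in> G"
  shows "finite {g \<in> G. g * u = w * g}"
proof (cases "{g \<in> G. g * u = w * g} = {}")
  case False
  then obtain k where k: "k \<in> G" "k * u = w * k" by blast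
  let ?C = "{g \<in> G. g * u = u * g}"
  have "subgrp e ?C"
  proof (rule subgrpI)
    show "sinv s \<in> ?C" if s: "s \<in> ?C" for s
    proof -
      have "sinv s * (s * u) * sinv s = sinv s * (u * s) * sinv s"
        using s by simp
      then show ?thesis
        using s u D by (simp add: mult.assoc)
    qed
    show "s * t \<in> ?C" if "s \<in> ?C" "t \<in> ?C" for s t
      using that D(4) by auto (metis mult.assoc)
  qed (use D u in auto)
  moreover have "?C \<subset> G"
  proof -
    obtain g where "g \<in> G" "u * g \<noteq> g * u"
      using u by (auto simp: Z_def)
    then have "g \<notin> ?C" by auto
    then show ?thesis
      using \<open>g \<in> G\<close> by blast
  qed
  ultimately have "finite ?C"
    by (rule proper_finite)
  moreover have "{g \<in> G. g * u = w * g} \<subseteq> (\<lambda>c. k * c) ` ?C"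
  proof
    fix g assume g: "g \<in> {g \<in> G. g * u = w * g}"
    have "sinv k * (w * k) * sinv k = sinv k * (k * u) * sinv k"
      using k by simp
    then have "sinv k * w = u * sinv k"
      using k(1) u w D D(3)[OF k(1)] by (simp add: mult.assoc)
    have "sinv k * g * u = sinv k * w * g"
      using g by (simp add: mult.assoc)
    then have "sinv k * g \<in> ?C"
      using g k(1) D \<open>sinv k * w = u * sinv k\<close> by (simp add: mult.assoc)
    moreover have "g = k * (sinv k * g)"
      using g k(1) D by simp
    ultimately show "g \<in> (\<lambda>c. k * c) ` ?C" by blast
  qed
  ultimately show ?thesis
    using finite_surj by blast
qed (simp only: finite.emptyI)

lemma coset_Z_mult_right:
  assumes "g \<in> G" shows "coset Z (x * g) = (\<lambda>y. y * g) ` coset Z x"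
proof -
  have "x * g * z = x * z * g" if "z \<in> Z" for z
    using that assms by (simp add: Z_def mult.assoc)
  then show ?thesis
    by (simp add: coset_def image_image cong: image_cong_simp)
qed

lemma coset_Z_eq_iff:
  assumes "x \<in> G" "y \<in> G" shows "coset Z x = coset Z y \<longleftrightarrow> (\<exists>z\<in>Z. x = y * z)"
  using coset_eq_iff[OF Z(1)] D(8) assms by blast

text \<open>\<open>Z\<close> is central, so right multiplication also acts on its cosets and the
  ideal is two-sided. The final argument multiplies on the right by elements of \<open>RG\<close>
  and relies on this.\<close>

lemma coset_ideal_mult_right:
  fixes f l :: "'s \<Rightarrow>\<^sub>0 'r"
  assumes P: "lideal (*) UNIV P" and f: "f \<in> coset_ideal P Z G" and l: "l \<in> alg G"
  shows "convolution f l \<in> coset_ideal P Z G"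
proof -
  have "push (coset Z) (convolution f l) = bilin (\<lambda>s t. basis ((\<lambda>y. y * t) ` coset Z s)) f l"
    unfolding convolution_bilin lin_bilin
    by (intro bilin_cong) (use l coset_Z_mult_right in \<open>auto simp: alg_def\<close>)
  also have "\<dots> = bilin (\<lambda>C t. basis ((\<lambda>y. y * t) ` C)) (push (coset Z) f) l"
    unfolding bilin_lin_left by (simp add: bilin_def)
  finally have "coef (push (coset Z) (convolution f l)) C \<in> P" for C
    unfolding bilin_def by (simp add: coef_lin_lideal[OF P] f[unfolded coset_ideal_def, simplified])
  then show ?thesis
    using f l lidealD(6)[OF alg_lideal[OF G]] by (auto simp: coset_ideal_def)
qed

lemma coset_ideal_notinD:
  assumes P: "lideal (*) UNIV P" and "m \<in> alg G" "m \<notin> coset_ideal P H G"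
  obtains x where "x \<in> supp m" "coef (push (coset H) m) (coset H x) \<notin> P"
proof -
  obtain C where C: "coef (push (coset H) m) C \<notin> P"
    using assms(2,3) by (auto simp: coset_ideal_def)
  have "{s \<in> supp m. coset H s = C} \<noteq> {}"
  proof
    assume "{s \<in> supp m. coset H s = C} = {}"
    then have "coef (push (coset H) m) C = 0"
      by (simp only: coef_push sum.empty)
    then show False
      using C lidealD(2)[OF P] by simp
  qed
  then obtain s where "s \<in> supp m" "coset H s = C"
    by blast
  then show thesis
    using that[of s] C by simp
qed

text \<open>The group \<open>G\<close> modulo its centre has infinite conjugacy classes apart from the trivial one, which
  makes its group algebra over a domain prime.\<close>

lemma coset_ideal_prime:
  fixes m l :: "'s \<Rightarrow>\<^sub>0 'r"
  assumes P: "prime_ideal P" and m: "m \<in> alg G" "m \<notin> coset_ideal P Z G"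
    and l: "l \<in> alg G" "l \<notin> coset_ideal P Z G"
  shows "\<exists>g\<in>G. convolution m (convolution (basis g) l) \<notin> coset_ideal P Z G"
proof -
  have P': "lideal (*) UNIV P"
    using P by (simp add: prime_ideal_def)
  obtain x0 where x0: "x0 \<in> supp m" "coef (push (coset Z) m) (coset Z x0) \<notin> P"
    using coset_ideal_notinD[OF P' m] .
  obtain y0 where y0: "y0 \<in> supp l" "coef (push (coset Z) l) (coset Z y0) \<notin> P"
    using coset_ideal_notinD[OF P' l] .
  have mG: "supp m \<subseteq> G" and lG: "supp l \<subseteq> G"
    using m l by (auto simp: alg_def)
  have x0G: "x0 \<in> G" and y0G: "y0 \<in> G"
    using mG lG x0 y0 by auto
  \<comment> \<open>\<open>x g y\<close> and \<open>x0 g y0\<close> lie in the same coset iff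
    \<open>x0 g y0 = x g y z\<close> for some \<open>z\<close> in \<open>Z\<close>, that is,
    \<open>g\<close> conjugates \<open>y z y0^{-1}\<close> to \<open>x^{-1} x0\<close>.
    \<open>B\<close> collects the finitely many \<open>g\<close> for which this happens with a
    noncentral element.\<close>
  define B where "B = (\<Union>x\<in>supp m. \<Union>y\<in>supp l. \<Union>z\<in>Z.
    if y * z * sinv y0 \<in> Z then {} else {g \<in> G. g * (y * z * sinv y0) = (sinv x * x0) * g})"
  have in_G: "y * z * sinv y0 \<in> G" "sinv x * x0 \<in> G" if "x \<in> supp m" "y \<in> supp l" "z \<in> Z" for x y z
    using that mG lG Z(3) D(3,4) x0G y0G by (meson subsetD)+
  have "finite B"
    unfolding B_def using in_G conjugator_finite by (intro finite_UN_I Z(2)) auto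
  then obtain g where g: "g \<in> G" "g \<notin> B"
    using infinite_G by (metis finite_subset subsetI)
  have iff: "coset Z (x * (g * y)) = coset Z (x0 * (g * y0)) \<longleftrightarrow>
      coset Z x = coset Z x0 \<and> coset Z y = coset Z y0" if x: "x \<in> supp m" and y: "y \<in> supp l" for x y
  proof -
    have xG: "x \<in> G" and yG: "y \<in> G"
      using x y mG lG by auto
    have prodG: "x * (g * y) \<in> G" "x0 * (g * y0) \<in> G"
      using D(4) xG yG x0G y0G g(1) by blast+
    show ?thesis
    proof
      assume "coset Z (x * (g * y)) = coset Z (x0 * (g * y0))"
      then obtain z where z: "z \<in> Z" "x0 * (g * y0) = x * (g * y) * z"
        using coset_Z_eq_iff[OF prodG(2,1)] by metis
      define u where "u = y * z * sinv y0"
      have zG: "z \<in> G" using z Z(3) by blast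
      have "sinv x * (x0 * (g * y0)) * sinv y0 = sinv x * (x * (g * y) * z) * sinv y0"
        using z by simp
      then have eq: "g * u = (sinv x * x0) * g"
        using xG yG x0G y0G g(1) zG D by (simp add: mult.assoc u_def)
      then have uZ: "u \<in> Z"
        using g x y z(1) unfolding B_def u_def by (auto split: if_splits)
      then have uG: "u \<in> G" and gu: "g * u = u * g" and y0u: "u * y0 = y0 * u"
        using g(1) y0G by (auto simp: Z_def)
      have "u * g * sinv g = (sinv x * x0) * g * sinv g"
        using eq gu by simp
      then have "u = sinv x * x0"
        using g(1) uG xG x0G D by (simp add: mult.assoc)
      then have "x0 = x * u"
        using xG x0G D by simp
      moreover have "y * z = y0 * u"
        unfolding y0u[symmetric] using yG y0G zG D by (simp add: u_def mult.assoc)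
      ultimately show "coset Z x = coset Z x0 \<and> coset Z y = coset Z y0"
        using coset_absorb[OF Z(1)] uZ z(1) by metis
    next
      assume "coset Z x = coset Z x0 \<and> coset Z y = coset Z y0"
      then obtain z z' where z: "z \<in> Z" "x = x0 * z" "z' \<in> Z" "y = y0 * z'"
        using coset_Z_eq_iff xG yG x0G y0G by metis
      have "g * y0 \<in> G"
        using D(4) g(1) y0G by blast
      then have "z * (g * y0) = g * y0 * z"
        using z(1) by (simp add: Z_def)
      then have "x0 * (z * (g * y0)) * z' = x0 * (g * y0 * z) * z'"
        by simp
      then have "x * (g * y) = x0 * (g * y0) * (z * z')"
        by (simp add: z mult.assoc)
      then show "coset Z (x * (g * y)) = coset Z (x0 * (g * y0))"
        using coset_absorb[OF Z(1)] subgrpD(4)[OF Z(1)] z by metis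
    qed
  qed
  have "convolution m (convolution (basis g) l) = lin (\<lambda>x. convolution (basis (x * g)) l) m"
    by (subst convolution_expand_left) (simp only: convolution_assoc[symmetric] convolution_basis)
  then have "push (coset Z) (convolution m (convolution (basis g) l)) =
      bilin (\<lambda>x y. basis (coset Z (x * (g * y)))) m l"
    by (simp add: convolution_basis_left lin_lin mult.assoc bilin_def)
  then have "coef (push (coset Z) (convolution m (convolution (basis g) l))) (coset Z (x0 * (g * y0))) =
      (\<Sum>x\<in>supp m. \<Sum>y\<in>supp l. coef m x * (coef l y *
         (if coset Z (x * (g * y)) = coset Z (x0 * (g * y0)) then 1 else 0)))"
    by (simp add: coef_bilin lookup_single when_def)
  \<comment> \<open>By the choice of \<open>g\<close> the indicator of the product coset factors
    into indicators for \<open>x\<close> and \<open>y\<close>, so the coefficient becomes a product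
    of two coset sums outside the prime \<open>P\<close>.\<close>
  also have "\<dots> = (\<Sum>x\<in>supp m. \<Sum>y\<in>supp l.
      (coef m x * (if coset Z x = coset Z x0 then 1 else 0)) *
      (coef l y * (if coset Z y = coset Z y0 then 1 else 0)))"
    by (intro sum.cong refl) (simp add: iff)
  also have "\<dots> = coef (push (coset Z) m) (coset Z x0) * coef (push (coset Z) l) (coset Z y0)"
    by (simp only: coef_lin sum_product lookup_single when_def)
  also have "\<dots> \<notin> P"
    using x0(2) y0(2) P by (auto simp: prime_ideal_def)
  finally show ?thesis
    using g(1) by (auto simp: coset_ideal_def)
qed

text \<open>Modulo \<open>P\<close> the coset sums of \<open>y\<close> are constant along the orbit
  of one coset, and \<open>G\<close> permutes the cosets transitively. So all cosets occur in the
  support of the image of \<open>y\<close>; with \<open>Z\<close> finite this makes \<open>G\<close>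
  finite.\<close>

lemma invariant_contradiction:
  fixes y :: "'s \<Rightarrow>\<^sub>0 'r"
  assumes P: "lideal (*) UNIV P" and y: "y \<in> alg G" "y \<notin> coset_ideal P Z G"
    and inv: "\<And>g. g \<in> G \<Longrightarrow> convolution (basis g) y - y \<in> coset_ideal P Z G"
  shows False
proof -
  obtain y0 where y0: "y0 \<in> supp y" "coef (push (coset Z) y) (coset Z y0) \<notin> P"
    using coset_ideal_notinD[OF P y] .
  have yG: "supp y \<subseteq> G" and y0G: "y0 \<in> G"
    using y y0 by (auto simp: alg_def)
  have ne: "coef (push (coset Z) y) (coset Z (g * y0)) \<notin> P" if g: "g \<in> G" for g
  proof -
    have inj: "inj_on (\<lambda>C. (\<lambda>x. g * x) ` C) (coset Z ` G)"
    proof (rule inj_on_inverseI[of _ "\<lambda>C. (\<lambda>x. sinv g * x) ` C"])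
      fix C assume "C \<in> coset Z ` G"
      then have "C \<subseteq> G"
        using Z(3) D(4) by (auto simp: coset_def)
      then have "sinv g * (g * x) = x" if "x \<in> C" for x
        using that D(7,10) g by auto
      then show "(\<lambda>x. sinv g * x) ` (\<lambda>x. g * x) ` C = C"
        by (simp add: image_image cong: image_cong_simp)
    qed
    have "supp (push (coset Z) y) \<subseteq> coset Z ` G"
      by (rule supp_lin) (use yG in auto)
    then have "coef (push (\<lambda>C. (\<lambda>x. g * x) ` C) (push (coset Z) y)) ((\<lambda>x. g * x) ` coset Z y0) =
        coef (push (coset Z) y) (coset Z y0)"
      by (rule coef_push_inj[OF inj]) (use y0G in auto)
    then have "coef (push (coset Z) (convolution (basis g) y)) (coset Z (g * y0)) \<notin> P"
      using y0(2) by (simp add: convolution_basis_left lin_lin coset_mult_left)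
    moreover have "coef (push (coset Z) (convolution (basis g) y)) C - coef (push (coset Z) y) C \<in> P" for C
      using inv[OF g] by (simp add: coset_ideal_def lin_diff lookup_minus)
    ultimately show ?thesis
      using lidealD(4)[OF P] by (metis diff_add_cancel)
  qed
  have "coset Z ` G \<subseteq> supp (push (coset Z) y)"
  proof
    fix C assume "C \<in> coset Z ` G"
    then obtain x where x: "x \<in> G" "C = coset Z x" by blast
    have "x * sinv y0 * y0 = x"
      using x y0G D by (simp add: mult.assoc)
    then have "coef (push (coset Z) y) C \<notin> P"
      using ne[of "x * sinv y0"] x D(3,4) y0G by simp
    then show "C \<in> supp (push (coset Z) y)"
      using lidealD(2)[OF P] by (metis in_keys_iff)
  qed
  then have "finite (coset Z ` G)"
    using finite_subset finite_keys by blast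
  then have "finite (\<Union>C\<in>coset Z ` G. C)"
    by (rule finite_UN_I) (use Z(2) in \<open>auto simp: coset_def\<close>)
  moreover have "G \<subseteq> (\<Union>C\<in>coset Z ` G. C)"
    using coset_self[OF Z(1)] D(8) by auto
  ultimately show False
    using infinite_G finite_subset by blast
qed

lemma contradiction:
  assumes P: "prime_ideal (P :: 'r set)"
  shows False
proof -
  have P': "lideal (*) UNIV P" and P1: "1 \<notin> P"
    using P by (auto simp: prime_ideal_def)
  define I0 :: "('s \<Rightarrow>\<^sub>0 'r) set" where "I0 = coset_ideal P Z G"
  define \<omega> :: "('s \<Rightarrow>\<^sub>0 'r) set" where "\<omega> = {f \<in> alg G. augmentation f \<in> P}"
  let ?l = "lideal convolution (alg G) :: ('s \<Rightarrow>\<^sub>0 'r) set \<Rightarrow> bool"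
  have I0: "?l I0"
    unfolding I0_def by (rule coset_ideal_lideal[OF P' G])
  note algD = lidealD[OF alg_lideal[OF G, where 'b = 'r]]
  have \<omega>: "?l \<omega>"
    by (rule lidealI)
       (auto simp: \<omega>_def augmentation_diff augmentation_convolution algD intro: lidealD[OF P'])
  have I0_\<omega>: "I0 \<subseteq> \<omega>"
  proof
    fix f assume f: "f \<in> I0"
    have "augmentation (push (coset Z) f) \<in> P"
      unfolding augmentation_def by (rule lideal_sum[OF P']) (use f in \<open>auto simp: I0_def coset_ideal_def\<close>)
    then show "f \<in> \<omega>"
      using f by (simp add: I0_def coset_ideal_def \<omega>_def)
  qed
  have right: "convolution f l \<in> I0" if "f \<in> I0" "l \<in> alg G" for f l
    using that coset_ideal_mult_right[OF P'] by (simp add: I0_def)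
  have basis_alg: "basis g \<in> alg G" if "g \<in> G" for g
    using that by (simp add: alg_def)

  let ?\<M> = "{M. ?l M \<and> I0 \<subseteq> M \<and> \<not> M \<subseteq> \<omega>}"
  have "basis e \<in> alg G - \<omega>"
    using P1 basis_alg D(1) by (simp add: \<omega>_def)
  then have "alg G \<in> ?\<M>"
    using alg_lideal[OF G] I0 by (auto dest: lidealD(1))
  then have "\<exists>M\<in>?\<M>. \<forall>J\<in>?\<M>. J \<subseteq> M \<longrightarrow> J = M"
    by (rule descending_minimal[OF dcc]) simp
  then obtain M where "M \<in> ?\<M>" and min: "\<forall>J\<in>?\<M>. J \<subseteq> M \<longrightarrow> J = M" ..
  then have M: "?l M" "I0 \<subseteq> M" "\<not> M \<subseteq> \<omega>"
    by simp_all
  have M_min: "J \<subseteq> \<omega>" if "?l J" "I0 \<subseteq> J" "J \<subseteq> M" "J \<noteq> M" for J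
    using min[rule_format, of J] that by auto
  let ?\<L> = "{L. ?l L \<and> I0 \<subset> L \<and> L \<subseteq> M}"
  have "M \<in> ?\<L>"
    using M I0_\<omega> by auto
  then have "\<exists>L\<in>?\<L>. \<forall>J\<in>?\<L>. J \<subseteq> L \<longrightarrow> J = L"
    by (rule descending_minimal[OF dcc]) simp
  then obtain L where "L \<in> ?\<L>" and min': "\<forall>J\<in>?\<L>. J \<subseteq> L \<longrightarrow> J = L" ..
  then have L: "?l L" "I0 \<subset> L" "L \<subseteq> M"
    by simp_all
  have L_min: "J = I0 \<or> J = L" if "?l J" "I0 \<subseteq> J" "J \<subseteq> L" for J
    using min'[rule_format, of J] that L(3) by auto
  obtain l where l: "l \<in> L" "l \<notin> I0"
    using L(2) by blast
  obtain m0 where m0: "m0 \<in> M" "m0 \<notin> I0"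
    using M(3) I0_\<omega> by blast
  have alg: "m0 \<in> alg G" "l \<in> alg G"
    using m0 l lidealD(1)[OF M(1)] lidealD(1)[OF L(1)] by auto
  obtain g where g: "g \<in> G" "convolution m0 (convolution (basis g) l) \<notin> I0"
    using coset_ideal_prime[OF P alg(1) _ alg(2)] m0(2) l(2) by (auto simp: I0_def)
  \<comment> \<open>Primeness has supplied \<open>g\<close> such that right multiplication by
    \<open>k\<close> does not send all of \<open>M\<close> to \<open>I0\<close>, while
    \<open>k\<close> still lies in \<open>L\<close>.\<close>
  define k where "k = convolution (basis g) l"
  have k: "k \<in> L" "k \<in> alg G"
    using lidealD(6)[OF L(1) basis_alg[OF g(1)] l(1)] lidealD(1)[OF L(1)] by (auto simp: k_def)

  \<comment> \<open>The kernel of right multiplication by \<open>k\<close> from \<open>M\<close> to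
    \<open>L/I0\<close>. It is a proper left ideal in \<open>M\<close> containing \<open>I0\<close>,
    so minimality of \<open>M\<close> forces it into \<open>\<omega>\<close>.\<close>
  define K where "K = {m \<in> M. convolution m k \<in> I0}"
  have "?l K"
    unfolding K_def using lidealD[OF M(1)] lidealD[OF I0]
    by (intro lidealI) (auto simp: convolution_simps convolution_assoc)
  moreover have "I0 \<subseteq> K"
    using M(2) right k(2) by (auto simp: K_def)
  moreover have "K \<noteq> M"
    using m0(1) g(2) by (auto simp: K_def k_def)
  ultimately have K_\<omega>: "K \<subseteq> \<omega>"
    by (intro M_min) (auto simp: K_def)

  obtain m1 where m1: "m1 \<in> M" "m1 \<notin> \<omega>"
    using M(3) by blast
  then have m1k: "convolution m1 k \<notin> I0"
    using K_\<omega> by (auto simp: K_def)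
  \<comment> \<open>The image of \<open>M \<inter> \<omega>\<close> under right multiplication by
    \<open>k\<close>, taken together with \<open>I0\<close>. Minimality of \<open>L\<close> leaves
    only the values \<open>I0\<close> and \<open>L\<close>.\<close>
  let ?N = "{convolution n k + i | n i. n \<in> M \<inter> \<omega> \<and> i \<in> I0}"
  have "?l ?N"
  proof (rule lidealI)
    show "?N \<subseteq> alg G"
    proof
      fix u assume "u \<in> ?N"
      then obtain n i where ni: "u = convolution n k + i" "n \<in> M" "i \<in> I0" by blast
      then have "n \<in> alg G" "i \<in> alg G"
        using lidealD(1)[OF M(1)] lidealD(1)[OF I0] by blast+
      then show "u \<in> alg G"
        unfolding ni(1) by (intro algD(4) algD(6) k(2))
    qed
    show "0 \<in> ?N"
      using lidealD(2)[OF M(1)] lidealD(2)[OF \<omega>] lidealD(2)[OF I0]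
      by (auto intro!: exI[of _ 0] simp: convolution_simps)
    fix u v :: "'s \<Rightarrow>\<^sub>0 'r" assume "u \<in> ?N" "v \<in> ?N"
    then obtain n i n' i' where ni: "u = convolution n k + i" "v = convolution n' k + i'"
      "n \<in> M \<inter> \<omega>" "n' \<in> M \<inter> \<omega>" "i \<in> I0" "i' \<in> I0" by blast
    then have "u - v = convolution (n - n') k + (i - i')"
      by (simp add: convolution_simps)
    then show "u - v \<in> ?N"
      using ni lidealD(3)[OF M(1)] lidealD(3)[OF \<omega>] lidealD(3)[OF I0] by blast
  next
    fix a u :: "'s \<Rightarrow>\<^sub>0 'r" assume a: "a \<in> alg G" and "u \<in> ?N"
    then obtain n i where ni: "u = convolution n k + i" "n \<in> M \<inter> \<omega>" "i \<in> I0" by blast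
    then have "convolution a u = convolution (convolution a n) k + convolution a i"
      by (simp add: convolution_simps convolution_assoc)
    then show "convolution a u \<in> ?N"
      using ni a lidealD(6)[OF M(1)] lidealD(6)[OF \<omega>] lidealD(6)[OF I0] by blast
  qed
  moreover have "I0 \<subseteq> ?N"
  proof
    fix i assume "i \<in> I0"
    moreover have "i = convolution 0 k + i"
      by (simp add: convolution_simps)
    ultimately show "i \<in> ?N"
      using lidealD(2)[OF M(1)] lidealD(2)[OF \<omega>] by blast
  qed
  moreover have "?N \<subseteq> L"
    using lidealD(4,6)[OF L(1)] lidealD(1)[OF M(1)] k(1) L(2) by blast
  ultimately have "?N = I0 \<or> ?N = L"
    by (rule L_min)
  \<comment> \<open>If the image were \<open>L\<close>, then \<open>m1 k = n k\<close> modulo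
    \<open>I0\<close> for some \<open>n\<close> in \<open>\<omega>\<close>, so \<open>m1 - n\<close>
    would be in the kernel \<open>K\<close>, hence in \<open>\<omega>\<close>, and so would
    \<open>m1\<close>.\<close>
  moreover have "?N \<noteq> L"
  proof
    assume "?N = L"
    moreover have "convolution m1 k \<in> L"
      using lidealD(6)[OF L(1)] lidealD(1)[OF M(1)] k(1) m1(1) by blast
    ultimately obtain n i where ni: "convolution m1 k = convolution n k + i" "n \<in> M \<inter> \<omega>" "i \<in> I0"
      by blast
    then have "convolution (m1 - n) k = i"
      by (simp add: convolution_simps)
    then have "m1 - n \<in> K"
      using ni m1(1) lidealD(3)[OF M(1)] by (simp add: K_def)
    then have "(m1 - n) + n \<in> \<omega>"
      using K_\<omega> ni(2) lidealD(4)[OF \<omega>] by blast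
    then show False
      using m1(2) by simp
  qed
  ultimately have N: "convolution n k \<in> I0" if "n \<in> M \<inter> \<omega>" for n
    using that lidealD(2)[OF I0] by force
  have m1G: "m1 \<in> alg G"
    using m1 lidealD(1)[OF M(1)] by blast
  show False
  proof (rule invariant_contradiction[OF P'])
    show "convolution m1 k \<in> alg G"
      using algD(6) m1G k(2) by blast
    show "convolution m1 k \<notin> coset_ideal P Z G"
      using m1k by (simp add: I0_def)
    \<comment> \<open>\<open>h m1 - m1\<close> has augmentation 0 and thus lies in
      \<open>M \<inter> \<omega>\<close>, which \<open>k\<close> sends to \<open>I0\<close>: this is
      the invariance of \<open>m1 k\<close>.\<close>
    fix h assume h: "h \<in> G"
    have "convolution (basis h) m1 - m1 \<in> M"
      using lidealD(3,6)[OF M(1)] m1(1) basis_alg[OF h] by blast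
    moreover have "convolution (basis h) m1 - m1 \<in> alg G"
      by (intro algD(3,6) m1G basis_alg h)
    then have "convolution (basis h) m1 - m1 \<in> \<omega>"
      using lidealD(2)[OF P'] by (simp add: \<omega>_def augmentation_diff augmentation_convolution)
    ultimately have "convolution (convolution (basis h) m1 - m1) k \<in> I0"
      using N by blast
    then show "convolution (basis h) (convolution m1 k) - convolution m1 k \<in> coset_ideal P Z G"
      by (simp add: convolution_simps convolution_assoc I0_def)
  qed
qed

end

theorem artinian_finite:
  assumes dcc: "chain_condition False convolution (UNIV :: ('s::inverse_semigroup \<Rightarrow>\<^sub>0 'r::comm_ring_1) set)"
  shows "finite (UNIV :: 's set)"
proof (rule finite_inverse_semigroup)
  show "finite (idempotents :: 's set)"
    by (rule finite_idempotents[OF dcc])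
  fix e :: 's assume "e \<in> idempotents"
  then have e: "subgrp e (hclass e)"
    by (simp add: idempotents_iff subgrp_hclass)
  show "finite (hclass e)"
  proof (rule ccontr)
    assume inf: "infinite (hclass e)"
    obtain H where H: "subgrp e H" "infinite H" "\<And>K. subgrp e K \<Longrightarrow> K \<subset> H \<Longrightarrow> finite K"
      using minimal_infinite_subgroup[OF e inf subgroup_chain_condition[OF dcc e]] by metis
    obtain P :: "'r set" where P: "prime_ideal P"
      using artinian_prime_ideal[OF coefficients_chain_condition[OF dcc]] .
    interpret minimal_infinite_group e H "TYPE('r)"
      by unfold_locales (use H subgroup_chain_condition[OF dcc H(1)] in auto)
    show False
      using P by (rule contradiction)
  qed
qed

section \<open>The groupoid algebra\<close>

lemma composable:
  assumes "dm s = rg t"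
  shows "dm (s * t) = dm t" "rg (s * t) = rg s"
proof -
  have "dm (s * t) = sinv t * dm s * t"
    by (simp only: sinv_mult mult.assoc)
  also have "\<dots> = dm t"
    unfolding assms by (simp add: mult.assoc)
  finally show "dm (s * t) = dm t" .
  have "rg (s * t) = s * rg t * sinv s"
    by (simp only: sinv_mult mult.assoc)
  also have "\<dots> = rg s"
    unfolding assms[symmetric] by (simp add: mult.assoc)
  finally show "rg (s * t) = rg s" .
qed

lemma dm_rg_sinv: "dm (sinv s) = rg s" "rg (sinv s) = dm s"
  by simp_all

lemma dm_rg_idem: "e \<in> idempotents \<Longrightarrow> dm e = e" "e \<in> idempotents \<Longrightarrow> rg e = e"
  by (simp_all add: idempotents_iff sinv_idem)

text \<open>The product of the groupoid whose arrows \<open>s\<close> go from \<open>dm s\<close> to \<open>rg s\<close>.\<close>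

definition gmult :: "('s::inverse_semigroup \<Rightarrow>\<^sub>0 'r::comm_ring_1) \<Rightarrow> ('s \<Rightarrow>\<^sub>0 'r) \<Rightarrow> 's \<Rightarrow>\<^sub>0 'r"
  where "gmult = bilin (\<lambda>s t. if dm s = rg t then basis (s * t) else 0)"

lemmas gmult_simps = bilin_simps[where \<phi> = "\<lambda>s t. if dm s = rg t then basis (s * t) else 0", folded gmult_def]
lemmas gmult_sum = bilin_sum[where \<phi> = "\<lambda>s t. if dm s = rg t then basis (s * t) else 0", folded gmult_def]

lemma gmult_basis: "gmult (basis s) (basis t) = (if dm s = rg t then basis (s * t) else 0)"
  by (simp add: gmult_def bilin_basis)

lemma gmult_assoc: "gmult (gmult f g) h = gmult f (gmult g h)"
proof -
  have "gmult (gmult (basis s) (basis t)) (basis u) = gmult (basis s) (gmult (basis t) (basis u) :: 'a \<Rightarrow>\<^sub>0 'b)" for s t u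
  proof (cases "dm s = rg t")
    case st: True
    show ?thesis
      by (cases "dm t = rg u")
         (simp_all only: gmult_basis composable[OF st] st if_True if_False gmult_simps composable mult.assoc[of s] simp_thms)
  next
    case st: False
    show ?thesis
    proof (cases "dm t = rg u")
      case tu: True
      then show ?thesis
        using st by (simp only: gmult_basis composable(2)[OF tu] st if_True if_False gmult_simps simp_thms)
    qed (simp only: gmult_basis st if_False gmult_simps)
  qed
  then show ?thesis
    unfolding gmult_def by (intro bilin_assoc) (simp only: bilin_basis)
qed

text \<open>The lower set of \<open>s\<close> in the natural partial order, that is, the
  restrictions of \<open>s\<close> as a partial bijection.\<close>

definition below :: "'s::inverse_semigroup \<Rightarrow> 's set"
  where "below s = {t. s * dm t = t}"

lemma below_eq_image: "below s = (\<lambda>e. s * e) ` idempotents"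
proof
  show "below s \<subseteq> (\<lambda>e. s * e) ` idempotents"
  proof
    fix t assume "t \<in> below s"
    then have "t = s * dm t"
      by (simp only: below_def mem_Collect_eq)
    then show "t \<in> (\<lambda>e. s * e) ` idempotents"
      by (rule image_eqI) (rule dm_in)
  qed
  show "(\<lambda>e. s * e) ` idempotents \<subseteq> below s"
  proof
    fix t assume "t \<in> (\<lambda>e. s * e) ` idempotents"
    then obtain e where e: "e * e = e" "t = s * e"
      by (auto simp: idempotents_iff)
    have "dm t = e * dm s * e"
      by (simp add: e sinv_mult sinv_idem mult.assoc)
    also have "\<dots> = dm s * e * e"
      by (simp only: idem_commute[OF e(1) dm_idem])
    also have "\<dots> = dm s * e"
      using e by (simp only: mult.assoc)
    finally show "t \<in> below s"
      by (simp add: below_def e mult.assoc)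
  qed
qed

lemma self_below: "s \<in> below s"
  by (simp add: below_def)

lemma below_mono: "t \<in> below s \<Longrightarrow> below t \<subseteq> below s"
proof -
  assume "t \<in> below s"
  then obtain e where e: "e \<in> idempotents" "t = s * e"
    by (auto simp: below_eq_image)
  have "t * f \<in> below s" if "f \<in> idempotents" for f
  proof -
    have "e * f \<in> idempotents"
      using idem_mult_idem e(1) that by (simp add: idempotents_iff)
    then show ?thesis
      by (auto simp: below_eq_image e(2) mult.assoc)
  qed
  then show ?thesis
    by (auto simp: below_eq_image[of t])
qed

lemma below_antisym:
  assumes "t \<in> below s" "s \<in> below t"
  shows "s = t"
proof -
  have st: "s * dm t = t" "t * dm s = s"
    using assms by (auto simp: below_def)
  have "s = s * dm t * dm s"
    by (simp only: st)
  also have "\<dots> = s * (dm t * dm s)"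
    by (rule mult.assoc)
  also have "\<dots> = s * (dm s * dm t)"
    by (simp only: idem_commute[OF dm_idem[of t] dm_idem[of s]])
  also have "\<dots> = s * dm s * dm t"
    by (rule mult.assoc[symmetric])
  also have "\<dots> = t"
    using st(1) by (simp add: mult.assoc)
  finally show ?thesis .
qed

text \<open>Restrictions of \<open>s t\<close> factor uniquely into composable restrictions of
  \<open>s\<close> and \<open>t\<close>: restrict \<open>t\<close> to the domain of
  \<open>w\<close>, then \<open>s\<close> to the range of the result. This unique factorization is
  what makes \<open>hat\<close> multiplicative.\<close>

lemma below_mult_bij:
  "bij_betw (\<lambda>(u, v). u * v) {(u, v). u \<in> below s \<and> v \<in> below t \<and> dm u = rg v} (below (s * t))"
proof (rule bij_betwI[where g = "\<lambda>w. (s * rg (t * dm w), t * dm w)"])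
  show "(\<lambda>(u, v). u * v) \<in> {(u, v). u \<in> below s \<and> v \<in> below t \<and> dm u = rg v} \<rightarrow> below (s * t)"
  proof clarify
    fix u v assume u: "u \<in> below s" and v: "v \<in> below t" and uv: "dm u = rg v"
    have "u * v = s * rg v * v"
      using u uv by (simp add: below_def)
    also have "\<dots> = s * v"
      by (simp add: mult.assoc)
    also have "\<dots> = s * t * dm (u * v)"
      using v composable(1)[OF uv] by (simp add: below_def mult.assoc)
    finally show "u * v \<in> below (s * t)"
      by (simp add: below_def)
  qed
  have w: "t * dm w \<in> below t \<and> dm (t * dm w) = dm w \<and> s * rg (t * dm w) \<in> below s \<and>
      dm (s * rg (t * dm w)) = rg (t * dm w) \<and> s * (t * dm w) = w" if "w \<in> below (s * t)" for w
  proof -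
    define d where "d = dm w"
    have d: "d * d = d" "s * t * d = w"
      using that by (simp_all add: d_def below_def mult.assoc)
    define v where "v = t * d"
    have v_below: "v \<in> below t"
      unfolding v_def below_eq_image using d(1) by (auto simp: idempotents_iff)
    \<comment> \<open>Since \<open>d\<close> is the exact domain of \<open>s t d\<close>, it absorbs
      both \<open>dm t\<close> and the pullback of \<open>dm s\<close> along \<open>t\<close>. The
      first absorption gives \<open>dm v = d\<close>.\<close>
    have "dm w = d * (sinv t * (dm s * (t * d)))"
      unfolding d(2)[symmetric] by (simp add: sinv_mult sinv_idem[OF d(1)] mult.assoc)
    then have dd: "d = d * (sinv t * (dm s * (t * d)))"
      by (simp only: d_def[symmetric])
    have cdt: "dm t * d = d * dm t"
      by (rule idem_commute[OF dm_idem d(1)])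
    have "dm v = d * (dm t * d)"
      by (simp only: v_def sinv_mult sinv_idem[OF d(1)] mult.assoc)
    also have "\<dots> = d * d * dm t"
      by (simp only: cdt) (simp only: mult.assoc)
    finally have dv: "dm v = d * dm t"
      by (simp only: d(1))
    have "d * dm t = d * (sinv t * (dm s * (t * d))) * dm t"
      by (simp only: dd[symmetric])
    also have "\<dots> = d * (sinv t * (dm s * (t * (d * dm t))))"
      by (simp only: mult.assoc)
    also have "\<dots> = d * (sinv t * (dm s * (t * (dm t * d))))"
      by (simp only: cdt)
    also have "\<dots> = d * (sinv t * (dm s * (t * d)))"
      by (simp add: mult.assoc)
    finally have dm_v: "dm v = d"
      using dv dd by simp
    have "rg v = t * d * sinv t"
    proof -
      have "rg v = t * (d * d) * sinv t"
        by (simp only: v_def sinv_mult sinv_idem[OF d(1)] mult.assoc)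
      then show ?thesis by (simp only: d(1))
    qed
    have c: "rg v * dm s = dm s * rg v"
      by (rule idem_commute[OF rg_idem dm_idem])
    \<comment> \<open>The second absorption says that \<open>dm s\<close> fixes \<open>v\<close>, so
      \<open>rg v\<close> lies below \<open>dm s\<close> and the restriction \<open>s * rg v\<close>
      has domain exactly \<open>rg v\<close>.\<close>
    have "v = v * d"
      using d(1) by (simp add: v_def mult.assoc)
    also have "\<dots> = v * (d * (sinv t * (dm s * (t * d))))"
      by (simp only: dd[symmetric])
    also have "\<dots> = (t * d * sinv t) * (dm s * v)"
      using d(1) by (simp add: v_def mult.assoc) (simp add: mult.assoc[symmetric])
    also have "\<dots> = rg v * (dm s * v)"
      by (simp only: \<open>rg v = t * d * sinv t\<close>)
    also have "\<dots> = rg v * dm s * v"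
      by (rule mult.assoc[symmetric])
    also have "\<dots> = dm s * rg v * v"
      by (simp only: c)
    finally have sv: "v = dm s * v"
      by (simp add: mult.assoc)
    have "dm (s * rg v) = rg v * dm s * rg v"
      by (subst sinv_mult) (simp only: sinv_idem[OF rg_idem[of v]] mult.assoc)
    also have "\<dots> = dm s * (rg v * rg v)"
      unfolding c by (rule mult.assoc)
    also have "\<dots> = dm s * v * sinv v"
      by (simp only: rg_idem) (simp only: mult.assoc)
    also have "\<dots> = rg v"
      by (simp only: sv[symmetric])
    finally have "dm (s * rg v) = rg v" .
    moreover have "s * rg v \<in> below s"
      by (simp add: below_eq_image)
    moreover have "s * v = w"
      using d(2) by (simp add: v_def mult.assoc)
    ultimately show ?thesis
      using v_below dm_v by (simp only: v_def d_def simp_thms)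
  qed
  show "(\<lambda>w. (s * rg (t * dm w), t * dm w)) \<in> below (s * t) \<rightarrow> {(u, v). u \<in> below s \<and> v \<in> below t \<and> dm u = rg v}"
    using w by auto
  show "(\<lambda>(u, v). u * v) ((\<lambda>w. (s * rg (t * dm w), t * dm w)) w) = w" if "w \<in> below (s * t)" for w
  proof -
    have "s * rg v * v = s * v" for v
      by (simp add: mult.assoc)
    from this[of "t * dm w"] show ?thesis
      using w[OF that] by (simp only: prod.case)
  qed
  show "(\<lambda>w. (s * rg (t * dm w), t * dm w)) ((\<lambda>(u, v). u * v) p) = p"
    if "p \<in> {(u, v). u \<in> below s \<and> v \<in> below t \<and> dm u = rg v}" for p
  proof -
    obtain u v where p: "p = (u, v)"
      by (cases p)
    have "s * dm u = u \<and> t * dm v = v \<and> dm u = rg v"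
      using that unfolding p below_def mem_Collect_eq prod.case .
    then have u: "s * dm u = u" and v: "t * dm v = v" and uv: "dm u = rg v"
      by blast+
    show ?thesis
      by (simp only: p prod.case composable(1)[OF uv] v uv[symmetric] u)
  qed
qed

text \<open>The zeta transform of the natural order. A sum over an infinite set is 0, so it is
  meaningful only when all lower sets are finite, as they are with finitely many
  idempotents.\<close>

definition hat :: "('s::inverse_semigroup \<Rightarrow>\<^sub>0 'r::comm_ring_1) \<Rightarrow> 's \<Rightarrow>\<^sub>0 'r"
  where "hat = lin (\<lambda>s. \<Sum>t\<in>below s. basis t)"

lemma lideal_image:
  assumes "bij h" "\<And>x y. h (x - y) = h x - h y" "\<And>x y. h (m x y) = m' (h x) (h y)"
    and I: "lideal m UNIV I"
  shows "lideal m' UNIV (h ` I)"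
proof (rule lidealI)
  have "h 0 = 0"
    using assms(2)[of 0 0] by simp
  then show "0 \<in> h ` I"
    using lidealD(2)[OF I] by (metis image_eqI)
  show "x - y \<in> h ` I" if "x \<in> h ` I" "y \<in> h ` I" for x y
    using that lidealD(3)[OF I] by (auto simp: assms(2)[symmetric])
  show "m' a x \<in> h ` I" if x: "x \<in> h ` I" for a x
  proof -
    obtain b where "a = h b"
      using bij_is_surj[OF assms(1)] by (metis surjD)
    moreover obtain y where "x = h y" "y \<in> I"
      using x by (rule imageE)
    ultimately show ?thesis
      using lidealD(6)[OF I, of b y] by (simp add: assms(3)[symmetric])
  qed
qed simp

lemma chain_condition_iso:
  assumes h: "bij h" "\<And>x y. h (x - y) = h x - h y" "\<And>x y. h (m x y) = m' (h x) (h y)"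
    and "chain_condition asc m' UNIV"
  shows "chain_condition asc m UNIV"
proof (rule chain_condition_transfer[OF assms(4), where F = "\<lambda>I. h ` I" and G = "\<lambda>J. h -` J"])
  show "lideal m' UNIV (h ` I)" if "lideal m UNIV I" for I
    by (rule lideal_image[where h = h and m' = m', OF h that])
  show "h -` (h ` I) = I" for I
    by (rule inj_vimage_image_eq[OF bij_is_inj[OF h(1)]])
qed (auto simp: mono_def)

lemma right_units_iso:
  assumes h: "bij h" "\<And>x y. h (x - y) = h x - h y" "\<And>x y. h (m x y) = m' (h x) (h y)"
    and "right_units m' UNIV"
  shows "right_units m UNIV"
  unfolding right_units_def
proof (intro allI impI)
  fix I assume "lideal m UNIV I"
  then have "lideal m' UNIV (h ` I)"
    by (rule lideal_image[where h = h and m' = m', OF h])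
  then obtain u where u: "u \<in> I" "\<And>x. x \<in> I \<Longrightarrow> m' (h x) (h u) = h x"
    using assms(4) unfolding right_units_def by blast
  then have "m x u = x" if "x \<in> I" for x
    using that injD[OF bij_is_inj[OF h(1)]] by (metis h(3))
  then show "\<exists>u\<in>I. \<forall>x\<in>I. m x u = x"
    using u(1) by blast
qed

text \<open>The choice is made from the set of all \<open>f\<close> joined to \<open>e\<close> by an
  arrow. Idempotents of one component have the same such set, so they receive the same
  representative.\<close>

definition rep :: "'s::inverse_semigroup \<Rightarrow> 's"
  where "rep e = (SOME f. \<exists>x. rg x = e \<and> dm x = f)"

text \<open>A chosen arrow from the representative of the component to \<open>e\<close>; it
  trivializes the component.\<close>

definition link :: "'s::inverse_semigroup \<Rightarrow> 's"
  where "link e = (SOME x. rg x = e \<and> dm x = rep e)"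

lemma link:
  assumes "e \<in> idempotents"
  shows "rg (link e) = e" "dm (link e) = rep e" "rep e \<in> idempotents"
proof -
  have "\<exists>x. rg x = e \<and> dm x = e"
    using dm_rg_idem[OF assms] by blast
  then have "\<exists>f x. rg x = e \<and> dm x = f"
    by blast
  then have "\<exists>x. rg x = e \<and> dm x = rep e"
    unfolding rep_def by (rule someI_ex)
  then have *: "rg (link e) = e \<and> dm (link e) = rep e"
    unfolding link_def by (rule someI_ex)
  then show "rg (link e) = e" "dm (link e) = rep e" by auto
  show "rep e \<in> idempotents"
    using * dm_in[of "link e"] by simp
qed

text \<open>Composing with \<open>s\<close> or its inverse shows that the two choice predicates
  coincide, and equal predicates have equal choices.\<close>

lemma rep_rg_dm: "rep (rg s) = rep (dm s)"
proof -
  have "(\<exists>x. rg x = rg s \<and> dm x = f) \<longleftrightarrow> (\<exists>x. rg x = dm s \<and> dm x = f)" for f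
  proof
    assume "\<exists>x. rg x = rg s \<and> dm x = f"
    then obtain x where x: "rg x = rg s" "dm x = f" by blast
    then have "dm (sinv s) = rg x" by simp
    from composable[OF this] show "\<exists>x. rg x = dm s \<and> dm x = f"
      using x by (metis dm_rg_sinv(2))
  next
    assume "\<exists>x. rg x = dm s \<and> dm x = f"
    then obtain x where x: "rg x = dm s" "dm x = f" by blast
    then have "dm s = rg x" by simp
    from composable[OF this] show "\<exists>x. rg x = rg s \<and> dm x = f"
      using x by metis
  qed
  then show ?thesis
    by (simp add: rep_def)
qed

lemma rep_rep: "e \<in> idempotents \<Longrightarrow> rep (rep e) = rep e"
  using rep_rg_dm[of "link e"] link by metis

text \<open>The entry in row \<open>e\<close> and column \<open>f\<close>: arrows from
  \<open>f\<close> to \<open>e\<close> are moved into the group at \<open>rep e\<close> along the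
  chosen links. \<open>embed\<close> places a group algebra element back at that entry.\<close>

definition coord :: "'s::inverse_semigroup \<Rightarrow> 's \<Rightarrow> ('s \<Rightarrow>\<^sub>0 'r::comm_ring_1) \<Rightarrow> 's \<Rightarrow>\<^sub>0 'r"
  where "coord e f = lin (\<lambda>s. if rg s = e \<and> dm s = f then basis (sinv (link e) * s * link f) else 0)"

definition embed :: "'s::inverse_semigroup \<Rightarrow> 's \<Rightarrow> ('s \<Rightarrow>\<^sub>0 'r::comm_ring_1) \<Rightarrow> 's \<Rightarrow>\<^sub>0 'r"
  where "embed e f = lin (\<lambda>g. basis (link e * g * sinv (link f)))"

lemma link_conj:
  assumes s: "rg s = e" "dm s = f"
  shows "sinv (link e) * s * link f \<in> hclass (rep e)" "rep f = rep e"
    "link e * (sinv (link e) * s * link f) * sinv (link f) = s"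
proof -
  have ef: "e \<in> idempotents" "f \<in> idempotents"
    using s rg_in[of s] dm_in[of s] by simp_all
  have 1: "dm (sinv (link e)) = rg s"
    using link(1)[OF ef(1)] s by simp
  have 2: "dm (sinv (link e) * s) = rg (link f)"
    using composable(1)[OF 1] s link(1)[OF ef(2)] by simp
  show rf: "rep f = rep e"
    using rep_rg_dm[of s] s by simp
  have "rg (sinv (link e) * s * link f) = rep e"
    using composable(2)[OF 2] composable(2)[OF 1] link(2)[OF ef(1)] by simp
  moreover have "dm (sinv (link e) * s * link f) = rep e"
    using composable(1)[OF 2] link(2)[OF ef(2)] rf by simp
  ultimately show "sinv (link e) * s * link f \<in> hclass (rep e)"
    by (simp add: hclass_def)
  have "link e * (sinv (link e) * s * link f) * sinv (link f) = rg (link e) * s * rg (link f)"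
    by (simp only: mult.assoc)
  also have "\<dots> = rg s * s * dm s"
    by (simp only: link(1)[OF ef(1)] link(1)[OF ef(2)] s)
  finally show "link e * (sinv (link e) * s * link f) * sinv (link f) = s"
    by (simp add: mult.assoc)
qed

lemma link_arrow:
  assumes ef: "e \<in> idempotents" "f \<in> idempotents" "rep f = rep e" and g: "g \<in> hclass (rep e)"
  shows "rg (link e * g * sinv (link f)) = e" "dm (link e * g * sinv (link f)) = f"
    "sinv (link e) * (link e * g * sinv (link f)) * link f = g"
proof -
  have gr: "rg g = rep e" "dm g = rep e"
    using g by (auto simp: hclass_def)
  have 1: "dm (link e) = rg g"
    using link(2)[OF ef(1)] gr by simp
  have 2: "dm (link e * g) = rg (sinv (link f))"
    using composable(1)[OF 1] gr link(2)[OF ef(2)] ef(3) by simp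
  show "rg (link e * g * sinv (link f)) = e"
    using composable(2)[OF 2] composable(2)[OF 1] link(1)[OF ef(1)] by simp
  show "dm (link e * g * sinv (link f)) = f"
    using composable(1)[OF 2] link(1)[OF ef(2)] by simp
  have "sinv (link e) * (link e * g * sinv (link f)) * link f = dm (link e) * g * dm (link f)"
    by (simp only: mult.assoc)
  also have "\<dots> = rg g * g * dm g"
    by (simp only: link(2)[OF ef(1)] link(2)[OF ef(2)] ef(3) gr)
  finally show "sinv (link e) * (link e * g * sinv (link f)) * link f = g"
    by (simp add: mult.assoc)
qed

lemma coord_diff: "coord e f (x - y) = coord e f x - coord e f y"
  and coord_add: "coord e f (x + y) = coord e f x + coord e f y"
  and coord_scale: "coord e f (scale c x) = scale c (coord e f x)"
  and coord_0: "coord e f 0 = 0"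
  by (simp_all add: coord_def lin_diff lin_add lin_scale)

lemma supp_coord: "supp (coord e f x) \<subseteq> hclass (rep e)"
  unfolding coord_def by (rule supp_lin) (use link_conj(1) in auto)

lemma coord_eq_0:
  assumes "rep e \<noteq> rep f"
  shows "coord e f x = 0"
proof -
  have "coord e f x = lin (\<lambda>_. 0) x"
    unfolding coord_def
  proof (rule lin_cong)
    show "(if rg s = e \<and> dm s = f then basis (sinv (link e) * s * link f) else 0) = 0" for s
      using link_conj(2)[of s e f] assms by auto
  qed
  then show ?thesis
    by (simp add: lin_fun)
qed

lemma coord_embed:
  assumes ef: "e \<in> idempotents" "f \<in> idempotents" "rep f = rep e" and a: "supp a \<subseteq> hclass (rep e)"
  shows "coord e' f' (embed e f a) = (if e' = e \<and> f' = f then a else 0)"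
proof -
  have "coord e' f' (embed e f a) = lin (\<lambda>g. if e' = e \<and> f' = f then basis g else 0) a"
    unfolding embed_def coord_def lin_lin
  proof (rule lin_cong)
    fix g assume "g \<in> supp a"
    then have "g \<in> hclass (rep e)"
      using a by blast
    from link_arrow[OF ef this] show "lin (\<lambda>s. if rg s = e' \<and> dm s = f' then basis (sinv (link e') * s * link f') else 0)
        (basis (link e * g * sinv (link f))) = (if e' = e \<and> f' = f then basis g else 0)"
      by auto
  qed
  then show ?thesis
    by (cases "e' = e \<and> f' = f") (simp_all only: if_True if_False lin_basis lin_fun simp_thms)
qed

locale finite_idempotents =
  fixes E :: "'s::inverse_semigroup set"
  assumes E_def: "E = idempotents" and finite_E: "finite E"
begin

lemma finite_below: "finite (below (s :: 's))"
  using finite_E by (simp add: below_eq_image E_def)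

lemma hat_convolution:
  fixes f g :: "'s \<Rightarrow>\<^sub>0 'r::comm_ring_1"
  shows "hat (convolution f g) = gmult (hat f) (hat g)"
proof -
  have basis: "(\<Sum>w\<in>below (s * t). basis w) =
      gmult (\<Sum>u\<in>below s. basis u) (\<Sum>v\<in>below t. basis v :: 's \<Rightarrow>\<^sub>0 'r)" for s t
  proof -
    let ?C = "{(u, v). u \<in> below s \<and> v \<in> below t \<and> dm u = rg v}"
    have "gmult (\<Sum>u\<in>below s. basis u) (\<Sum>v\<in>below t. basis v :: 's \<Rightarrow>\<^sub>0 'r) =
        (\<Sum>p\<in>below s \<times> below t. if dm (fst p) = rg (snd p) then basis (fst p * snd p) else 0)"
      unfolding gmult_sum(1) unfolding gmult_sum(2)
      by (simp only: gmult_basis sum.cartesian_product case_prod_unfold)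
    also have "\<dots> = (\<Sum>p\<in>?C. basis (fst p * snd p))"
      by (rule sum.mono_neutral_cong_right) (auto simp: finite_below)
    also have "\<dots> = (\<Sum>p\<in>?C. basis (case p of (u, v) \<Rightarrow> u * v))"
      by (simp only: case_prod_unfold)
    also have "\<dots> = (\<Sum>w\<in>below (s * t). basis w)"
      by (rule sum.reindex_bij_betw[OF below_mult_bij])
    finally show ?thesis ..
  qed
  have "hat (convolution f g) = lin (\<lambda>s. lin (\<lambda>t. gmult (\<Sum>u\<in>below s. basis u) (\<Sum>v\<in>below t. basis v)) g) f"
    unfolding basis[symmetric] by (simp add: convolution_bilin hat_def lin_bilin) (simp add: bilin_def)
  also have "\<dots> = gmult (hat f) (hat g)"
    unfolding gmult_def hat_def by (rule bilin_lin_lin[symmetric])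
  finally show ?thesis .
qed

lemma hat_diff: "hat (f - g) = hat f - hat g"
  and hat_add: "hat (f + g) = hat f + hat g"
  and hat_scale: "hat (scale c f) = scale c (hat f)"
  by (simp_all add: hat_def lin_diff lin_add lin_scale)

lemma card_below_less: "t \<in> below s \<Longrightarrow> t \<noteq> s \<Longrightarrow> card (below t) < card (below (s :: 's))"
  by (metis below_antisym below_mono finite_below psubsetI psubset_card_mono self_below)

text \<open>\<open>hat\<close> is unitriangular for the natural order. \<open>S\<close> may be
  infinite, so \<open>card (below s)\<close> serves as the rank: for injectivity, a support element
  of largest rank keeps its coefficient; for surjectivity, basis elements are reached by induction
  on the rank.\<close>

lemma bij_hat: "bij (hat :: ('s \<Rightarrow>\<^sub>0 'r::comm_ring_1) \<Rightarrow> _)"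
proof (rule bijI)
  have zero: "f = 0" if "hat f = 0" for f :: "'s \<Rightarrow>\<^sub>0 'r"
  proof (rule ccontr)
    assume "f \<noteq> 0"
    then have ne: "supp f \<noteq> {}" by simp
    then have "Max ((\<lambda>s. card (below s)) ` supp f) \<in> (\<lambda>s. card (below s)) ` supp f"
      by (intro Max_in) auto
    then obtain s where s: "s \<in> supp f" "card (below s) = Max ((\<lambda>s. card (below s)) ` supp f)"
      by (metis (no_types, lifting) imageE)
    have max: "t = s" if "t \<in> supp f" "s \<in> below t" for t
    proof -
      have "card (below t) \<le> card (below s)"
        unfolding s(2) by (rule Max_ge) (use that in auto)
      then show ?thesis
        using card_below_less[OF that(2)] by force
    qed
    have "coef (hat f) s = (\<Sum>t\<in>supp f. coef f t * (if s \<in> below t then 1 else 0))"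
      by (simp add: hat_def coef_lin coef_sum_basis finite_below)
    also have "\<dots> = (\<Sum>t\<in>supp f. if t = s then coef f s else 0)"
      by (rule sum.cong) (use max self_below in auto)
    also have "\<dots> = coef f s"
      using s(1) by simp
    finally show False
      using that s(1) by (simp add: in_keys_iff)
  qed
  show "inj (hat :: ('s \<Rightarrow>\<^sub>0 'r) \<Rightarrow> _)"
  proof (rule injI)
    fix f g :: "'s \<Rightarrow>\<^sub>0 'r" assume "hat f = hat g"
    then have "hat (f - g) = 0"
      by (simp add: hat_diff)
    then show "f = g"
      using zero by fastforce
  qed
  have "\<exists>f :: 's \<Rightarrow>\<^sub>0 'r. hat f = basis t" for t
  proof (induction "card (below t)" arbitrary: t rule: less_induct)
    case less
    have "\<forall>u\<in>below t - {t}. \<exists>f :: 's \<Rightarrow>\<^sub>0 'r. hat f = basis u"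
      using less card_below_less by blast
    then obtain F :: "'s \<Rightarrow> 's \<Rightarrow>\<^sub>0 'r" where F: "\<And>u. u \<in> below t - {t} \<Longrightarrow> hat (F u) = basis u"
      by metis
    have "hat (basis t - (\<Sum>u\<in>below t - {t}. F u)) = (\<Sum>u\<in>below t. basis u) - (\<Sum>u\<in>below t - {t}. hat (F u))"
      by (simp add: hat_def lin_diff lin_sum)
    also have "(\<Sum>u\<in>below t - {t}. hat (F u)) = (\<Sum>u\<in>below t - {t}. basis u)"
      by (rule sum.cong) (use F in auto)
    also have "(\<Sum>u\<in>below t. basis u) - (\<Sum>u\<in>below t - {t}. basis u) = (basis t :: 's \<Rightarrow>\<^sub>0 'r)"
      using sum.remove[OF finite_below self_below, of "basis :: 's \<Rightarrow> 's \<Rightarrow>\<^sub>0 'r" t] by (simp add: algebra_simps)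
    finally show ?case by blast
  qed
  then obtain F where F: "\<And>t. hat (F t :: 's \<Rightarrow>\<^sub>0 'r) = basis t" by metis
  have "hat (lin F g) = g" for g :: "'s \<Rightarrow>\<^sub>0 'r"
    using F by (simp add: hat_def lin_lin)
  then show "surj (hat :: ('s \<Rightarrow>\<^sub>0 'r) \<Rightarrow> _)"
    by (metis surjI)
qed

lemma chain_condition_hat:
  "chain_condition asc gmult (UNIV :: ('s \<Rightarrow>\<^sub>0 'r::comm_ring_1) set) \<Longrightarrow>
   chain_condition asc convolution (UNIV :: ('s \<Rightarrow>\<^sub>0 'r) set)"
  by (rule chain_condition_iso[where h = hat and m' = gmult, OF bij_hat hat_diff hat_convolution])

lemma right_units_hat:
  "right_units gmult (UNIV :: ('s \<Rightarrow>\<^sub>0 'r::comm_ring_1) set) \<Longrightarrow>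
   right_units convolution (UNIV :: ('s \<Rightarrow>\<^sub>0 'r) set)"
  by (rule right_units_iso[where h = hat and m' = gmult, OF bij_hat hat_diff hat_convolution])

text \<open>The sum of the identity arrows, which is the identity of the groupoid algebra; its
  preimage under \<open>hat\<close> is the identity of \<open>RS\<close>.\<close>

definition gunit :: "'s \<Rightarrow>\<^sub>0 'r::comm_ring_1"
  where "gunit = (\<Sum>e\<in>E. basis e)"

lemma gunit: "gmult gunit x = x" "gmult x gunit = (x :: 's \<Rightarrow>\<^sub>0 'r::comm_ring_1)"
proof -
  have "gmult gunit (basis t) = (basis t :: 's \<Rightarrow>\<^sub>0 'r)" "gmult (basis t) gunit = (basis t :: 's \<Rightarrow>\<^sub>0 'r)" for t
  proof -
    have "gmult gunit (basis t) = (\<Sum>e\<in>E. if e = rg t then basis t else 0 :: 's \<Rightarrow>\<^sub>0 'r)"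
      unfolding gunit_def gmult_sum gmult_basis
      by (intro sum.cong refl) (auto simp: E_def dm_rg_idem mult.assoc)
    then show "gmult gunit (basis t) = (basis t :: 's \<Rightarrow>\<^sub>0 'r)"
      using finite_E by (simp add: E_def)
    have "gmult (basis t) gunit = (\<Sum>e\<in>E. if e = dm t then basis t else 0 :: 's \<Rightarrow>\<^sub>0 'r)"
      unfolding gunit_def gmult_sum gmult_basis
      by (intro sum.cong refl) (auto simp: E_def dm_rg_idem mult.assoc)
    then show "gmult (basis t) gunit = (basis t :: 's \<Rightarrow>\<^sub>0 'r)"
      using finite_E by (simp add: E_def)
  qed
  then have "gmult gunit (lin basis x) = lin basis x" "gmult (lin basis x) gunit = lin basis x"
    unfolding gmult_def by (simp_all only: bilin_lin_left bilin_lin_right)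
  then show "gmult gunit x = x" "gmult x gunit = x" by simp_all
qed

lemma gmult_scale_unit: "gmult (scale c gunit) x = scale c (x :: 's \<Rightarrow>\<^sub>0 'r::comm_ring_1)"
  by (simp add: gmult_simps gunit)

lemma coord_gmult:
  fixes x y :: "'s \<Rightarrow>\<^sub>0 'r::comm_ring_1"
  shows "coord e f (gmult x y) = (\<Sum>k\<in>E. convolution (coord e k x) (coord k f y))"
proof -
  let ?c = "\<lambda>e f s. if rg s = e \<and> dm s = f then basis (sinv (link e) * s * link f) else 0 :: 's \<Rightarrow>\<^sub>0 'r"
  have basis: "lin (?c e f) (if dm s = rg t then basis (s * t) else 0) =
      (\<Sum>k\<in>E. convolution (?c e k s) (?c k f t))" for s t
  proof -
    \<comment> \<open>Only the intermediate object \<open>k = dm s\<close> contributes, and there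
      the links at \<open>k\<close> cancel: \<open>link k\<close> times its inverse is
      \<open>k\<close>, which \<open>s\<close> absorbs.\<close>
    have "convolution (?c e k s) (?c k f t) = (if k = dm s then lin (?c e f) (if dm s = rg t then basis (s * t) else 0) else 0)"
      if "k \<in> E" for k
    proof (cases "k = dm s \<and> k = rg t \<and> rg s = e \<and> dm t = f")
      case True
      then have k: "k = dm s" "k = rg t" and ef: "rg s = e" "dm t = f"
        by blast+
      have c: "dm s = rg t"
        by (rule k(1)[symmetric, THEN trans, OF k(2)])
      have "sinv (link e) * s * link k * (sinv (link k) * t * link f) = sinv (link e) * (s * rg (link k)) * t * link f"
        by (simp only: mult.assoc)
      also have "rg (link k) = dm s"
        using link(1)[of k] that by (simp only: E_def k(1)[symmetric])
      finally have "sinv (link e) * s * link k * (sinv (link k) * t * link f) = sinv (link e) * (s * t) * link f"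
        by (simp add: mult.assoc)
      moreover have "rg (s * t) = e" "dm (s * t) = f"
        by (simp_all only: composable[OF c] ef)
      ultimately show ?thesis
        by (simp only: k(1) c ef convolution_basis lin_single scale_simps if_True simp_thms mult_1)
    next
      case False
      then have "convolution (?c e k s) (?c k f t) = 0"
        by (auto simp: convolution_simps)
      moreover have "lin (?c e f) (if dm s = rg t then basis (s * t) else 0) = 0" if "k = dm s"
      proof (cases "dm s = rg t")
        case c: True
        then have "\<not> (rg (s * t) = e \<and> dm (s * t) = f)"
          using composable[OF c] that False by auto
        then show ?thesis by auto
      qed simp
      ultimately show ?thesis by simp
    qed
    then have "(\<Sum>k\<in>E. convolution (?c e k s) (?c k f t)) =
        (\<Sum>k\<in>E. if k = dm s then lin (?c e f) (if dm s = rg t then basis (s * t) else 0) else 0)"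
      by (intro sum.cong) auto
    also have "\<dots> = lin (?c e f) (if dm s = rg t then basis (s * t) else 0)"
      using finite_E dm_in[of s] by (simp only: sum.delta' E_def[symmetric]) (simp add: E_def)
    finally show ?thesis ..
  qed
  have "coord e f (gmult x y) = lin (\<lambda>s. lin (\<lambda>t. \<Sum>k\<in>E. convolution (?c e k s) (?c k f t)) y) x"
    unfolding basis[symmetric] by (simp add: coord_def gmult_def lin_bilin) (simp add: bilin_def)
  also have "\<dots> = (\<Sum>k\<in>E. lin (\<lambda>s. lin (\<lambda>t. convolution (?c e k s) (?c k f t)) y) x)"
    by (simp only: lin_fun_sum)
  also have "\<dots> = (\<Sum>k\<in>E. convolution (coord e k x) (coord k f y))"
    unfolding coord_def convolution_bilin bilin_lin_lin ..
  finally show ?thesis .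
qed

lemma sum_embed_coord:
  fixes x :: "'s \<Rightarrow>\<^sub>0 'r::comm_ring_1"
  shows "(\<Sum>e\<in>E. \<Sum>f\<in>E. embed e f (coord e f x)) = x"
proof -
  have "(\<Sum>e\<in>E. \<Sum>f\<in>E. embed e f (coord e f x)) =
      lin (\<lambda>s. \<Sum>e\<in>E. \<Sum>f\<in>E. if rg s = e \<and> dm s = f then basis s else 0) x"
    unfolding embed_def coord_def lin_lin lin_fun_sum[symmetric]
    by (intro lin_cong sum.cong refl) (auto simp: link_conj(3))
  also have "\<dots> = lin basis x"
  proof (rule lin_cong)
    fix s
    have "(\<Sum>f\<in>E. if rg s = e \<and> dm s = f then basis s else 0) = (if rg s = e then basis s else 0 :: 's \<Rightarrow>\<^sub>0 'r)" for e
      using finite_E dm_in[of s] by (simp add: E_def)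
    then show "(\<Sum>e\<in>E. \<Sum>f\<in>E. if rg s = e \<and> dm s = f then basis s else 0) = (basis s :: 's \<Rightarrow>\<^sub>0 'r)"
      using finite_E rg_in[of s] by (simp add: E_def)
  qed
  finally show ?thesis by simp
qed

lemma coord_eqI:
  fixes x y :: "'s \<Rightarrow>\<^sub>0 'r::comm_ring_1"
  assumes "\<And>e f. e \<in> E \<Longrightarrow> f \<in> E \<Longrightarrow> coord e f x = coord e f y"
  shows "x = y"
proof -
  have "x = (\<Sum>e\<in>E. \<Sum>f\<in>E. embed e f (coord e f x))"
    by (simp only: sum_embed_coord)
  also have "\<dots> = (\<Sum>e\<in>E. \<Sum>f\<in>E. embed e f (coord e f y))"
    using assms by (intro sum.cong refl) simp
  finally show ?thesis
    by (simp only: sum_embed_coord)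
qed

end

section \<open>Chain conditions and right units of the groupoid algebra\<close>

lemma alg_scale: "f \<in> alg A \<Longrightarrow> scale c f \<in> alg A"
  using supp_scale[of c f] by (auto simp: alg_def)

lemma stabilizesI_lideals:
  assumes "chain_condition asc m C" "\<And>n. lideal m C (I n)" "set_chain asc I"
  shows "stabilizes I"
  using assms unfolding chain_condition_def by blast

context finite_idempotents
begin

lemma chain_condition_gmult:
  assumes acc: "\<And>e. e \<in> E \<Longrightarrow> chain_condition asc convolution (alg (hclass e) :: ('s \<Rightarrow>\<^sub>0 'r::comm_ring_1) set)"
  shows "chain_condition asc gmult (UNIV :: ('s \<Rightarrow>\<^sub>0 'r) set)"
  unfolding chain_condition_def
proof (intro allI impI, elim conjE)
  fix I :: "nat \<Rightarrow> ('s \<Rightarrow>\<^sub>0 'r) set"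
  assume I: "\<forall>n. lideal gmult UNIV (I n)" and chain: "set_chain asc I"
  \<comment> \<open>Left ideals do not survive restriction to the kernels of coordinates, since
    general multiplication mixes rows. Multiplication by diagonal entries acts within one row and
    kills the others; closure under it is inherited by the kernels and suffices to make each
    coordinate image a left ideal of a group algebra.\<close>
  define Q where "Q M \<longleftrightarrow> 0 \<in> M \<and> (\<forall>x\<in>M. \<forall>y\<in>M. x - y \<in> M) \<and>
    (\<forall>e\<in>E. \<forall>b\<in>alg (hclass (rep e)). \<forall>x\<in>M. gmult (embed e e b) x \<in> M)" for M :: "('s \<Rightarrow>\<^sub>0 'r) set"
  define c where "c t x = coord (fst t) (snd t) x" for t :: "'s \<times> 's" and x :: "'s \<Rightarrow>\<^sub>0 'r"
  have rep_E: "rep e \<in> E" if "e \<in> E" for e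
    using link(3) that by (simp add: E_def)
  have act: "coord e' f (gmult (embed e e b) x) = (if e' = e then convolution b (coord e f x) else 0)"
    if "e \<in> E" "b \<in> alg (hclass (rep e))" for e e' f b and x :: "'s \<Rightarrow>\<^sub>0 'r"
  proof -
    have "coord e' f (gmult (embed e e b) x) = (\<Sum>k\<in>E. if k = e then if e' = e then convolution b (coord k f x) else 0 else 0)"
      unfolding coord_gmult
      by (intro sum.cong refl) (use that in \<open>simp add: coord_embed E_def alg_def convolution_simps\<close>)
    also have "\<dots> = (if e' = e then convolution b (coord e f x) else 0)"
      using that(1) finite_E by simp
    finally show ?thesis .
  qed
  show "stabilizes I"
  proof (rule stabilizes_by_coordinates[where T = "E \<times> E" and c = c and Q = Q and asc = asc])
    show "finite (E \<times> E)"
      using finite_E by simp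
    show "c t (x - y) = c t x - c t y" for t x y
      by (simp add: c_def coord_diff)
    show "x - y \<in> M" if "Q M" "x \<in> M" "y \<in> M" for M x y
      using that by (simp add: Q_def)
    show "Q {x \<in> M. \<forall>t\<in>U. c t x = 0}" if "Q M" "U \<subseteq> E \<times> E" for M U
      using that(1) by (auto simp: Q_def c_def coord_0 coord_diff act convolution_simps)
    show "stabilizes (\<lambda>n. c t ` M n)" if t: "t \<in> E \<times> E" and M: "\<And>n. Q (M n)" "set_chain asc M" for t M
    proof -
      obtain e f where ef: "t = (e, f)" "e \<in> E"
        using t by auto
      show ?thesis
      proof (rule stabilizesI_lideals)
        show "chain_condition asc convolution (alg (hclass (rep e)) :: ('s \<Rightarrow>\<^sub>0 'r) set)"
          by (rule acc[OF rep_E[OF ef(2)]])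
        show "lideal convolution (alg (hclass (rep e))) (c t ` M n)" for n
        proof (rule lidealI)
          show "c t ` M n \<subseteq> alg (hclass (rep e))"
            using supp_coord by (auto simp: c_def ef alg_def)
          show "0 \<in> c t ` M n"
            using M(1)[of n] by (auto simp: Q_def c_def coord_0 intro!: image_eqI[of _ _ 0])
          show "x - y \<in> c t ` M n" if "x \<in> c t ` M n" "y \<in> c t ` M n" for x y
            using that M(1)[of n] by (auto simp: Q_def c_def coord_diff[symmetric])
          show "convolution b x \<in> c t ` M n" if b: "b \<in> alg (hclass (rep e))" and x: "x \<in> c t ` M n" for b x
          proof -
            obtain y where y: "y \<in> M n" "x = coord e f y"
              using x by (auto simp: c_def ef)
            have "gmult (embed e e b) y \<in> M n"
              using M(1)[of n] y(1) b ef(2) by (simp add: Q_def)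
            moreover have "convolution b x = c t (gmult (embed e e b) y)"
              by (simp add: c_def ef act[OF ef(2) b] y(2))
            ultimately show ?thesis by blast
          qed
        qed
        show "set_chain asc (\<lambda>n. c t ` M n)"
          by (rule set_chain_mono[OF M(2)]) (auto simp: mono_def)
      qed
    qed
    show "x = 0" if "\<And>t. t \<in> E \<times> E \<Longrightarrow> c t x = 0" for x
    proof (rule coord_eqI)
      show "coord e f x = coord e f 0" if "e \<in> E" "f \<in> E" for e f
        using \<open>\<And>t. t \<in> E \<times> E \<Longrightarrow> c t x = 0\<close>[of "(e, f)"] that by (simp add: c_def coord_0)
    qed
    show "Q (I n)" for n
      using I lidealD(2,3,6)[of gmult UNIV "I n"] by (simp add: Q_def)
    show "0 \<in> I n" for n
      using I lidealD(2) by blast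
  qed (rule chain)
qed

definition submodule :: "('s \<Rightarrow>\<^sub>0 'r::comm_ring_1) set \<Rightarrow> bool"
  where "submodule M \<longleftrightarrow> 0 \<in> M \<and> (\<forall>x\<in>M. \<forall>y\<in>M. x - y \<in> M) \<and> (\<forall>c. \<forall>x\<in>M. scale c x \<in> M)"

lemma lideal_submodule: "lideal gmult UNIV I \<Longrightarrow> submodule (I :: ('s \<Rightarrow>\<^sub>0 'r::comm_ring_1) set)"
  unfolding submodule_def using lidealD(2,3,6)[of gmult UNIV I] gmult_scale_unit by (metis UNIV_I)

lemma submodule_coef_ideal:
  assumes "submodule (M :: ('s \<Rightarrow>\<^sub>0 'r::comm_ring_1) set)"
  shows "lideal (*) UNIV ((\<lambda>x. coef x s) ` M)"
proof (rule lidealI)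
  show "0 \<in> (\<lambda>x. coef x s) ` M"
    using assms by (auto simp: submodule_def intro!: image_eqI[of _ _ 0])
  show "a - b \<in> (\<lambda>x. coef x s) ` M" if "a \<in> (\<lambda>x. coef x s) ` M" "b \<in> (\<lambda>x. coef x s) ` M" for a b
    using that assms by (auto simp: submodule_def lookup_minus[symmetric])
  show "r * a \<in> (\<lambda>x. coef x s) ` M" if "a \<in> (\<lambda>x. coef x s) ` M" for r a
    using that assms by (auto simp: submodule_def coef_scale[symmetric] simp del: coef_scale)
qed simp

text \<open>For finite \<open>S\<close> the coefficients themselves serve as coordinates, and the
  coordinate images are ideals of \<open>R\<close>.\<close>

lemma chain_condition_gmult_finite:
  assumes fin: "finite (UNIV :: 's set)"
    and R: "chain_condition asc ((*) :: 'r::comm_ring_1 \<Rightarrow> 'r \<Rightarrow> 'r) UNIV"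
  shows "chain_condition asc gmult (UNIV :: ('s \<Rightarrow>\<^sub>0 'r) set)"
  unfolding chain_condition_def
proof (intro allI impI, elim conjE)
  fix I :: "nat \<Rightarrow> ('s \<Rightarrow>\<^sub>0 'r) set"
  assume I: "\<forall>n. lideal gmult UNIV (I n)" and chain: "set_chain asc I"
  show "stabilizes I"
  proof (rule stabilizes_by_coordinates[where T = UNIV and c = "\<lambda>s x. coef x s" and Q = submodule and asc = asc])
    show "coef (x - y) t = coef x t - coef y t" for x y :: "'s \<Rightarrow>\<^sub>0 'r" and t
      by (rule lookup_minus)
    show "x - y \<in> M" if "submodule M" "x \<in> M" "y \<in> M" for M and x y :: "'s \<Rightarrow>\<^sub>0 'r"
      using that by (simp add: submodule_def)
    show "submodule {x \<in> M. \<forall>t\<in>U. coef x t = 0}" if "submodule M" for M :: "('s \<Rightarrow>\<^sub>0 'r) set" and U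
      using that by (simp add: submodule_def lookup_minus)
    show "stabilizes (\<lambda>n. (\<lambda>x. coef x t) ` M n)"
      if "\<And>n. submodule (M n)" "set_chain asc M" for t and M :: "nat \<Rightarrow> ('s \<Rightarrow>\<^sub>0 'r) set"
    proof (rule stabilizesI_lideals[OF R])
      show "lideal (*) UNIV ((\<lambda>x. coef x t) ` M n)" for n
        by (rule submodule_coef_ideal[OF that(1)])
      show "set_chain asc (\<lambda>n. (\<lambda>x. coef x t) ` M n)"
        by (rule set_chain_mono[OF that(2)]) (auto simp: mono_def)
    qed
    show "x = 0" if "\<And>t. t \<in> UNIV \<Longrightarrow> coef x t = 0" for x :: "'s \<Rightarrow>\<^sub>0 'r"
      using that by (simp add: poly_mapping_eqI)
    show "submodule (I n)" "0 \<in> I n" for n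
      using I lideal_submodule lidealD(2) by blast+
  qed (use fin chain in auto)
qed

text \<open>Over a ring with right units, submodules of a free module of finite rank are direct
  summands. One basis element is split off at a time, using an \<open>m0\<close> in \<open>M\<close>
  whose coefficient at \<open>a\<close> is a unit for the ideal of all coefficients at
  \<open>a\<close>.\<close>

lemma submodule_projection:
  assumes R: "right_units ((*) :: 'r::comm_ring_1 \<Rightarrow> 'r \<Rightarrow> 'r) UNIV" and "finite A"
    and "submodule (M :: ('s \<Rightarrow>\<^sub>0 'r) set)" "M \<subseteq> alg A"
  shows "\<exists>p. (\<forall>x y. p (x - y) = p x - p y) \<and> (\<forall>c x. p (scale c x) = scale c (p x)) \<and>
    (\<forall>x\<in>alg A. p x \<in> M) \<and> (\<forall>x\<in>M. p x = x)"
  using assms(2-4)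
proof (induction A arbitrary: M)
  case empty
  then have "M = {0}"
    by (auto simp: submodule_def alg_def)
  then show ?case
    by (intro exI[of _ "\<lambda>_. 0"]) simp
next
  case (insert a A)
  have M: "0 \<in> M" "\<And>x y. x \<in> M \<Longrightarrow> y \<in> M \<Longrightarrow> x - y \<in> M" "\<And>c x. x \<in> M \<Longrightarrow> scale c x \<in> M"
    using insert.prems(1) by (auto simp: submodule_def)
  obtain m0 where m0: "m0 \<in> M" "\<And>x. x \<in> M \<Longrightarrow> coef x a * coef m0 a = coef x a"
    using R submodule_coef_ideal[OF insert.prems(1), of a] unfolding right_units_def by blast
  define M' where "M' = {x \<in> M. coef x a = 0}"
  have "submodule M'"
    using M by (simp add: submodule_def M'_def lookup_minus)
  moreover have "M' \<subseteq> alg A"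
    using insert.prems(2) by (auto simp: M'_def alg_def in_keys_iff subset_iff)
  ultimately obtain p where p: "\<And>x y. p (x - y) = p x - p y" "\<And>c x. p (scale c x) = scale c (p x)"
    "\<And>x. x \<in> alg A \<Longrightarrow> p x \<in> M'" "\<And>x. x \<in> M' \<Longrightarrow> p x = x"
    using insert.IH by blast
  \<comment> \<open>The coefficient at \<open>a\<close> of an arbitrary \<open>x\<close> need not be
    in the ideal, so subtracting a multiple of \<open>m0\<close> may leave a remainder there, which
    is deleted. For \<open>x\<close> in \<open>M\<close> the remainder is already 0.\<close>
  define rest :: "('s \<Rightarrow>\<^sub>0 'r) \<Rightarrow> 's \<Rightarrow>\<^sub>0 'r"
    where "rest x = (x - scale (coef x a) m0) - Poly_Mapping.single a (coef (x - scale (coef x a) m0) a)" for x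
  define q where "q x = scale (coef x a) m0 + p (rest x)" for x
  have m0_alg: "m0 \<in> alg (insert a A)"
    using m0(1) insert.prems(2) by blast
  have rest_coef: "coef (rest x) s = (if s = a then 0 else coef x s - coef x a * coef m0 s)" for x s
    by (simp add: rest_def lookup_minus lookup_single when_def)
  have rest_alg: "rest x \<in> alg A" if "x \<in> alg (insert a A)" for x
  proof -
    have "coef (rest x) s = 0" if "s \<notin> A" for s
    proof (cases "s = a")
      case False
      then have "coef x s = 0" "coef m0 s = 0"
        using that \<open>x \<in> alg (insert a A)\<close> m0_alg by (auto simp: alg_def in_keys_iff subset_iff)
      then show ?thesis by (simp add: rest_coef)
    qed (simp add: rest_coef)
    then show ?thesis
      by (auto simp: alg_def in_keys_iff)
  qed
  have rest_diff: "rest (x - y) = rest x - rest y" for x y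
    by (rule poly_mapping_eqI) (simp add: rest_coef lookup_minus algebra_simps)
  have rest_scale: "rest (scale c x) = scale c (rest x)" for c x
    by (rule poly_mapping_eqI) (simp add: rest_coef algebra_simps)
  have "q (x - y) = q x - q y" for x y
    by (simp add: q_def rest_diff p(1) lookup_minus scale_diff_left)
  moreover have "q (scale c x) = scale c (q x)" for c x
    by (simp add: q_def rest_scale p(2))
  moreover have "q x \<in> M" if "x \<in> alg (insert a A)" for x
  proof -
    have "p (rest x) \<in> M"
      using p(3)[OF rest_alg[OF that]] by (simp add: M'_def)
    moreover have "- scale (coef x a) m0 \<in> M"
      using M(2)[OF M(1) M(3)[OF m0(1)]] by simp
    ultimately have "p (rest x) - (- scale (coef x a) m0) \<in> M"
      by (rule M(2))
    then show ?thesis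
      by (simp add: q_def add.commute)
  qed
  moreover have "q x = x" if "x \<in> M" for x
  proof -
    have "rest x = x - scale (coef x a) m0"
      by (rule poly_mapping_eqI) (use m0(2)[OF that] in \<open>simp add: rest_coef lookup_minus\<close>)
    moreover have "x - scale (coef x a) m0 \<in> M'"
      using M(2)[OF that M(3)[OF m0(1)]] m0(2)[OF that] by (simp add: M'_def lookup_minus)
    ultimately show ?thesis
      by (simp add: q_def p(4))
  qed
  ultimately show ?case by blast
qed

text \<open>Averaging over the arrows that start at the chosen representatives (rather than over all arrows)
  requires only the orders of the maximal subgroups to be invertible.\<close>

lemma right_units_gmult:
  assumes fin: "finite (UNIV :: 's set)"
    and R: "right_units ((*) :: 'r::comm_ring_1 \<Rightarrow> 'r \<Rightarrow> 'r) UNIV"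
    and inv: "\<And>e. e \<in> E \<Longrightarrow> \<exists>r :: 'r. r * of_nat (card (hclass e)) = 1"
  shows "right_units gmult (UNIV :: ('s \<Rightarrow>\<^sub>0 'r) set)"
  unfolding right_units_def
proof (intro allI impI)
  fix I :: "('s \<Rightarrow>\<^sub>0 'r) set" assume I: "lideal gmult UNIV I"
  have "I \<subseteq> alg UNIV"
    by simp
  then obtain p where "\<forall>x y. p (x - y) = p x - p y" "\<forall>c x. p (scale c x) = scale c (p x)"
    "\<forall>x\<in>alg UNIV. p x \<in> I" "\<forall>x\<in>I. p x = x"
    using submodule_projection[OF R fin lideal_submodule[OF I]] by blast
  then have p: "\<And>x y. p (x - y) = p x - p y" "\<And>c x. p (scale c x) = scale c (p x)"
    "\<And>x. p x \<in> I" "\<And>x. x \<in> I \<Longrightarrow> p x = x"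
    by simp_all
  obtain w :: "'s \<Rightarrow> 'r" where w: "\<And>e. e \<in> E \<Longrightarrow> w e * of_nat (card (hclass e)) = 1"
    using inv by metis
  define A where "A = {g :: 's. dm g = rep (dm g)}"
  \<comment> \<open>\<open>p\<close> is only \<open>R\<close>-linear; averaging over translates by
    arrows makes it linear over the groupoid algebra. The weight depends on the source of
    \<open>g\<close> alone, so left translation does not change it.\<close>
  define avg where "avg x = (\<Sum>g\<in>A. scale (w (dm g)) (gmult (basis g) (p (gmult (basis (sinv g)) x))))"
    for x :: "'s \<Rightarrow>\<^sub>0 'r"
  have finA: "finite A"
    by (rule finite_subset[OF subset_UNIV fin])
  have p_0: "p 0 = 0"
    using p(1)[of 0 0] by simp
  have p_add: "p (x + y) = p x + p y" for x y
    using p(1)[of x "- y"] p(1)[of 0 y] p_0 by simp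
  have avg_I: "avg x \<in> I" for x
    unfolding avg_def
    by (intro lideal_sum[OF I]) (use lideal_submodule[OF I] lidealD(6)[OF I] p(3) in \<open>simp add: submodule_def\<close>)
  have avg_id: "avg x = x" if x: "x \<in> I" for x
  proof -
    have "avg x = (\<Sum>g\<in>A. scale (w (dm g)) (gmult (basis (rg g)) x))"
      unfolding avg_def
    proof (intro sum.cong refl)
      fix g
      have "p (gmult (basis (sinv g)) x) = gmult (basis (sinv g)) x"
        by (rule p(4)) (use lidealD(6)[OF I] x in simp)
      then show "scale (w (dm g)) (gmult (basis g) (p (gmult (basis (sinv g)) x))) = scale (w (dm g)) (gmult (basis (rg g)) x)"
        by (simp add: gmult_assoc[symmetric] gmult_basis)
    qed
    \<comment> \<open>Grouped by target: at \<open>e\<close> the arrows from \<open>rep e\<close>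
      are as many as the elements of \<open>hclass (rep e)\<close> and contribute equal terms, so
      their weights add up to 1.\<close>
    also have "\<dots> = (\<Sum>e\<in>E. \<Sum>g\<in>{g \<in> A. rg g = e}. scale (w (dm g)) (gmult (basis (rg g)) x))"
      by (rule sum.group[symmetric]) (use finA finite_E in \<open>auto simp: E_def\<close>)
    also have "\<dots> = (\<Sum>e\<in>E. gmult (basis e) x)"
    proof (intro sum.cong refl)
      fix e assume e: "e \<in> E"
      then have eI: "e \<in> idempotents" "rep e \<in> idempotents" "rep (rep e) = rep e"
        using link(3) rep_rep by (auto simp: E_def)
      have "(dm g = rep (dm g) \<and> rg g = e) \<longleftrightarrow> (rg g = e \<and> dm g = rep e)" for g :: 's
        using rep_rg_dm[of g] by metis
      then have Ae: "{g \<in> A. rg g = e} = {g. rg g = e \<and> dm g = rep e}"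
        by (simp only: A_def mem_Collect_eq)
      have link_rep: "bij_betw (\<lambda>h. link e * h) (hclass (rep e)) {g. rg g = e \<and> dm g = rep e}"
      proof (rule bij_betwI[where g = "\<lambda>g. sinv (link e) * g"])
        show "(\<lambda>h. link e * h) \<in> hclass (rep e) \<rightarrow> {g. rg g = e \<and> dm g = rep e}"
        proof
          fix h assume h: "h \<in> hclass (rep e)"
          then have hr: "rg h = rep e" "dm h = rep e"
            by (auto simp: hclass_def)
          have "dm (link e) = rg h"
            by (simp only: link(2)[OF eI(1)] hr)
          from composable[OF this] show "link e * h \<in> {g. rg g = e \<and> dm g = rep e}"
            by (simp only: hr link(1)[OF eI(1)] mem_Collect_eq simp_thms)
        qed
        show "(\<lambda>g. sinv (link e) * g) \<in> {g. rg g = e \<and> dm g = rep e} \<rightarrow> hclass (rep e)"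
        proof
          fix g assume "g \<in> {g. rg g = e \<and> dm g = rep e}"
          then have gr: "rg g = e" "dm g = rep e" by auto
          have "dm (sinv (link e)) = rg g"
            by (simp only: dm_rg_sinv link(1)[OF eI(1)] gr)
          from composable[OF this] show "sinv (link e) * g \<in> hclass (rep e)"
            by (simp only: hclass_def gr dm_rg_sinv link(2)[OF eI(1)] mem_Collect_eq simp_thms)
        qed
        show "sinv (link e) * (link e * h) = h" if "h \<in> hclass (rep e)" for h
        proof -
          have "rg h = dm (link e)"
            using that link(2)[OF eI(1)] by (simp add: hclass_def)
          then have "dm (link e) * h = rg h * h"
            by (simp only:)
          then show ?thesis
            by (simp add: mult.assoc)
        qed
        show "link e * (sinv (link e) * g) = g" if "g \<in> {g. rg g = e \<and> dm g = rep e}" for g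
        proof -
          have "rg g = rg (link e)"
            using that link(1)[OF eI(1)] by simp
          then have "rg (link e) * g = rg g * g"
            by (simp only:)
          then show ?thesis
            by (simp add: mult.assoc)
        qed
      qed
      have "(\<Sum>g\<in>{g \<in> A. rg g = e}. scale (w (dm g)) (gmult (basis (rg g)) x)) =
          (\<Sum>g\<in>{g. rg g = e \<and> dm g = rep e}. scale (w (rep e)) (gmult (basis e) x))"
        unfolding Ae by (intro sum.cong refl) simp
      also have "\<dots> = scale (w (rep e) * of_nat (card (hclass (rep e)))) (gmult (basis e) x)"
        by (rule poly_mapping_eqI)
           (simp add: lookup_sum bij_betw_same_card[OF link_rep] mult.assoc mult.left_commute)
      also have "\<dots> = gmult (basis e) x"
        using w[of "rep e"] eI(2) by (simp add: E_def)
      finally show "(\<Sum>g\<in>{g \<in> A. rg g = e}. scale (w (dm g)) (gmult (basis (rg g)) x)) = gmult (basis e) x" .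
    qed
    also have "\<dots> = gmult gunit x"
      by (simp add: gunit_def gmult_sum)
    finally show ?thesis
      by (simp add: gunit)
  qed
  have avg_basis: "avg (gmult (basis h) x) = gmult (basis h) (avg x)" for h x
  proof -
    have "avg (gmult (basis h) x) = (\<Sum>g\<in>A. if rg g = rg h
        then scale (w (dm g)) (gmult (basis g) (p (gmult (basis (sinv g * h)) x))) else 0)"
      unfolding avg_def by (intro sum.cong refl) (simp add: gmult_assoc[symmetric] gmult_basis gmult_simps p_0)
    also have "\<dots> = (\<Sum>g\<in>{g \<in> A. rg g = rg h}. scale (w (dm g)) (gmult (basis g) (p (gmult (basis (sinv g * h)) x))))"
      by (rule sum.inter_filter[OF finA, symmetric])
    \<comment> \<open>Left translation by \<open>h\<close> matches arrows into \<open>dm h\<close>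
      with arrows into \<open>rg h\<close> and preserves their sources.\<close>
    also have "\<dots> = (\<Sum>g\<in>{g \<in> A. rg g = dm h}. scale (w (dm g)) (gmult (basis (h * g)) (p (gmult (basis (sinv g)) x))))"
    proof (rule sum.reindex_bij_witness[where i = "\<lambda>g. h * g" and j = "\<lambda>g. sinv h * g"])
      fix g assume "g \<in> {g \<in> A. rg g = rg h}"
      then have g: "rg g = rg h" "dm g = rep (dm g)"
        by (auto simp: A_def)
      have hg: "dm (sinv h) = rg g"
        by (simp only: g(1) dm_rg_sinv)
      have "rg h * g = rg g * g"
        by (simp only: g(1))
      then show *: "h * (sinv h * g) = g"
        by (simp add: mult.assoc)
      show "sinv h * g \<in> {g \<in> A. rg g = dm h}"
        unfolding A_def mem_Collect_eq composable[OF hg] dm_rg_sinv using g(2) by blast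
      have "sinv (sinv h * g) = sinv g * h"
        by (simp add: sinv_mult)
      then show "scale (w (dm (sinv h * g))) (gmult (basis (h * (sinv h * g))) (p (gmult (basis (sinv (sinv h * g))) x))) =
          scale (w (dm g)) (gmult (basis g) (p (gmult (basis (sinv g * h)) x)))"
        unfolding * composable[OF hg] by (simp only:)
    next
      fix g assume "g \<in> {g \<in> A. rg g = dm h}"
      then have g: "rg g = dm h" "dm g = rep (dm g)"
        by (auto simp: A_def)
      have hg: "dm h = rg g"
        by (simp only: g(1))
      have "dm h * g = rg g * g"
        by (simp only: g(1))
      then show "sinv h * (h * g) = g"
        by (simp add: mult.assoc)
      show "h * g \<in> {g \<in> A. rg g = rg h}"
        unfolding A_def mem_Collect_eq composable[OF hg] using g(2) by blast
    qed
    also have "\<dots> = (\<Sum>g\<in>A. if rg g = dm h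
        then scale (w (dm g)) (gmult (basis (h * g)) (p (gmult (basis (sinv g)) x))) else 0)"
      by (rule sum.inter_filter[OF finA])
    also have "\<dots> = gmult (basis h) (avg x)"
      unfolding avg_def gmult_sum
    proof (intro sum.cong refl)
      fix g
      show "(if rg g = dm h then scale (w (dm g)) (gmult (basis (h * g)) (p (gmult (basis (sinv g)) x))) else 0) =
          gmult (basis h) (scale (w (dm g)) (gmult (basis g) (p (gmult (basis (sinv g)) x))))"
        by (cases "dm h = rg g") (simp_all add: gmult_simps gmult_assoc[symmetric] gmult_basis)
    qed
    finally show ?thesis .
  qed
  have avg_add: "avg (x + y) = avg x + avg y" and avg_scale: "avg (scale c x) = scale c (avg x)" for x y c
    by (simp_all add: avg_def gmult_simps p_add p(2) sum.distrib scale_sum mult.commute)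
  have avg_0: "avg 0 = 0"
    by (simp add: avg_def gmult_simps p_0)
  have avg_lin: "avg (lin \<phi> a) = lin (\<lambda>s. avg (\<phi> s)) a" for \<phi> and a :: "'s \<Rightarrow>\<^sub>0 'r"
  proof -
    have "avg (sum f B) = (\<Sum>i\<in>B. avg (f i))" for f and B :: "'s set"
      by (induction B rule: infinite_finite_induct) (simp_all add: avg_0 avg_add)
    then show ?thesis
      by (simp add: lin_def avg_scale)
  qed
  have avg_gmult: "avg (gmult a x) = gmult a (avg x)" for a x
  proof -
    have "avg (gmult (lin basis a) x) = gmult (lin basis a) (avg x)"
      unfolding gmult_def bilin_lin_left avg_lin unfolding gmult_def[symmetric] avg_basis ..
    then show ?thesis by simp
  qed
  \<comment> \<open>By left linearity \<open>x\<close> times the average of the identity is the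
    average of \<open>x\<close>, which is \<open>x\<close> itself on \<open>I\<close>.\<close>
  have "gmult x (avg gunit) = x" if "x \<in> I" for x
    using avg_gmult[of x gunit] avg_id[OF that] by (simp add: gunit)
  then show "\<exists>u\<in>I. \<forall>x\<in>I. gmult x u = x"
    using avg_I by blast
qed

end

section \<open>Semisimplicity\<close>

lemma abelian_monoid_semigroup_algebra: "abelian_monoid (semigroup_algebra R G)"
  by (rule abelian_monoidI)
     (auto simp: semigroup_algebra_def ac_simps intro: supp_add_subset[THEN subsetD])

lemma finsum_semigroup_algebra:
  assumes "\<And>i. i \<in> I \<Longrightarrow> supp (f i) \<subseteq> G"
  shows "finsum (semigroup_algebra R G) f I = sum f I"
proof -
  interpret abelian_monoid "semigroup_algebra R G"
    by (rule abelian_monoid_semigroup_algebra)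
  show ?thesis
    using assms
  proof (induction I rule: infinite_finite_induct)
    case (insert i I)
    then have "f \<in> I \<rightarrow> carrier (semigroup_algebra R G)" "f i \<in> carrier (semigroup_algebra R G)"
      by (auto simp: semigroup_algebra_def)
    then show ?case
      using insert by (simp add: finsum_insert) (simp add: semigroup_algebra_def)
  qed (simp_all add: finsum_infinite, simp_all add: semigroup_algebra_def)
qed

definition simple_lideal :: "('m::ab_group_add \<Rightarrow> 'm \<Rightarrow> 'm) \<Rightarrow> 'm set \<Rightarrow> bool"
  where "simple_lideal m L \<longleftrightarrow> lideal m UNIV L \<and> L \<noteq> {0} \<and>
    (\<forall>J. lideal m UNIV J \<and> J \<subseteq> L \<longrightarrow> J = {0} \<or> J = L)"

lemma simple_left_ideal_iff:
  fixes L :: "('s::semigroup_mult \<Rightarrow>\<^sub>0 'r::comm_ring_1) set"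
  shows "simple_left_ideal (semigroup_algebra R (UNIV :: 's set)) L \<longleftrightarrow> simple_lideal convolution L"
proof -
  have "\<zero>\<^bsub>semigroup_algebra R (UNIV :: 's set)\<^esub> = (0 :: 's \<Rightarrow>\<^sub>0 'r)"
    by (simp add: semigroup_algebra_def)
  then show ?thesis
    by (simp add: simple_left_ideal_def simple_lideal_def left_ideal_semigroup_algebra)
qed

lemma lideal_plus:
  assumes bi: "\<And>a x y. m a (x + y) = m a x + m a y"
    and I: "lideal m UNIV I" and J: "lideal m UNIV J"
  shows "lideal m UNIV {x + y | x y. x \<in> I \<and> y \<in> J}"
proof (rule lidealI)
  show "0 \<in> {x + y | x y. x \<in> I \<and> y \<in> J}"
    using lidealD(2)[OF I] lidealD(2)[OF J] by (auto intro!: exI[of _ 0])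
  show "u - v \<in> {x + y | x y. x \<in> I \<and> y \<in> J}"
    if uv: "u \<in> {x + y | x y. x \<in> I \<and> y \<in> J}" "v \<in> {x + y | x y. x \<in> I \<and> y \<in> J}" for u v
  proof -
    obtain x y x' y' where "u = x + y" "v = x' + y'" "x \<in> I" "x' \<in> I" "y \<in> J" "y' \<in> J"
      using uv by blast
    then have "u - v = (x - x') + (y - y')" "x - x' \<in> I" "y - y' \<in> J"
      using lidealD(3)[OF I] lidealD(3)[OF J] by auto
    then show ?thesis by blast
  qed
  show "m a u \<in> {x + y | x y. x \<in> I \<and> y \<in> J}" if u: "u \<in> {x + y | x y. x \<in> I \<and> y \<in> J}" for a u
  proof -
    obtain x y where "u = x + y" "x \<in> I" "y \<in> J"
      using u by blast
    then have "m a u = m a x + m a y" "m a x \<in> I" "m a y \<in> J"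
      using lidealD(6)[OF I] lidealD(6)[OF J] bi by auto
    then show ?thesis by blast
  qed
qed simp

lemma maximal_disjoint_lideal:
  fixes m :: "'m::ab_group_add \<Rightarrow> 'm \<Rightarrow> 'm"
  assumes m0: "\<And>a. m a 0 = 0"
    and I: "lideal m UNIV I"
  obtains C where "lideal m UNIV C" "C \<inter> I = {0}"
    "\<And>D. lideal m UNIV D \<Longrightarrow> D \<inter> I = {0} \<Longrightarrow> C \<subseteq> D \<Longrightarrow> D = C"
proof -
  let ?A = "{C. lideal m UNIV C \<and> C \<inter> I = {0}}"
  have "\<exists>M\<in>?A. \<forall>Y\<in>?A. M \<subseteq> Y \<longrightarrow> Y = M"
  proof (rule subset_Zorn_nonempty)
    have "lideal m UNIV {0}"
      by (simp add: lideal_def m0)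
    then show "?A \<noteq> {}"
      using lidealD(2)[OF I] by blast
    fix \<C> assume ne: "\<C> \<noteq> {}" and chain: "subset.chain ?A \<C>"
    have in_A: "lideal m UNIV C" "C \<inter> I = {0}" if "C \<in> \<C>" for C
      using chain that by (auto simp: subset.chain_def)
    have "lideal m UNIV (\<Union>\<C>)"
    proof (rule lidealI)
      show "0 \<in> \<Union>\<C>"
        using ne in_A(1) lidealD(2) by blast
      show "x - y \<in> \<Union>\<C>" if xy: "x \<in> \<Union>\<C>" "y \<in> \<Union>\<C>" for x y
      proof -
        obtain C D where CD: "C \<in> \<C>" "x \<in> C" "D \<in> \<C>" "y \<in> D"
          using xy by blast
        have "C \<subseteq> D \<or> D \<subseteq> C"
          using chain CD(1,3) unfolding subset.chain_def by auto
        then show ?thesis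
        proof
          assume "C \<subseteq> D"
          then have "x - y \<in> D"
            using lidealD(3)[OF in_A(1)[OF CD(3)]] CD by blast
          then show ?thesis using CD(3) by blast
        next
          assume "D \<subseteq> C"
          then have "x - y \<in> C"
            using lidealD(3)[OF in_A(1)[OF CD(1)]] CD by blast
          then show ?thesis using CD(1) by blast
        qed
      qed
      show "m a x \<in> \<Union>\<C>" if x: "x \<in> \<Union>\<C>" for a x
      proof -
        obtain C where C: "C \<in> \<C>" "x \<in> C"
          using x by blast
        then have "m a x \<in> C"
          using lidealD(6)[OF in_A(1)[OF C(1)]] by blast
        then show ?thesis using C(1) by blast
      qed
    qed simp
    moreover have "\<Union>\<C> \<inter> I = {0}"
      using ne in_A(2) by blast
    ultimately show "\<Union>\<C> \<in> ?A" by blast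
  qed
  then obtain C where C: "C \<in> ?A" and max: "\<forall>Y\<in>?A. C \<subseteq> Y \<longrightarrow> Y = C" ..
  show thesis
  proof (rule that[of C])
    show "D = C" if "lideal m UNIV D" "D \<inter> I = {0}" "C \<subseteq> D" for D
      using max that by simp
  qed (use C in auto)
qed

text \<open>A complement of a left ideal is found by Zorn's lemma; the component of the identity in the
  left ideal is then a right unit.\<close>

lemma simple_sum_right_units:
  fixes m :: "'m::ab_group_add \<Rightarrow> 'm \<Rightarrow> 'm"
  assumes bi: "\<And>a x y. m a (x + y) = m a x + m a y"
    and u: "\<And>x. m x u = x"
    and simple: "\<And>L. L \<in> \<L> \<Longrightarrow> simple_lideal m L"
    and sums: "\<And>x. \<exists>F f. finite F \<and> F \<subseteq> \<L> \<and> (\<forall>L\<in>F. f L \<in> L) \<and> x = sum f F"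
  shows "right_units m UNIV"
  unfolding right_units_def
proof (intro allI impI)
  fix I assume I: "lideal m UNIV I"
  have m0: "m a 0 = 0" for a
    using bi[of a 0 0] by simp
  obtain C where C: "lideal m UNIV C" "C \<inter> I = {0}"
    and max: "\<And>D. lideal m UNIV D \<Longrightarrow> D \<inter> I = {0} \<Longrightarrow> C \<subseteq> D \<Longrightarrow> D = C"
    using maximal_disjoint_lideal[of m, OF m0 I] by blast
  let ?D = "{c + i | c i. c \<in> C \<and> i \<in> I}"
  have D: "lideal m UNIV ?D"
    by (rule lideal_plus[OF bi C(1) I])
  have CD: "C \<subseteq> ?D"
    using lidealD(2)[OF I] by force
  \<comment> \<open>Every simple left ideal lies in \<open>C + I\<close>: otherwise it meets
    \<open>C + I\<close> trivially, so \<open>C + L\<close> still meets \<open>I\<close> trivially,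
    and maximality of \<open>C\<close> puts \<open>L\<close> into \<open>C\<close>.\<close>
  have LD: "L \<subseteq> ?D" if "L \<in> \<L>" for L
  proof (rule ccontr)
    assume not_sub: "\<not> L \<subseteq> ?D"
    have L: "lideal m UNIV L" "\<And>J. lideal m UNIV J \<Longrightarrow> J \<subseteq> L \<Longrightarrow> J = {0} \<or> J = L"
      using simple[OF that] by (auto simp: simple_lideal_def)
    have "L \<inter> ?D = {0} \<or> L \<inter> ?D = L"
      by (rule L(2)[OF lideal_Int[OF L(1) D]]) blast
    then have LD0: "L \<inter> ?D = {0}"
      using not_sub by blast
    let ?CL = "{c + l | c l. c \<in> C \<and> l \<in> L}"
    have "?CL = C"
    proof (rule max)
      show "lideal m UNIV ?CL"
        by (rule lideal_plus[OF bi C(1) L(1)])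
      show "C \<subseteq> ?CL"
        using lidealD(2)[OF L(1)] by force
      have "x = 0" if x: "x \<in> ?CL \<inter> I" for x
      proof -
        obtain c l where cl: "x = c + l" "c \<in> C" "l \<in> L"
          using x by blast
        then have "l = - c + x"
          by simp
        then have "l \<in> ?D"
          using lidealD(5)[OF C(1) cl(2)] x by blast
        then have "l = 0"
          using cl(3) LD0 by blast
        then show ?thesis
          using cl C(2) x by auto
      qed
      moreover have "0 \<in> ?CL \<inter> I"
        using lidealD(2)[OF I] lidealD(2)[OF C(1)] lidealD(2)[OF L(1)] by force
      ultimately show "?CL \<inter> I = {0}" by blast
    qed
    moreover have "L \<subseteq> ?CL"
      using lidealD(2)[OF C(1)] by force
    ultimately have "L \<subseteq> C"
      by (simp only:)
    then show False
      using not_sub order_trans[OF _ CD] by blast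
  qed
  obtain F f where Ff: "F \<subseteq> \<L>" "\<forall>L\<in>F. f L \<in> L" "u = sum f F"
    using sums[of u] by blast
  have "u \<in> ?D"
    unfolding Ff(3) by (rule lideal_sum[OF D]) (use Ff LD in blast)
  then obtain c i where ci: "u = c + i" "c \<in> C" "i \<in> I" by blast
  have "m x i = x" if x: "x \<in> I" for x
  proof -
    have sum: "m x c + m x i = x"
      using u[of x] by (simp add: ci(1) bi)
    have "m x i \<in> I" "m x c \<in> C"
      using lidealD(6)[OF I] lidealD(6)[OF C(1)] ci by simp_all
    moreover have "m x c = x - m x i"
      using sum by (simp add: algebra_simps)
    ultimately have "m x c \<in> C \<inter> I"
      using lidealD(3)[OF I x] by simp
    then show ?thesis
      using sum C(2) by simp
  qed
  then show "\<exists>u\<in>I. \<forall>x\<in>I. m x u = x"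
    using ci(3) by blast
qed

lemma semisimple_right_units:
  fixes R :: "'r::comm_ring_1 itself"
  assumes "semisimple_ring (semigroup_algebra R (UNIV :: 's::semigroup_mult set))"
  shows "right_units convolution (UNIV :: ('s \<Rightarrow>\<^sub>0 'r) set)"
proof -
  let ?A = "semigroup_algebra R (UNIV :: 's set)"
  have A: "carrier ?A = UNIV" "monoid.mult ?A = convolution" "\<zero>\<^bsub>?A\<^esub> = 0"
    by (simp_all add: semigroup_algebra_def)
  obtain u :: "'s \<Rightarrow>\<^sub>0 'r" where u: "\<And>x. convolution x u = x"
    using assms by (auto simp: semisimple_ring_def unital_def A)
  obtain \<L> where simple: "\<And>L. L \<in> \<L> \<Longrightarrow> simple_lideal (convolution :: ('s \<Rightarrow>\<^sub>0 'r) \<Rightarrow> _) L"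
    and sum: "is_direct_sum ?A \<L>"
    using assms by (auto simp: semisimple_ring_def simple_left_ideal_iff)
  show ?thesis
  proof (rule simple_sum_right_units[OF convolution_simps(2) u simple])
    fix x :: "'s \<Rightarrow>\<^sub>0 'r"
    obtain f where f: "f \<in> (\<Pi>\<^sub>E L\<in>\<L>. L)" "finite {L \<in> \<L>. f L \<noteq> 0}"
      "x = finsum ?A f {L \<in> \<L>. f L \<noteq> 0}"
      using sum unfolding is_direct_sum_def A by blast
    then have "x = sum f {L \<in> \<L>. f L \<noteq> 0}"
      by (simp add: finsum_semigroup_algebra)
    then show "\<exists>F f. finite F \<and> F \<subseteq> \<L> \<and> (\<forall>L\<in>F. f L \<in> L) \<and> x = sum f F"
      using f(1,2) by (intro exI[of _ "{L \<in> \<L>. f L \<noteq> 0}"] exI[of _ f]) auto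
  qed
qed

definition decomposable :: "('m::ab_group_add \<Rightarrow> 'm \<Rightarrow> 'm) \<Rightarrow> 'm set \<Rightarrow> bool"
  where "decomposable m I \<longleftrightarrow> (\<exists>\<L>. finite \<L> \<and> (\<forall>L\<in>\<L>. simple_lideal m L \<and> L \<subseteq> I) \<and>
    (\<forall>x\<in>I. \<exists>!f. f \<in> (\<Pi>\<^sub>E L\<in>\<L>. L) \<and> x = sum f \<L>))"

text \<open>Take a minimal counterexample \<open>B\<close> and a minimal nonzero left ideal
  \<open>L\<close> inside it. The right unit \<open>u\<close> of \<open>L\<close> splits
  \<open>B\<close> into \<open>L\<close> and the kernel of right multiplication by \<open>u\<close>,
  which is strictly smaller and hence decomposable.\<close>

lemma decomposable_all:
  fixes m :: "'m::ab_group_add \<Rightarrow> 'm \<Rightarrow> 'm"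
  assumes bi: "\<And>a x y. m a (x - y) = m a x - m a y" "\<And>a x y. m (x - y) a = m x a - m y a"
    and assoc: "\<And>x y z. m (m x y) z = m x (m y z)"
    and dcc: "chain_condition False m UNIV" and ru: "right_units m UNIV"
    and I: "lideal m UNIV I"
  shows "decomposable m I"
proof (rule ccontr)
  assume "\<not> decomposable m I"
  let ?\<B> = "{I. lideal m UNIV I \<and> \<not> decomposable m I}"
  have "I \<in> ?\<B>"
    using I \<open>\<not> decomposable m I\<close> by blast
  then have "\<exists>I\<in>?\<B>. \<forall>J\<in>?\<B>. J \<subseteq> I \<longrightarrow> J = I"
    by (rule descending_minimal[OF dcc]) simp
  then obtain B where "B \<in> ?\<B>" and minB: "\<forall>J\<in>?\<B>. J \<subseteq> B \<longrightarrow> J = B" ..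
  then have B: "lideal m UNIV B" "\<not> decomposable m B" by auto
  have m0: "m a 0 = 0" "m 0 a = 0" for a
    using bi(1)[of a 0 0] bi(2)[of 0 0 a] by simp_all
  have "decomposable m {0}"
    unfolding decomposable_def by (intro exI[of _ "{}"]) auto
  then have "B \<noteq> {0}"
    using B(2) by auto
  let ?\<N> = "{J. lideal m UNIV J \<and> J \<noteq> {0} \<and> J \<subseteq> B}"
  have "B \<in> ?\<N>"
    using B(1) \<open>B \<noteq> {0}\<close> by blast
  then have "\<exists>I\<in>?\<N>. \<forall>J\<in>?\<N>. J \<subseteq> I \<longrightarrow> J = I"
    by (rule descending_minimal[OF dcc]) simp
  then obtain L where "L \<in> ?\<N>" and minL: "\<forall>J\<in>?\<N>. J \<subseteq> L \<longrightarrow> J = L" ..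
  then have L: "lideal m UNIV L" "L \<noteq> {0}" "L \<subseteq> B" by auto
  have simpleL: "simple_lideal m L"
    unfolding simple_lideal_def using L minL by auto
  obtain u where u: "u \<in> L" "\<And>x. x \<in> L \<Longrightarrow> m x u = x"
    using ru L(1) unfolding right_units_def by blast
  define C where "C = {x \<in> B. m x u = 0}"
  have C: "lideal m UNIV C"
    by (rule lidealI) (use lidealD[OF B(1)] in \<open>auto simp: C_def bi m0 assoc\<close>)
  have LC: "L \<inter> C = {0}"
    using u(2) lidealD(2)[OF L(1)] lidealD(2)[OF C] by (auto simp: C_def)
  then have "C \<noteq> B"
    using L lidealD(2)[OF L(1)] by blast
  then have "decomposable m C"
    using minB C by (auto simp: C_def)
  then obtain \<L> where fin: "finite \<L>" and "\<forall>K\<in>\<L>. simple_lideal m K \<and> K \<subseteq> C"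
    and "\<forall>x\<in>C. \<exists>!f. f \<in> (\<Pi>\<^sub>E K\<in>\<L>. K) \<and> x = sum f \<L>"
    unfolding decomposable_def by (elim exE conjE) (rule that)
  then have simple: "\<And>K. K \<in> \<L> \<Longrightarrow> simple_lideal m K" "\<And>K. K \<in> \<L> \<Longrightarrow> K \<subseteq> C"
    and dec: "\<And>x. x \<in> C \<Longrightarrow> \<exists>!f. f \<in> (\<Pi>\<^sub>E K\<in>\<L>. K) \<and> x = sum f \<L>"
    by simp_all
  have "L \<notin> \<L>"
    using simple(2) LC L(2) by blast
  have sum_C: "sum f \<L> \<in> C" if "\<And>K. K \<in> \<L> \<Longrightarrow> f K \<in> K" for f
    by (rule lideal_sum[OF C]) (use that simple(2) in blast)
  have mu_L: "m x u \<in> L" for x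
    using lidealD(6)[OF L(1) _ u(1)] by simp
  have "decomposable m B"
    unfolding decomposable_def
  proof (intro exI[of _ "insert L \<L>"] conjI ballI)
    show "finite (insert L \<L>)" using fin by simp
    show "simple_lideal m K" "K \<subseteq> B" if "K \<in> insert L \<L>" for K
      using that simpleL simple L(3) by (auto simp: C_def)
    fix x assume x: "x \<in> B"
    have "m x u \<in> B"
      using mu_L L(3) by blast
    then have xC: "x - m x u \<in> C"
      using lidealD(3)[OF B(1) x] u by (simp add: C_def bi assoc)
    define f where "f = (THE f. f \<in> (\<Pi>\<^sub>E K\<in>\<L>. K) \<and> x - m x u = sum f \<L>)"
    have f: "f \<in> (\<Pi>\<^sub>E K\<in>\<L>. K)" "x - m x u = sum f \<L>"
      using theI'[OF dec[OF xC]] by (simp_all add: f_def)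
    have f_unique: "g = f" if "g \<in> (\<Pi>\<^sub>E K\<in>\<L>. K)" "x - m x u = sum g \<L>" for g
      unfolding f_def by (rule the1_equality[OF dec[OF xC], symmetric]) (use that in blast)
    let ?f = "f(L := m x u)"
    have sum_upd: "sum ?f \<L> = sum f \<L>"
      by (rule sum.cong) (use \<open>L \<notin> \<L>\<close> in auto)
    show "\<exists>!f. f \<in> (\<Pi>\<^sub>E L\<in>insert L \<L>. L) \<and> x = sum f (insert L \<L>)"
    proof (rule ex1I)
      have "?f \<in> (\<Pi>\<^sub>E L\<in>insert L \<L>. L)"
        using f(1) mu_L by (auto simp: PiE_iff extensional_def)
      moreover have "sum ?f (insert L \<L>) = m x u + sum f \<L>"
        using fin \<open>L \<notin> \<L>\<close> sum_upd by simp
      ultimately show "?f \<in> (\<Pi>\<^sub>E L\<in>insert L \<L>. L) \<and> x = sum ?f (insert L \<L>)"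
        using f(2)[symmetric] by simp
      fix g assume g: "g \<in> (\<Pi>\<^sub>E L\<in>insert L \<L>. L) \<and> x = sum g (insert L \<L>)"
      then have gL: "g L \<in> L" and gK: "\<And>K. K \<in> \<L> \<Longrightarrow> g K \<in> K" and g_sum: "x = g L + sum g \<L>"
        using fin \<open>L \<notin> \<L>\<close> by auto
      have diff: "x - g L = sum g \<L>"
        using g_sum by (metis add_diff_cancel_left')
      then have "m (x - g L) u = 0"
        using sum_C[of g] gK by (simp add: C_def)
      then have gLu: "g L = m x u"
        using u(2)[OF gL] by (simp add: bi)
      let ?g = "restrict g \<L>"
      have "?g = f"
      proof (rule f_unique)
        show "?g \<in> (\<Pi>\<^sub>E K\<in>\<L>. K)"
          using gK by auto
        have "sum ?g \<L> = sum g \<L>"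
          by (rule sum.cong) auto
        then show "x - m x u = sum ?g \<L>"
          by (simp only: diff gLu[symmetric])
      qed
      show "g = ?f"
      proof
        fix K
        show "g K = ?f K"
        proof (cases "K \<in> insert L \<L>")
          case True
          then show ?thesis
            using gLu \<open>?g = f\<close> \<open>L \<notin> \<L>\<close> by (auto simp flip: \<open>?g = f\<close>)
        next
          case False
          then have "g K = undefined" "f K = undefined"
            using g f(1) by (auto simp: PiE_iff extensional_def)
          then show ?thesis
            using False by simp
        qed
      qed
    qed
  qed
  then show False
    using B(2) by contradiction
qed

lemma semisimpleI:
  fixes R :: "'r::comm_ring_1 itself" and u :: "'s::semigroup_mult \<Rightarrow>\<^sub>0 'r"
  assumes u: "\<And>x. convolution u x = x" "\<And>x. convolution x u = x"
    and dcc: "chain_condition False convolution (UNIV :: ('s \<Rightarrow>\<^sub>0 'r) set)"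
    and ru: "right_units convolution (UNIV :: ('s \<Rightarrow>\<^sub>0 'r) set)"
  shows "semisimple_ring (semigroup_algebra R (UNIV :: 's set))"
proof -
  let ?A = "semigroup_algebra R (UNIV :: 's set)"
  have A: "carrier ?A = UNIV" "monoid.mult ?A = convolution" "\<zero>\<^bsub>?A\<^esub> = 0"
    by (simp_all add: semigroup_algebra_def)
  have "decomposable convolution (UNIV :: ('s \<Rightarrow>\<^sub>0 'r) set)"
    by (rule decomposable_all[OF convolution_simps(4,3) convolution_assoc dcc ru]) (simp add: lideal_def)
  then obtain \<L> :: "('s \<Rightarrow>\<^sub>0 'r) set set" where fin: "finite \<L>"
    and "\<forall>L\<in>\<L>. simple_lideal convolution L \<and> L \<subseteq> UNIV"
    and "\<forall>x\<in>UNIV. \<exists>!f. f \<in> (\<Pi>\<^sub>E L\<in>\<L>. L) \<and> x = sum f \<L>"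
    unfolding decomposable_def by (elim exE conjE) (rule that)
  then have simple: "\<And>L. L \<in> \<L> \<Longrightarrow> simple_lideal convolution L"
    and dec: "\<And>x. \<exists>!f. f \<in> (\<Pi>\<^sub>E L\<in>\<L>. L) \<and> x = sum f \<L>"
    by simp_all
  \<comment> \<open>The target definition sums over the members with nonzero component only; for a
    finite family the missing terms are zero.\<close>
  have "finsum ?A f {L \<in> \<L>. f L \<noteq> 0} = sum f \<L>" for f :: "('s \<Rightarrow>\<^sub>0 'r) set \<Rightarrow> 's \<Rightarrow>\<^sub>0 'r"
  proof -
    have "finsum ?A f {L \<in> \<L>. f L \<noteq> 0} = sum f {L \<in> \<L>. f L \<noteq> 0}"
      by (rule finsum_semigroup_algebra) simp
    also have "\<dots> = sum f \<L>"
      by (rule sum.mono_neutral_left) (use fin in auto)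
    finally show ?thesis .
  qed
  then have "is_direct_sum ?A \<L>"
    using dec fin by (simp add: is_direct_sum_def A)
  moreover have "unital ?A"
    using u by (auto simp: unital_def A)
  ultimately show ?thesis
    unfolding semisimple_ring_def using simple simple_left_ideal_iff by blast
qed

text \<open>Let \<open>u\<close> be the right unit of the augmentation ideal. Then
  \<open>c = e - u\<close> is fixed by left multiplication with \<open>G\<close> and has
  augmentation 1, so its nonempty finite support is a union of translates that fill
  \<open>G\<close>.\<close>

lemma right_units_finite_group:
  assumes G: "subgrp e (G :: 's::inverse_semigroup set)"
    and ru: "right_units convolution (alg G :: ('s \<Rightarrow>\<^sub>0 'r::comm_ring_1) set)"
  shows "finite G"
proof -
  note D = subgrpD[OF G]
  note algD = lidealD[OF alg_lideal[OF G, where 'b = 'r]]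
  have basis_alg: "basis g \<in> (alg G :: ('s \<Rightarrow>\<^sub>0 'r) set)" if "g \<in> G" for g
    using that by (simp add: alg_def)
  let ?W = "{f \<in> alg G. augmentation f = (0 :: 'r)} :: ('s \<Rightarrow>\<^sub>0 'r) set"
  have "lideal convolution (alg G) ?W"
    by (rule lidealI) (auto simp: augmentation_diff augmentation_convolution algD)
  then obtain u where u: "u \<in> ?W" "\<And>x. x \<in> ?W \<Longrightarrow> convolution x u = x"
    using ru unfolding right_units_def by blast
  define c where "c = basis e - u"
  have c_alg: "c \<in> alg G"
    using u(1) algD(3)[OF basis_alg[OF D(1)]] by (simp add: c_def)
  have "augmentation c = 1"
    using u(1) by (simp add: c_def augmentation_diff)
  then have "c \<noteq> 0" by auto
  then obtain x where x: "x \<in> supp c"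
    by (metis ex_in_conv keys_eq_empty)
  have xG: "x \<in> G"
    using x c_alg by (auto simp: alg_def)
  have "g * x \<in> supp c" if g: "g \<in> G" for g
  proof -
    have "basis g - basis e \<in> ?W"
      using algD(3)[OF basis_alg[OF g] basis_alg[OF D(1)]] by (simp add: augmentation_diff)
    from u(2)[OF this] have "convolution (basis g) u - convolution (basis e) u = basis g - basis e"
      by (simp add: convolution_simps)
    then have "convolution (basis g) c = convolution (basis e) c"
      by (simp add: c_def convolution_simps convolution_basis D g) (simp add: algebra_simps)
    also have "\<dots> = c"
      using convolution_identity(1)[OF G] c_alg by (simp add: alg_def)
    finally have gc: "push (\<lambda>t. g * t) c = c"
      by (simp only: convolution_basis_left)
    have "inj_on (\<lambda>t. g * t) G"
      by (rule inj_on_inverseI[of _ "\<lambda>t. sinv g * t"]) (use D g in auto)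
    from coef_push_inj[OF this _ xG, of c] have "coef c (g * x) = coef c x"
      unfolding gc using c_alg by (simp add: alg_def)
    then show ?thesis
      using x by (simp add: in_keys_iff)
  qed
  moreover have "g = (g * x) * sinv x" if "g \<in> G" for g
    using that xG D by (simp add: mult.assoc)
  ultimately have "G \<subseteq> (\<lambda>y. y * sinv x) ` supp c"
    by blast
  then show ?thesis
    using finite_surj[OF finite_keys] by blast
qed

text \<open>Let \<open>s\<close> be the sum over \<open>G\<close>, so \<open>s s\<close> is the
  order of \<open>G\<close> times \<open>s\<close>. The left ideal of multiples of
  \<open>d s\<close> has square zero when the order kills \<open>d\<close>; a right unit then forces
  \<open>d s = 0\<close>.\<close>

lemma right_units_order:
  assumes G: "subgrp e (G :: 's::inverse_semigroup set)" and fin: "finite G"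
    and ru: "right_units convolution (alg G :: ('s \<Rightarrow>\<^sub>0 'r::comm_ring_1) set)"
    and d: "of_nat (card G) * d = (0 :: 'r)"
  shows "d = 0"
proof -
  note D = subgrpD[OF G]
  define s :: "'s \<Rightarrow>\<^sub>0 'r" where "s = (\<Sum>g\<in>G. basis g)"
  have s_alg: "s \<in> alg G"
    unfolding s_def alg_def using supp_sum_subset[of G basis G] by auto
  have gs: "convolution (basis g) s = s" if g: "g \<in> G" for g
  proof -
    have "bij_betw (\<lambda>t. g * t) G G"
      by (rule bij_betwI[where g = "\<lambda>t. sinv g * t"]) (use D g in auto)
    from sum.reindex_bij_betw[OF this] show ?thesis
      by (simp add: s_def convolution_sum convolution_basis)
  qed
  have as: "convolution a s = scale (augmentation a) s" if "a \<in> alg G" for a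
  proof -
    have "convolution a s = lin (\<lambda>g. s) a"
      unfolding convolution_expand_left[of a] by (rule lin_cong) (use that gs in \<open>auto simp: alg_def\<close>)
    also have "\<dots> = scale (augmentation a) s"
      by (rule poly_mapping_eqI) (simp add: coef_lin augmentation_def sum_distrib_right)
    finally show ?thesis .
  qed
  let ?L = "range (\<lambda>r. scale (r * d) s)"
  have "lideal convolution (alg G) ?L"
  proof (rule lidealI)
    show "?L \<subseteq> alg G"
      using alg_scale[OF s_alg] by auto
    show "0 \<in> ?L"
      by (rule range_eqI[of _ _ 0]) simp
    show "x - y \<in> ?L" if "x \<in> ?L" "y \<in> ?L" for x y
      using that by (auto simp flip: scale_diff_left left_diff_distrib)
    show "convolution a x \<in> ?L" if a: "a \<in> alg G" and "x \<in> ?L" for a x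
    proof -
      from that obtain r where "x = scale (r * d) s" by blast
      then have "convolution a x = scale (r * augmentation a * d) s"
        by (simp add: convolution_simps as[OF a] mult.commute mult.left_commute)
      then show ?thesis by blast
    qed
  qed
  then obtain r where r: "\<And>x. x \<in> ?L \<Longrightarrow> convolution x (scale (r * d) s) = x"
    using ru unfolding right_units_def by blast
  have "augmentation s = of_nat (card G)"
    by (simp add: s_def augmentation_sum)
  have "scale d s \<in> ?L"
    by (rule range_eqI[of _ _ 1]) simp
  from r[OF this] have "scale (r * d * d * of_nat (card G)) s = scale d s"
    by (simp add: convolution_simps as[OF s_alg] \<open>augmentation s = _\<close> mult.assoc mult.commute mult.left_commute)
  moreover have "r * d * d * of_nat (card G) = r * d * (of_nat (card G) * d)"
    by (simp add: ac_simps)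
  ultimately have "scale d s = 0"
    using d by simp
  then have "coef (scale d s) e = 0" by simp
  then show ?thesis
    using D(1) fin by (simp add: s_def coef_sum_basis)
qed

section \<open>Finite products of fields\<close>

text \<open>Says that the ideal \<open>eR\<close> is a field with identity \<open>e\<close>.\<close>

definition field_idem :: "'r::comm_ring_1 \<Rightarrow> bool"
  where "field_idem e \<longleftrightarrow> e * e = e \<and> e \<noteq> 0 \<and> (\<forall>x. e * x \<noteq> 0 \<longrightarrow> (\<exists>y. e * x * y = e))"

definition field_decomposition :: "'r::comm_ring_1 \<Rightarrow> 'r set \<Rightarrow> bool"
  where "field_decomposition e F \<longleftrightarrow> finite F \<and> (\<forall>x\<in>F. field_idem x) \<and>
    (\<forall>x\<in>F. \<forall>y\<in>F. x \<noteq> y \<longrightarrow> x * y = 0) \<and> \<Sum>F = e"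

lemma field_decomposition_mult:
  assumes "field_decomposition e F" "x \<in> F"
  shows "x * e = x"
proof -
  have "x * e = (\<Sum>y\<in>F. x * y)"
    using assms(1) by (auto simp: field_decomposition_def sum_distrib_left)
  also have "\<dots> = (\<Sum>y\<in>F. if y = x then x else 0)"
    by (rule sum.cong) (use assms in \<open>auto simp: field_decomposition_def field_idem_def\<close>)
  also have "\<dots> = x"
    using assms by (simp add: field_decomposition_def)
  finally show ?thesis .
qed

lemma field_decomposition_sum:
  assumes "field_decomposition f F" "field_decomposition g G" "f * g = 0"
  shows "field_decomposition (f + g) (F \<union> G)"
proof -
  have 0: "x * y = 0" if "x \<in> F" "y \<in> G" for x y
  proof -
    have "x * y = (x * f) * (y * g)"
      by (simp only: field_decomposition_mult[OF assms(1) that(1)] field_decomposition_mult[OF assms(2) that(2)])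
    also have "\<dots> = x * y * (f * g)"
      by (simp only: ac_simps)
    finally show ?thesis
      using assms(3) by simp
  qed
  have "F \<inter> G = {}"
    using 0 assms(1) by (force simp: field_decomposition_def field_idem_def)
  moreover have "y * x = 0" if "x \<in> F" "y \<in> G" for x y
    using 0[OF that] by (simp add: mult.commute)
  ultimately show ?thesis
    using assms(1,2) 0 unfolding field_decomposition_def by (auto simp: sum.union_disjoint)
qed

lemma range_mult_lideal: "lideal (*) UNIV (range (\<lambda>r. (a :: 'r::comm_ring_1) * r))"
proof (rule lidealI)
  show "0 \<in> range (\<lambda>r. a * r)"
    by (rule range_eqI[of _ _ 0]) simp
  show "x - y \<in> range (\<lambda>r. a * r)" if "x \<in> range (\<lambda>r. a * r)" "y \<in> range (\<lambda>r. a * r)" for x y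
    using that by (auto simp flip: right_diff_distrib)
  show "b * x \<in> range (\<lambda>r. a * r)" if "x \<in> range (\<lambda>r. a * r)" for b x
    using that by (auto simp: mult.left_commute)
qed simp

text \<open>A minimal idempotent \<open>d\<close> without a decomposition is not a field idempotent,
  so some nonzero \<open>d x\<close> is not invertible in \<open>dR\<close>. The right unit
  \<open>f\<close> of the ideal generated by \<open>d x\<close> is an idempotent strictly between 0
  and \<open>d\<close>, and the decompositions of \<open>f\<close> and \<open>d - f\<close>
  combine.\<close>

lemma right_units_field_decomposition:
  assumes ru: "right_units ((*) :: 'r::comm_ring_1 \<Rightarrow> 'r \<Rightarrow> 'r) UNIV" and "e * e = (e :: 'r)"
  shows "\<exists>F. field_decomposition e F"
proof (rule ccontr)
  assume none: "\<not> ?thesis"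
  \<comment> \<open>Smaller idempotents \<open>e\<close> have larger ideals generated by
    \<open>1 - e\<close>, so the ascending chain condition yields a minimal bad idempotent.\<close>
  let ?J = "\<lambda>e :: 'r. range (\<lambda>r. (1 - e) * r)"
  let ?B = "?J ` {e. e * e = e \<and> \<not> (\<exists>F. field_decomposition e F)}"
  have "?J e \<in> ?B"
    using none assms(2) by blast
  then have "\<exists>M\<in>?B. \<forall>I\<in>?B. M \<subseteq> I \<longrightarrow> I = M"
    by (rule ascending_maximal[OF right_units_ascending[OF ru]]) (use range_mult_lideal in blast)
  then have "\<exists>d\<in>{e. e * e = e \<and> \<not> (\<exists>F. field_decomposition e F)}.
      \<forall>f\<in>{e. e * e = e \<and> \<not> (\<exists>F. field_decomposition e F)}. ?J d \<subseteq> ?J f \<longrightarrow> ?J f = ?J d"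
    by (simp only: bex_simps ball_simps)
  then obtain d where d: "d * d = d" "\<not> (\<exists>F. field_decomposition d F)"
    and max: "\<And>f. f * f = f \<Longrightarrow> \<not> (\<exists>F. field_decomposition f F) \<Longrightarrow> ?J d \<subseteq> ?J f \<Longrightarrow> ?J f = ?J d"
    by blast
  have split: "\<exists>F. field_decomposition f F" if f: "f * f = f" "d * f = f" "f \<noteq> d" for f
  proof (rule ccontr)
    assume bad: "\<not> (\<exists>F. field_decomposition f F)"
    have "(1 - f) * ((1 - d) * r) = (1 - d) * r" for r
      using f(2) by (simp add: algebra_simps) (simp add: mult.assoc[symmetric] mult.commute[of f d])
    then have "?J d \<subseteq> ?J f"
      by (metis (no_types, lifting) image_subsetI rangeI)
    from max[OF f(1) bad this] have "1 - f \<in> ?J d"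
      by (metis mult.right_neutral rangeI)
    then obtain r where r: "1 - f = (1 - d) * r" by blast
    have "d * (1 - f) = (d - d * d) * r"
      unfolding r by (simp add: algebra_simps)
    then show False
      using f(2,3) d(1) by (simp add: algebra_simps)
  qed
  have "d \<noteq> 0"
  proof
    assume "d = 0"
    then have "field_decomposition d {}"
      by (simp add: field_decomposition_def)
    then show False using d(2) by blast
  qed
  have "\<not> field_idem d"
  proof
    assume "field_idem d"
    then have "field_decomposition d {d}"
      by (simp add: field_decomposition_def)
    then show False using d(2) by blast
  qed
  then obtain x where x: "d * x \<noteq> 0" "\<And>y. d * x * y \<noteq> d"
    using d(1) \<open>d \<noteq> 0\<close> by (auto simp: field_idem_def)
  obtain f where f: "f \<in> range (\<lambda>r. d * x * r)" "\<And>y. y \<in> range (\<lambda>r. d * x * r) \<Longrightarrow> y * f = y"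
    using ru range_mult_lideal[of "d * x"] unfolding right_units_def by blast
  obtain y where y: "f = d * x * y"
    using f(1) by blast
  have ff: "f * f = f"
    by (rule f(2)[OF f(1)])
  have "d * f = d * d * x * y"
    by (simp add: y mult.assoc)
  then have df: "d * f = f"
    by (simp add: d(1) y)
  have "f \<noteq> d"
    using x(2) y by metis
  have "d * x * f = d * x"
    by (rule f(2)) (rule range_eqI[of _ _ 1], simp)
  then have "f \<noteq> 0"
    using x(1) by auto
  obtain F where F: "field_decomposition f F"
    using split[OF ff df \<open>f \<noteq> d\<close>] by blast
  have "(d - f) * (d - f) = d - f" "d * (d - f) = d - f" "f * (d - f) = 0"
    using d(1) ff df by (simp_all add: algebra_simps)
  moreover have "d - f \<noteq> d"
    using \<open>f \<noteq> 0\<close> by simp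
  ultimately obtain G where "field_decomposition (d - f) G"
    using split by blast
  from field_decomposition_sum[OF F this] have "field_decomposition d (F \<union> G)"
    using \<open>f * (d - f) = 0\<close> by simp
  then show False
    using d(2) by blast
qed

text \<open>If \<open>x\<close> in \<open>I\<close> has \<open>x * e\<close> nonzero, then
  \<open>e\<close> is a multiple of \<open>x\<close> and belongs to \<open>I\<close>. Hence
  \<open>I\<close> is generated by the sum of the members of \<open>F\<close> it contains; in
  particular it is determined by a subset of \<open>F\<close>.\<close>

lemma field_decomposition_ideal:
  assumes F: "field_decomposition 1 F" and I: "lideal (*) UNIV (I :: 'r::comm_ring_1 set)"
  shows "\<Sum>(F \<inter> I) \<in> I" "x \<in> I \<longleftrightarrow> x * \<Sum>(F \<inter> I) = x"
proof -
  have fin: "finite F"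
    using F by (simp add: field_decomposition_def)
  show in_I: "\<Sum>(F \<inter> I) \<in> I"
    by (rule lideal_sum[OF I]) blast
  have "x * \<Sum>(F \<inter> I) = x" if x: "x \<in> I"
  proof -
    have "x * e = 0" if e: "e \<in> F - F \<inter> I" for e
    proof (rule ccontr)
      assume "x * e \<noteq> 0"
      then obtain y where "e * x * y = e"
        using e F unfolding field_decomposition_def field_idem_def by (metis DiffD1 mult.commute)
      then have "e = (e * y) * x"
        by (simp add: ac_simps)
      then have "e \<in> I"
        using lidealD(6)[OF I _ x, of "e * y"] by simp
      then show False using e by blast
    qed
    then have "(\<Sum>e\<in>F \<inter> I. x * e) = (\<Sum>e\<in>F. x * e)"
      by (intro sum.mono_neutral_left) (use fin in auto)
    also have "\<dots> = x"
      using F by (simp add: field_decomposition_def flip: sum_distrib_left)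
    finally show ?thesis
      by (simp add: sum_distrib_left)
  qed
  moreover have "x \<in> I" if "x * \<Sum>(F \<inter> I) = x"
    using lidealD(6)[OF I _ in_I, of x] that by simp
  ultimately show "x \<in> I \<longleftrightarrow> x * \<Sum>(F \<inter> I) = x" by blast
qed

lemma field_decomposition_right_units:
  assumes F: "field_decomposition (1 :: 'r::comm_ring_1) F"
  shows "right_units ((*) :: 'r \<Rightarrow> 'r \<Rightarrow> 'r) UNIV"
  unfolding right_units_def using field_decomposition_ideal[OF F] by blast

lemma finite_decreasing_stabilizes:
  assumes "\<And>n. J n \<subseteq> F" "finite F" "\<And>n. J (Suc n) \<subseteq> J n"
  shows "stabilizes J"
proof -
  have fin: "finite (J n)" for n
    using assms(1,2) finite_subset by blast
  obtain N where N: "\<And>n. card (J N) \<le> card (J n)"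
    using ex_has_least_nat[of "\<lambda>_. True" 0 "\<lambda>n. card (J n)"] by auto
  have "J n = J N" if "n \<ge> N" for n
    using lift_Suc_antimono_le[of J N n, OF assms(3) that] card_seteq[OF fin[of N], of "J n"] N[of n] by blast
  then show ?thesis
    by (rule stabilizesI)
qed

lemma field_decomposition_artinian:
  assumes F: "field_decomposition (1 :: 'r::comm_ring_1) F"
  shows "chain_condition False ((*) :: 'r \<Rightarrow> 'r \<Rightarrow> 'r) UNIV"
  unfolding chain_condition_def
proof (intro allI impI, elim conjE)
  fix I :: "nat \<Rightarrow> 'r set"
  assume I: "\<forall>n. lideal (*) UNIV (I n)" "set_chain False I"
  have "stabilizes (\<lambda>n. F \<inter> I n)"
    by (rule finite_decreasing_stabilizes[where F = F])
       (use F I(2) in \<open>auto simp: field_decomposition_def set_chain_def\<close>)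
  then have "stabilizes (\<lambda>n. {x. x * \<Sum>(F \<inter> I n) = x})"
    by (rule stabilizes_compose)
  moreover have "{x. x * \<Sum>(F \<inter> I n) = x} = I n" for n
    using field_decomposition_ideal(2)[OF F I(1)[rule_format]] by blast
  ultimately show "stabilizes I" by simp
qed

lemma field_decomposition_invertible:
  assumes F: "field_decomposition (1 :: 'r::comm_ring_1) F" and "\<And>e. e \<in> F \<Longrightarrow> a * e \<noteq> 0"
  shows "\<exists>r. r * a = 1"
proof -
  have "\<forall>e\<in>F. \<exists>y. e * a * y = e"
    using F assms(2) unfolding field_decomposition_def field_idem_def by (metis mult.commute)
  then obtain y where y: "\<And>e. e \<in> F \<Longrightarrow> e * a * y e = e"
    by metis
  have "(\<Sum>e\<in>F. e * y e) * a = (\<Sum>e\<in>F. e)"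
    unfolding sum_distrib_right by (intro sum.cong refl) (metis y mult.commute mult.left_commute)
  then show ?thesis
    using F by (auto simp: field_decomposition_def)
qed

subsection \<open>Products of rings given by lists\<close>

lemma RDirProd_list_Cons:
  "carrier (RDirProd_list (A # As)) = (\<lambda>(x, xs). x # xs) ` (carrier A \<times> carrier (RDirProd_list As))"
  "x \<in> carrier A \<Longrightarrow> y \<in> carrier A \<Longrightarrow> xs \<in> carrier (RDirProd_list As) \<Longrightarrow> ys \<in> carrier (RDirProd_list As) \<Longrightarrow>
     (x # xs) \<otimes>\<^bsub>RDirProd_list (A # As)\<^esub> (y # ys) = (x \<otimes>\<^bsub>A\<^esub> y) # (xs \<otimes>\<^bsub>RDirProd_list As\<^esub> ys)"
  "x \<in> carrier A \<Longrightarrow> y \<in> carrier A \<Longrightarrow> xs \<in> carrier (RDirProd_list As) \<Longrightarrow> ys \<in> carrier (RDirProd_list As) \<Longrightarrow>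
     (x # xs) \<oplus>\<^bsub>RDirProd_list (A # As)\<^esub> (y # ys) = (x \<oplus>\<^bsub>A\<^esub> y) # (xs \<oplus>\<^bsub>RDirProd_list As\<^esub> ys)"
  "\<one>\<^bsub>RDirProd_list (A # As)\<^esub> = \<one>\<^bsub>A\<^esub> # \<one>\<^bsub>RDirProd_list As\<^esub>"
proof -
  show "carrier (RDirProd_list (A # As)) = (\<lambda>(x, xs). x # xs) ` (carrier A \<times> carrier (RDirProd_list As))"
    by (rule RDirProd_list_carrier)
  show "\<one>\<^bsub>RDirProd_list (A # As)\<^esub> = \<one>\<^bsub>A\<^esub> # \<one>\<^bsub>RDirProd_list As\<^esub>"
    by (simp add: RDirProd_list_one)
  have hom: "(\<lambda>(a, as). a # as) \<in> ring_hom (RDirProd A (RDirProd_list As)) (RDirProd_list (A # As))"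
    by (rule RDirProd_list_hom1)
  assume xy: "x \<in> carrier A" "y \<in> carrier A" "xs \<in> carrier (RDirProd_list As)" "ys \<in> carrier (RDirProd_list As)"
  then have c: "(x, xs) \<in> carrier (RDirProd A (RDirProd_list As))" "(y, ys) \<in> carrier (RDirProd A (RDirProd_list As))"
    by (simp_all add: RDirProd_carrier)
  show "(x # xs) \<otimes>\<^bsub>RDirProd_list (A # As)\<^esub> (y # ys) = (x \<otimes>\<^bsub>A\<^esub> y) # (xs \<otimes>\<^bsub>RDirProd_list As\<^esub> ys)"
    using ring_hom_mult[OF hom c] by (simp add: RDirProd_def DirProd_def monoid.defs)
  show "(x # xs) \<oplus>\<^bsub>RDirProd_list (A # As)\<^esub> (y # ys) = (x \<oplus>\<^bsub>A\<^esub> y) # (xs \<oplus>\<^bsub>RDirProd_list As\<^esub> ys)"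
    using ring_hom_add[OF hom c] by (simp add: RDirProd_def DirProd_def monoid.defs)
qed

lemma RDirProd_list_map_carrier:
  "xs \<in> carrier (RDirProd_list (map B ks)) \<longleftrightarrow> length xs = length ks \<and> (\<forall>i<length ks. xs ! i \<in> carrier (B (ks ! i)))"
  using RDirProd_list_carrier_mem[of xs "map B ks"] RDirProd_list_carrier_memI[of xs "map B ks"]
  by (auto simp: nth_map)

lemma RDirProd_list_map_one: "\<one>\<^bsub>RDirProd_list (map B ks)\<^esub> = map (\<lambda>i. \<one>\<^bsub>B i\<^esub>) ks"
  by (induction ks) (simp_all add: RDirProd_list_one monoid.defs)

lemma RDirProd_list_map_simps:
  assumes "\<And>i. i \<in> set ks \<Longrightarrow> f i \<in> carrier (B i)" "\<And>i. i \<in> set ks \<Longrightarrow> g i \<in> carrier (B i)"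
  shows "map f ks \<otimes>\<^bsub>RDirProd_list (map B ks)\<^esub> map g ks = map (\<lambda>i. f i \<otimes>\<^bsub>B i\<^esub> g i) ks"
    and "map f ks \<oplus>\<^bsub>RDirProd_list (map B ks)\<^esub> map g ks = map (\<lambda>i. f i \<oplus>\<^bsub>B i\<^esub> g i) ks"
proof -
  have carr: "map h js \<in> carrier (RDirProd_list (map B js))" if "\<And>i. i \<in> set js \<Longrightarrow> h i \<in> carrier (B i)" for h js
    using that by (simp add: RDirProd_list_map_carrier)
  show "map f ks \<otimes>\<^bsub>RDirProd_list (map B ks)\<^esub> map g ks = map (\<lambda>i. f i \<otimes>\<^bsub>B i\<^esub> g i) ks"
    using assms
  proof (induction ks)
    case (Cons i js)
    then show ?case
      using RDirProd_list_Cons(2)[of "f i" "B i" "g i" "map f js" "map B js" "map g js"] carr[of js f] carr[of js g]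
      by simp
  qed (simp add: monoid.defs)
  show "map f ks \<oplus>\<^bsub>RDirProd_list (map B ks)\<^esub> map g ks = map (\<lambda>i. f i \<oplus>\<^bsub>B i\<^esub> g i) ks"
    using assms
  proof (induction ks)
    case (Cons i js)
    then show ?case
      using RDirProd_list_Cons(3)[of "f i" "B i" "g i" "map f js" "map B js" "map g js"] carr[of js f] carr[of js g]
      by simp
  qed (simp add: monoid.defs)
qed

text \<open>Homomorphisms that are jointly injective and jointly surjective assemble to an
  isomorphism; distinct keys \<open>ks\<close> allow a list of components to be read as a function
  of the key.\<close>

lemma RDirProd_list_iso:
  assumes hom: "\<And>i. i \<in> set ks \<Longrightarrow> h i \<in> ring_hom A (B i)"
    and inj: "\<And>x y. x \<in> carrier A \<Longrightarrow> y \<in> carrier A \<Longrightarrow> (\<And>i. i \<in> set ks \<Longrightarrow> h i x = h i y) \<Longrightarrow> x = y"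
    and surj: "\<And>f. (\<And>i. i \<in> set ks \<Longrightarrow> f i \<in> carrier (B i)) \<Longrightarrow> \<exists>x\<in>carrier A. \<forall>i\<in>set ks. h i x = f i"
    and dist: "distinct ks"
  shows "(\<lambda>x. map (\<lambda>i. h i x) ks) \<in> ring_iso A (RDirProd_list (map B ks))"
proof -
  have closed: "h i x \<in> carrier (B i)" if "i \<in> set ks" "x \<in> carrier A" for i x
    using ring_hom_closed[OF hom[OF that(1)] that(2)] .
  have "(\<lambda>x. map (\<lambda>i. h i x) ks) \<in> ring_hom A (RDirProd_list (map B ks))"
  proof (rule ring_hom_memI)
    show "map (\<lambda>i. h i x) ks \<in> carrier (RDirProd_list (map B ks))" if "x \<in> carrier A" for x
      using closed that by (simp add: RDirProd_list_map_carrier)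
    fix x y assume xy: "x \<in> carrier A" "y \<in> carrier A"
    note simps = RDirProd_list_map_simps[where f = "\<lambda>i. h i x" and g = "\<lambda>i. h i y" and B = B and ks = ks]
    show "map (\<lambda>i. h i (x \<otimes>\<^bsub>A\<^esub> y)) ks = map (\<lambda>i. h i x) ks \<otimes>\<^bsub>RDirProd_list (map B ks)\<^esub> map (\<lambda>i. h i y) ks"
      using ring_hom_mult[OF hom] simps(1) closed xy by simp
    show "map (\<lambda>i. h i (x \<oplus>\<^bsub>A\<^esub> y)) ks = map (\<lambda>i. h i x) ks \<oplus>\<^bsub>RDirProd_list (map B ks)\<^esub> map (\<lambda>i. h i y) ks"
      using ring_hom_add[OF hom] simps(2) closed xy by simp
  next
    show "map (\<lambda>i. h i \<one>\<^bsub>A\<^esub>) ks = \<one>\<^bsub>RDirProd_list (map B ks)\<^esub>"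
      using ring_hom_one[OF hom] by (simp add: RDirProd_list_map_one)
  qed
  moreover have "bij_betw (\<lambda>x. map (\<lambda>i. h i x) ks) (carrier A) (carrier (RDirProd_list (map B ks)))"
  proof (rule bij_betw_imageI)
    show "inj_on (\<lambda>x. map (\<lambda>i. h i x) ks) (carrier A)"
      by (rule inj_onI) (use inj in \<open>auto simp: map_eq_conv\<close>)
    show "(\<lambda>x. map (\<lambda>i. h i x) ks) ` carrier A = carrier (RDirProd_list (map B ks))"
    proof
      show "(\<lambda>x. map (\<lambda>i. h i x) ks) ` carrier A \<subseteq> carrier (RDirProd_list (map B ks))"
        using closed by (auto simp: RDirProd_list_map_carrier)
      show "carrier (RDirProd_list (map B ks)) \<subseteq> (\<lambda>x. map (\<lambda>i. h i x) ks) ` carrier A"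
      proof
        fix xs assume "xs \<in> carrier (RDirProd_list (map B ks))"
        then have xs: "length xs = length ks" "\<And>k. k < length ks \<Longrightarrow> xs ! k \<in> carrier (B (ks ! k))"
          by (auto simp: RDirProd_list_map_carrier)
        define f where "f i = xs ! (THE k. k < length ks \<and> ks ! k = i)" for i
        have f: "f (ks ! k) = xs ! k" if "k < length ks" for k
        proof -
          have "(THE l. l < length ks \<and> ks ! l = ks ! k) = k"
            by (rule the_equality) (use that dist nth_eq_iff_index_eq in auto)
          then show ?thesis by (simp add: f_def)
        qed
        have "f i \<in> carrier (B i)" if "i \<in> set ks" for i
          using that f xs(2) by (auto simp: in_set_conv_nth)
        then obtain x where x: "x \<in> carrier A" "\<forall>i\<in>set ks. h i x = f i"
          using surj by blast
        have "map (\<lambda>i. h i x) ks = xs"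
          by (rule nth_equalityI) (use xs(1) x(2) f in auto)
        then show "xs \<in> (\<lambda>x. map (\<lambda>i. h i x) ks) ` carrier A"
          using x(1) by blast
      qed
    qed
  qed
  ultimately show ?thesis
    by (simp add: ring_iso_def)
qed

text \<open>Translates the characteristic into the additive order of an element \<open>d\<close> of
  \<open>R\<close>, with characteristic 0 for infinite order. Positivity of \<open>m\<close> matters
  because 0 divides 0.\<close>

lemma ring_characteristic_dvd:
  fixes d :: "'r::comm_ring_1"
  assumes iff: "\<And>n. [n] \<cdot>\<^bsub>F\<^esub> \<one>\<^bsub>F\<^esub> = \<zero>\<^bsub>F\<^esub> \<longleftrightarrow> of_nat n * d = 0" and "m > 0"
  shows "ring_characteristic F dvd m \<longleftrightarrow> of_nat m * d = 0"
proof (cases "\<exists>n::nat. n > 0 \<and> of_nat n * d = 0")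
  case False
  then have "ring_characteristic F = 0"
    unfolding ring_characteristic_def iff by (rule if_not_P)
  moreover have "of_nat m * d \<noteq> 0"
    using False assms(2) by blast
  ultimately show ?thesis
    using assms(2) by simp
next
  case True
  define c where "c = (LEAST n::nat. n > 0 \<and> of_nat n * d = 0)"
  have c: "c > 0" "of_nat c * d = 0"
    using LeastI_ex[OF True] by (simp_all add: c_def)
  have "ring_characteristic F = c"
    using True by (simp add: ring_characteristic_def iff c_def)
  moreover have "of_nat m * d = 0" if dvd: "c dvd m"
  proof -
    obtain k where "m = c * k"
      using dvd by (rule dvdE)
    then have "of_nat m * d = of_nat k * (of_nat c * d)"
      by (simp add: ac_simps)
    then show ?thesis
      using c by simp
  qed
  moreover have "c dvd m" if "of_nat m * d = 0"
  proof -
    have "of_nat m * d = of_nat (m div c) * (of_nat c * d) + of_nat (m mod c) * d"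
      by (subst div_mult_mod_eq[of m c, symmetric]) (simp only: of_nat_add of_nat_mult distrib_right mult.assoc)
    then have "of_nat (m mod c) * d = 0"
      using that c(2) by simp
    then have "\<not> 0 < m mod c"
      using not_less_Least[of "m mod c" "\<lambda>n. n > 0 \<and> of_nat n * d = 0"] c(1) by (auto simp flip: c_def)
    then show ?thesis by auto
  qed
  ultimately show ?thesis by auto
qed

text \<open>The ideal \<open>eR\<close> as a ring record on the type of \<open>R\<close> itself,
  because the factors in the theorem are rings over that type.\<close>

definition idem_field :: "'r::comm_ring_1 \<Rightarrow> 'r ring"
  where "idem_field e = \<lparr>carrier = range (\<lambda>r. e * r), monoid.mult = (*), one = e, ring.zero = 0, add = (+)\<rparr>"

lemma idem_field_carrier:
  assumes "e * e = e" shows "x \<in> carrier (idem_field e) \<longleftrightarrow> e * x = x"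
proof
  assume "x \<in> carrier (idem_field e)"
  then obtain r where "x = e * r"
    by (auto simp: idem_field_def)
  then show "e * x = x"
    using assms by (simp add: mult.assoc[symmetric])
next
  assume "e * x = x"
  then have "x = e * x" by simp
  then show "x \<in> carrier (idem_field e)"
    unfolding idem_field_def by (metis (no_types) partial_object.select_convs(1) rangeI)
qed

lemma field_idem_field:
  assumes "field_idem e"
  shows "field (idem_field e)"
proof -
  have e: "e * e = e" "e \<noteq> 0"
    using assms by (auto simp: field_idem_def)
  note carr = idem_field_carrier[OF e(1)]
  have ops: "monoid.mult (idem_field e) = (*)" "\<one>\<^bsub>idem_field e\<^esub> = e" "\<zero>\<^bsub>idem_field e\<^esub> = 0" "add (idem_field e) = (+)"
    by (simp_all add: idem_field_def)
  have "abelian_group (idem_field e)"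
  proof (rule abelian_groupI)
    show "\<exists>y\<in>carrier (idem_field e). y \<oplus>\<^bsub>idem_field e\<^esub> x = \<zero>\<^bsub>idem_field e\<^esub>" if "x \<in> carrier (idem_field e)" for x
      using that by (intro bexI[of _ "- x"]) (simp_all add: carr ops)
  qed (simp_all add: carr ops algebra_simps)
  moreover have "Group.comm_monoid (idem_field e)"
    by (rule comm_monoidI) (auto simp: carr ops e ac_simps)
  ultimately interpret cring "idem_field e"
    by (rule cringI) (simp_all add: ops algebra_simps)
  show ?thesis
  proof (rule cring_fieldI2)
    show "\<zero>\<^bsub>idem_field e\<^esub> \<noteq> \<one>\<^bsub>idem_field e\<^esub>"
      using e by (simp add: ops)
    fix a assume a: "a \<in> carrier (idem_field e)" "a \<noteq> \<zero>\<^bsub>idem_field e\<^esub>"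
    then have "e * a \<noteq> 0"
      by (simp add: carr ops)
    then obtain y where "e * a * y = e"
      using assms by (auto simp: field_idem_def)
    then have "a * (e * y) = e"
      by (simp add: ac_simps)
    moreover have "e * y \<in> carrier (idem_field e)"
      by (simp add: idem_field_def)
    ultimately show "\<exists>b\<in>carrier (idem_field e). a \<otimes>\<^bsub>idem_field e\<^esub> b = \<one>\<^bsub>idem_field e\<^esub>"
      by (auto simp: ops)
  qed
qed

lemma idem_field_characteristic:
  assumes "m > 0" shows "ring_characteristic (idem_field e) dvd m \<longleftrightarrow> of_nat m * e = 0"
proof (rule ring_characteristic_dvd[OF _ assms])
  fix n :: nat
  have "[n] \<cdot>\<^bsub>idem_field e\<^esub> e = of_nat n * e"
    unfolding add_pow_def by (induction n) (simp_all add: idem_field_def algebra_simps)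
  then show "[n] \<cdot>\<^bsub>idem_field e\<^esub> \<one>\<^bsub>idem_field e\<^esub> = \<zero>\<^bsub>idem_field e\<^esub> \<longleftrightarrow> of_nat n * e = 0"
    by (simp add: idem_field_def)
qed

lemma field_decomposition_iso:
  assumes F: "field_decomposition (1 :: 'r::comm_ring_1) F"
  obtains es where "set es = F" "(ring_of_type_algebra :: 'r ring) \<simeq> RDirProd_list (map idem_field es)"
proof -
  obtain es where es: "set es = F" "distinct es"
    using F finite_distinct_list[of F] unfolding field_decomposition_def by blast
  have idem: "e * e = e" if "e \<in> F" for e
    using F that by (auto simp: field_decomposition_def field_idem_def)
  have orth: "e * f = 0" if "e \<in> F" "f \<in> F" "e \<noteq> f" for e f
    using F that by (auto simp: field_decomposition_def)
  have sum: "x = (\<Sum>e\<in>F. e * x)" for x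
    using F by (simp add: field_decomposition_def flip: sum_distrib_right)
  have "(\<lambda>x. map (\<lambda>e. e * x) es) \<in> ring_iso (ring_of_type_algebra :: 'r ring) (RDirProd_list (map idem_field es))"
  proof (rule RDirProd_list_iso)
    show "(\<lambda>x. e * x) \<in> ring_hom (ring_of_type_algebra :: 'r ring) (idem_field e)" if "e \<in> set es" for e
    proof (rule ring_hom_memI)
      fix x y :: 'r
      have "e * (x * y) = e * x * (e * y)"
        using idem[of e] that es(1) by (metis mult.assoc mult.left_commute)
      then show "e * (x \<otimes>\<^bsub>ring_of_type_algebra\<^esub> y) = e * x \<otimes>\<^bsub>idem_field e\<^esub> (e * y)"
        by (simp add: ring_of_type_algebra_def idem_field_def)
    qed (simp_all add: ring_of_type_algebra_def idem_field_def distrib_left)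
    show "x = y" if "\<And>e. e \<in> set es \<Longrightarrow> e * x = e * y" for x y
      using sum[of x] sum[of y] that es(1) by (metis (no_types, lifting) sum.cong)
    show "\<exists>x\<in>carrier (ring_of_type_algebra :: 'r ring). \<forall>e\<in>set es. e * x = f e"
      if "\<And>e. e \<in> set es \<Longrightarrow> f e \<in> carrier (idem_field e)" for f
    proof (intro bexI ballI)
      fix e assume e: "e \<in> set es"
      have fe: "i * f i = f i" if "i \<in> F" for i
        using \<open>\<And>e. e \<in> set es \<Longrightarrow> f e \<in> carrier (idem_field e)\<close>[of i] idem_field_carrier[OF idem] that es(1) by simp
      have "e * (\<Sum>i\<in>F. f i) = (\<Sum>i\<in>F. e * (i * f i))"
        unfolding sum_distrib_left by (intro sum.cong refl) (simp add: fe)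
      also have "\<dots> = (\<Sum>i\<in>F. if i = e then f e else 0)"
      proof (intro sum.cong refl)
        fix i assume i: "i \<in> F"
        have "e * (i * f i) = e * i * f i"
          by (rule mult.assoc[symmetric])
        then show "e * (i * f i) = (if i = e then f e else 0)"
          using e i es(1) fe[OF i] idem[OF i] orth[of e i] by auto
      qed
      also have "\<dots> = f e"
        using e es(1) F by (simp add: field_decomposition_def)
      finally show "e * (\<Sum>i\<in>F. f i) = f e" .
    qed (simp add: ring_of_type_algebra_def)
  qed (rule es(2))
  then show thesis
    using that es(1) by (auto simp: is_ring_iso_def)
qed

text \<open>The unit vectors of the product pull back to orthogonal field idempotents of
  \<open>R\<close> with sum 1, and the characteristic of a factor becomes the additive order of its
  idempotent.\<close>

lemma field_list_decomposition:
  assumes fields: "\<And>K. K \<in> set Fs \<Longrightarrow> field K"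
    and iso: "(ring_of_type_algebra :: 'r::comm_ring_1 ring) \<simeq> RDirProd_list Fs"
  obtains F where "field_decomposition (1 :: 'r) F"
    "\<And>e. e \<in> F \<Longrightarrow> \<exists>K\<in>set Fs. \<forall>m>0. ring_characteristic K dvd m \<longleftrightarrow> of_nat m * e = 0"
proof -
  let ?R = "ring_of_type_algebra :: 'r ring" and ?P = "RDirProd_list Fs"
  let ?n = "length Fs"
  have R: "carrier ?R = UNIV" "monoid.mult ?R = (*)" "\<one>\<^bsub>?R\<^esub> = 1" "\<zero>\<^bsub>?R\<^esub> = 0" "add ?R = (+)"
    by (simp_all add: ring_of_type_algebra_def)
  obtain \<phi> where \<phi>: "\<phi> \<in> ring_iso ?R ?P"
    using iso by (auto simp: is_ring_iso_def)
  then have hom: "\<phi> \<in> ring_hom ?R ?P" and bij: "bij_betw \<phi> UNIV (carrier ?P)"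
    by (auto simp: ring_iso_def R)
  have ringK: "ring (Fs ! i)" if "i < ?n" for i
    using fields[of "Fs ! i"] that by (simp add: field.is_ring)
  have nth: "Fs = map (\<lambda>i. Fs ! i) [0..<?n]"
    by (simp add: map_nth)
  have list_as_map: "xs = map (\<lambda>i. xs ! i) [0..<?n]" if "xs \<in> carrier ?P" for xs
    using RDirProd_list_carrier_mem(1)[OF that] by (simp add: map_nth flip: \<open>length xs = _\<close>)
  define pr where "pr i r = \<phi> r ! i" for i r
  have \<phi>_P: "\<phi> r \<in> carrier ?P" for r
    using ring_hom_closed[OF hom] by (simp add: R)
  have pr_carrier: "pr i r \<in> carrier (Fs ! i)" if "i < ?n" for i r
    using RDirProd_list_carrier_mem(2)[OF \<phi>_P that] by (simp add: pr_def)
  have \<phi>_map: "\<phi> r = map (\<lambda>i. pr i r) [0..<?n]" for r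
    unfolding pr_def by (rule list_as_map[OF \<phi>_P])
  note simps = RDirProd_list_map_simps[where ks = "[0..<?n]" and B = "\<lambda>i. Fs ! i", folded nth]
  have pr_hom: "pr i (r * s) = pr i r \<otimes>\<^bsub>Fs ! i\<^esub> pr i s" "pr i (r + s) = pr i r \<oplus>\<^bsub>Fs ! i\<^esub> pr i s"
    "pr i 1 = \<one>\<^bsub>Fs ! i\<^esub>" if i: "i < ?n" for i r s
  proof -
    have "\<phi> (r * s) = \<phi> r \<otimes>\<^bsub>?P\<^esub> \<phi> s" "\<phi> (r + s) = \<phi> r \<oplus>\<^bsub>?P\<^esub> \<phi> s" "\<phi> 1 = \<one>\<^bsub>?P\<^esub>"
      using ring_hom_mult[OF hom, of r s] ring_hom_add[OF hom, of r s] ring_hom_one[OF hom] by (simp_all add: R)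
    moreover have "\<phi> r \<otimes>\<^bsub>?P\<^esub> \<phi> s = map (\<lambda>i. pr i r \<otimes>\<^bsub>Fs ! i\<^esub> pr i s) [0..<?n]"
      "\<phi> r \<oplus>\<^bsub>?P\<^esub> \<phi> s = map (\<lambda>i. pr i r \<oplus>\<^bsub>Fs ! i\<^esub> pr i s) [0..<?n]"
      "\<one>\<^bsub>?P\<^esub> = map (\<lambda>i. \<one>\<^bsub>Fs ! i\<^esub>) [0..<?n]"
      unfolding \<phi>_map[of r] \<phi>_map[of s]
      using simps pr_carrier RDirProd_list_map_one[of "\<lambda>i. Fs ! i" "[0..<?n]", folded nth] by simp_all
    ultimately show "pr i (r * s) = pr i r \<otimes>\<^bsub>Fs ! i\<^esub> pr i s" "pr i (r + s) = pr i r \<oplus>\<^bsub>Fs ! i\<^esub> pr i s"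
      "pr i 1 = \<one>\<^bsub>Fs ! i\<^esub>"
      using i by (simp_all add: pr_def)
  qed
  have pr_0: "pr i 0 = \<zero>\<^bsub>Fs ! i\<^esub>" if i: "i < ?n" for i
  proof -
    interpret ring "Fs ! i" by (rule ringK[OF i])
    have "pr i 0 \<oplus>\<^bsub>Fs ! i\<^esub> pr i 0 = pr i 0"
      using pr_hom(2)[OF i, of 0 0] by simp
    then show ?thesis
      using pr_carrier[OF i, of 0] by (metis a_comm add.l_cancel_one' zero_closed r_zero)
  qed
  have pr_inj: "r = s" if "\<And>i. i < ?n \<Longrightarrow> pr i r = pr i s" for r s
  proof -
    have "\<phi> r = \<phi> s"
      unfolding \<phi>_map[of r] \<phi>_map[of s] using that by simp
    then show ?thesis
      using bij_betw_imp_inj_on[OF bij] by (auto dest: injD)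
  qed
  have pr_surj: "\<exists>r. \<forall>i<?n. pr i r = f i" if "\<And>i. i < ?n \<Longrightarrow> f i \<in> carrier (Fs ! i)" for f
  proof -
    have "map f [0..<?n] \<in> carrier ?P"
      by (rule RDirProd_list_carrier_memI) (use that in auto)
    then obtain r where "\<phi> r = map f [0..<?n]"
      using bij_betw_imp_surj_on[OF bij] by (metis imageE)
    then show ?thesis
      by (intro exI[of _ r]) (simp add: pr_def)
  qed
  \<comment> \<open>The element of \<open>R\<close> with component \<open>x\<close> at place
    \<open>i\<close> and zero elsewhere; for \<open>x\<close> the identity of the factor it gives
    the idempotent \<open>\<delta> i\<close>.\<close>
  define loc where "loc i x = (SOME r. \<forall>j<?n. pr j r = (if j = i then x else \<zero>\<^bsub>Fs ! j\<^esub>))" for i x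
  have loc: "pr j (loc i x) = (if j = i then x else \<zero>\<^bsub>Fs ! j\<^esub>)" if "i < ?n" "x \<in> carrier (Fs ! i)" "j < ?n" for i x j
  proof -
    have "\<exists>r. \<forall>j<?n. pr j r = (if j = i then x else \<zero>\<^bsub>Fs ! j\<^esub>)"
      by (rule pr_surj) (use that ringK ring.ring_simprules(2) in auto)
    then have "\<forall>j<?n. pr j (loc i x) = (if j = i then x else \<zero>\<^bsub>Fs ! j\<^esub>)"
      unfolding loc_def by (rule someI_ex)
    then show ?thesis using that(3) by blast
  qed
  define \<delta> where "\<delta> i = loc i \<one>\<^bsub>Fs ! i\<^esub>" for i
  have \<delta>: "pr j (\<delta> i) = (if j = i then \<one>\<^bsub>Fs ! i\<^esub> else \<zero>\<^bsub>Fs ! j\<^esub>)" if "i < ?n" "j < ?n" for i j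
    unfolding \<delta>_def using that ringK ring.ring_simprules(6) by (intro loc) auto
  have pr_\<delta>: "pr j (\<delta> i * r) = (if j = i then pr i r else \<zero>\<^bsub>Fs ! j\<^esub>)" if "i < ?n" "j < ?n" for i j r
  proof -
    interpret ring "Fs ! j" by (rule ringK[OF that(2)])
    note c = pr_carrier[OF that(2), of r]
    show ?thesis
      using l_one[OF c] l_null[OF c] by (auto simp: pr_hom(1)[OF that(2)] \<delta>[OF that])
  qed
  have one_ne_zero: "\<one>\<^bsub>Fs ! i\<^esub> \<noteq> \<zero>\<^bsub>Fs ! i\<^esub>" if "i < ?n" for i
    using fields[of "Fs ! i"] that by (simp add: field_def domain.one_not_zero)
  have \<delta>_ne: "\<delta> i \<noteq> 0" if "i < ?n" for i
    using \<delta>[OF that that] pr_0[OF that] one_ne_zero[OF that] by auto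
  have \<delta>_orth: "\<delta> i * \<delta> j = (if i = j then \<delta> i else 0)" if "i < ?n" "j < ?n" for i j
    by (rule pr_inj) (use that in \<open>auto simp: pr_\<delta> \<delta> pr_0\<close>)
  have \<delta>_inj: "inj_on \<delta> {..<?n}"
    by (rule inj_onI) (metis \<delta>_orth \<delta>_ne lessThan_iff)
  have \<delta>_field: "field_idem (\<delta> i)" if i: "i < ?n" for i
    unfolding field_idem_def
  proof (intro conjI allI impI)
    show "\<delta> i * \<delta> i = \<delta> i" "\<delta> i \<noteq> 0"
      using \<delta>_orth[OF i i] \<delta>_ne[OF i] by auto
    fix x assume nonzero: "\<delta> i * x \<noteq> 0"
    have "pr i x \<noteq> \<zero>\<^bsub>Fs ! i\<^esub>"
    proof
      assume "pr i x = \<zero>\<^bsub>Fs ! i\<^esub>"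
      then have "\<delta> i * x = 0"
        by (intro pr_inj) (auto simp: pr_\<delta>[OF i] pr_0)
      then show False
        using nonzero by contradiction
    qed
    moreover interpret field "Fs ! i"
      using fields i by simp
    have "pr i x \<in> carrier (Fs ! i)"
      by (rule pr_carrier[OF i])
    ultimately have inv: "inv\<^bsub>Fs ! i\<^esub> (pr i x) \<in> carrier (Fs ! i)" "pr i x \<otimes>\<^bsub>Fs ! i\<^esub> inv\<^bsub>Fs ! i\<^esub> (pr i x) = \<one>\<^bsub>Fs ! i\<^esub>"
      by (auto simp: field_Units)
    have "\<delta> i * x * loc i (inv\<^bsub>Fs ! i\<^esub> (pr i x)) = \<delta> i"
    proof (rule pr_inj)
      fix j assume j: "j < ?n"
      show "pr j (\<delta> i * x * loc i (inv\<^bsub>Fs ! i\<^esub> (pr i x))) = pr j (\<delta> i)"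
        unfolding mult.assoc pr_\<delta>[OF i j] pr_hom(1)[OF i] loc[OF i inv(1) i] \<delta>[OF i j] using inv(2) by simp
    qed
    then show "\<exists>y. \<delta> i * x * y = \<delta> i" ..
  qed
  have pr_of_nat: "pr i (of_nat k * \<delta> i) = [k] \<cdot>\<^bsub>Fs ! i\<^esub> \<one>\<^bsub>Fs ! i\<^esub>" if i: "i < ?n" for i k
  proof (induction k)
    case 0
    show ?case
      using pr_0[OF i] by (simp add: add_pow_def)
  next
    case (Suc k)
    interpret ring "Fs ! i" by (rule ringK[OF i])
    have "of_nat (Suc k) * \<delta> i = of_nat k * \<delta> i + \<delta> i"
      by (simp add: algebra_simps)
    then show ?case
      using Suc \<delta>[OF i i] by (simp add: pr_hom(2)[OF i] add_pow_def)
  qed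
  have sum_\<delta>: "(\<Sum>i<?n. \<delta> i) = 1"
  proof (rule pr_inj)
    fix j assume j: "j < ?n"
    interpret ring "Fs ! j" by (rule ringK[OF j])
    have "pr j (\<Sum>i<k. \<delta> i) = (if j < k then \<one>\<^bsub>Fs ! j\<^esub> else \<zero>\<^bsub>Fs ! j\<^esub>)" if "k \<le> ?n" for k
      using that
    proof (induction k)
      case (Suc k)
      then have k: "k < ?n" by simp
      have step: "pr j (\<Sum>i<Suc k. \<delta> i) = pr j (\<Sum>i<k. \<delta> i) \<oplus>\<^bsub>Fs ! j\<^esub> pr j (\<delta> k)"
        by (simp add: pr_hom(2)[OF j])
      show ?case
      proof (cases "j = k")
        case True
        then have "pr j (\<Sum>i<k. \<delta> i) = \<zero>\<^bsub>Fs ! j\<^esub>" "pr j (\<delta> k) = \<one>\<^bsub>Fs ! j\<^esub>" "j < Suc k"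
          using Suc \<delta>[OF k j] by auto
        then show ?thesis
          unfolding step by simp
      next
        case False
        then have "pr j (\<delta> k) = \<zero>\<^bsub>Fs ! j\<^esub>" "j < Suc k \<longleftrightarrow> j < k"
          using \<delta>[OF k j] by auto
        then show ?thesis
          unfolding step using Suc by simp
      qed
    qed (simp add: pr_0[OF j])
    then show "pr j (\<Sum>i<?n. \<delta> i) = pr j 1"
      using j pr_hom(3)[OF j] by simp
  qed
  show thesis
  proof (rule that[of "\<delta> ` {..<?n}"])
    show "field_decomposition 1 (\<delta> ` {..<?n})"
      unfolding field_decomposition_def
      using \<delta>_field \<delta>_orth sum_\<delta> by (auto simp: sum.reindex[OF \<delta>_inj])
    fix e assume "e \<in> \<delta> ` {..<?n}"
    then obtain i where i: "i < ?n" "e = \<delta> i" by blast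
    have "[k] \<cdot>\<^bsub>Fs ! i\<^esub> \<one>\<^bsub>Fs ! i\<^esub> = \<zero>\<^bsub>Fs ! i\<^esub> \<longleftrightarrow> of_nat k * e = 0" for k
    proof
      assume *: "[k] \<cdot>\<^bsub>Fs ! i\<^esub> \<one>\<^bsub>Fs ! i\<^esub> = \<zero>\<^bsub>Fs ! i\<^esub>"
      show "of_nat k * e = 0"
      proof (rule pr_inj)
        fix j assume j: "j < ?n"
        show "pr j (of_nat k * e) = pr j 0"
          using pr_of_nat[OF i(1), of k] pr_\<delta>[OF i(1) j, of "of_nat k"] pr_\<delta>[OF i(1) i(1), of "of_nat k"] * pr_0[OF j]
          by (auto simp: i(2) mult.commute split: if_splits)
      qed
    next
      assume "of_nat k * e = 0"
      then show "[k] \<cdot>\<^bsub>Fs ! i\<^esub> \<one>\<^bsub>Fs ! i\<^esub> = \<zero>\<^bsub>Fs ! i\<^esub>"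
        using pr_of_nat[OF i(1), of k] pr_0[OF i(1)] by (simp add: i(2))
    qed
    then have "\<forall>m>0. ring_characteristic (Fs ! i) dvd m \<longleftrightarrow> of_nat m * e = 0"
      using ring_characteristic_dvd by blast
    then show "\<exists>K\<in>set Fs. \<forall>m>0. ring_characteristic K dvd m \<longleftrightarrow> of_nat m * e = 0"
      using i(1) nth_mem by blast
  qed
qed

section \<open>Matrix algebras\<close>

lemma semigroup_algebra_simps:
  fixes R :: "'r::comm_ring_1 itself"
  shows "carrier (semigroup_algebra R G) = (alg G :: ('s::semigroup_mult \<Rightarrow>\<^sub>0 'r) set)"
    "monoid.mult (semigroup_algebra R G) = (convolution :: ('s \<Rightarrow>\<^sub>0 'r) \<Rightarrow> _)"
    "\<zero>\<^bsub>semigroup_algebra R G\<^esub> = (0 :: 's \<Rightarrow>\<^sub>0 'r)"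
    "add (semigroup_algebra R G) = ((+) :: ('s \<Rightarrow>\<^sub>0 'r) \<Rightarrow> _)"
    "module.smult (semigroup_algebra R G) = (scale :: 'r \<Rightarrow> ('s \<Rightarrow>\<^sub>0 'r) \<Rightarrow> _)"
  by (simp_all add: semigroup_algebra_def alg_def scale_def fun_eq_iff)

lemma semigroup_algebra_one:
  assumes "u \<in> alg G" "\<And>f. f \<in> alg G \<Longrightarrow> convolution u f = f \<and> convolution f u = f"
  shows "\<one>\<^bsub>semigroup_algebra (R :: 'r::comm_ring_1 itself) G\<^esub> = (u :: 's::semigroup_mult \<Rightarrow>\<^sub>0 'r)"
proof -
  have "\<one>\<^bsub>semigroup_algebra R G\<^esub> = (THE u. u \<in> alg G \<and> (\<forall>f. f \<in> alg G \<longrightarrow> convolution u f = f \<and> convolution f u = f))"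
    by (simp add: semigroup_algebra_def alg_def)
  also have "\<dots> = u"
  proof (rule the_equality)
    show "v = u" if v: "v \<in> alg G \<and> (\<forall>f. f \<in> alg G \<longrightarrow> convolution v f = f \<and> convolution f v = f)" for v
    proof -
      have "convolution v u = u" "convolution v u = v"
        using v assms by blast+
      then show ?thesis by simp
    qed
  qed (use assms in blast)
  finally show ?thesis .
qed

lemma group_algebra_one:
  assumes "subgrp e G"
  shows "\<one>\<^bsub>semigroup_algebra (R :: 'r::comm_ring_1 itself) G\<^esub> = (basis e :: 's::inverse_semigroup \<Rightarrow>\<^sub>0 'r)"
  by (rule semigroup_algebra_one)
     (use convolution_identity[OF assms] subgrpD(1)[OF assms] in \<open>auto simp: alg_def\<close>)

lemma product_algebra_simps:
  "carrier (product_algebra As) = carrier (RDirProd_list As)"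
  "monoid.mult (product_algebra As) = monoid.mult (RDirProd_list As)"
  "\<one>\<^bsub>product_algebra As\<^esub> = \<one>\<^bsub>RDirProd_list As\<^esub>"
  "add (product_algebra As) = add (RDirProd_list As)"
  "module.smult (product_algebra As) = (\<lambda>r xs. map2 (\<lambda>A x. r \<odot>\<^bsub>A\<^esub> x) As xs)"
  by (simp_all add: product_algebra_def ring.defs module.defs)

lemma map2_map_map: "map2 f (map g ks) (map h ks) = map (\<lambda>k. f (g k) (h k)) ks"
  by (induction ks) simp_all

context finite_idempotents
begin

lemma gunit_in_hat: "\<exists>u :: 's \<Rightarrow>\<^sub>0 'r::comm_ring_1. hat u = gunit"
  using bij_is_surj[OF bij_hat] by (metis surjD)

lemma hat_unit:
  assumes "hat u = (gunit :: 's \<Rightarrow>\<^sub>0 'r::comm_ring_1)"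
  shows "convolution u x = x" "convolution x u = x"
  using injD[OF bij_is_inj[OF bij_hat], of "convolution u x" x] injD[OF bij_is_inj[OF bij_hat], of "convolution x u" x]
  by (simp_all add: hat_convolution assms gunit)

definition reps :: "'s list"
  where "reps = (SOME rs. set rs = rep ` E \<and> distinct rs)"

lemma reps: "set reps = rep ` E" "distinct reps"
proof -
  have "\<exists>rs. set rs = rep ` E \<and> distinct rs"
    using finite_distinct_list[of "rep ` E"] finite_E by blast
  then have "set reps = rep ` E \<and> distinct reps"
    unfolding reps_def by (rule someI_ex)
  then show "set reps = rep ` E" "distinct reps" by auto
qed

definition iso_class :: "'s \<Rightarrow> 's set"
  where "iso_class r = {e \<in> E. rep e = r}"

text \<open>A numbering of the idempotents in the component of \<open>r\<close>, needed because
  matrix algebras are indexed by natural numbers.\<close>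

definition obj :: "'s \<Rightarrow> nat \<Rightarrow> 's"
  where "obj r = (SOME f. bij_betw f {..<card (iso_class r)} (iso_class r))"

lemma obj: "bij_betw (obj r) {..<card (iso_class r)} (iso_class r)"
proof -
  have "finite (iso_class r)"
    using finite_E by (simp add: iso_class_def)
  then have "\<exists>f. bij_betw f {..<card (iso_class r)} (iso_class r)"
    using ex_bij_betw_nat_finite[of "iso_class r"] by (simp add: atLeast0LessThan)
  then show ?thesis
    unfolding obj_def by (rule someI_ex)
qed

lemma obj_in:
  assumes "i < card (iso_class r)"
  shows "obj r i \<in> E" "rep (obj r i) = r"
  using bij_betwE[OF obj[of r]] assms by (auto simp: iso_class_def)

lemma obj_surj: "e \<in> E \<Longrightarrow> rep e = r \<Longrightarrow> \<exists>i<card (iso_class r). obj r i = e"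
  using bij_betw_imp_surj_on[OF obj[of r]] by (force simp: iso_class_def)

lemma obj_eq_iff: "i < card (iso_class r) \<Longrightarrow> j < card (iso_class r) \<Longrightarrow> obj r i = obj r j \<longleftrightarrow> i = j"
  using bij_betw_imp_inj_on[OF obj[of r]] by (auto dest: inj_onD)

abbreviation block_index :: "'s \<Rightarrow> (nat \<times> nat) set"
  where "block_index r \<equiv> {..<card (iso_class r)} \<times> {..<card (iso_class r)}"

definition block :: "('s \<Rightarrow>\<^sub>0 'r::comm_ring_1) \<Rightarrow> 's \<Rightarrow> nat \<times> nat \<Rightarrow> 's \<Rightarrow>\<^sub>0 'r"
  where "block x r = (\<lambda>(i, j)\<in>block_index r. coord (obj r i) (obj r j) x)"

abbreviation block_algebra :: "'r::comm_ring_1 itself \<Rightarrow> 's \<Rightarrow> ('r, nat \<times> nat \<Rightarrow> 's \<Rightarrow>\<^sub>0 'r) module"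
  where "block_algebra R r \<equiv> matrix_algebra (card (iso_class r)) (semigroup_algebra R (hclass r))"

lemma block_apply:
  "i < card (iso_class r) \<Longrightarrow> j < card (iso_class r) \<Longrightarrow> block x r (i, j) = coord (obj r i) (obj r j) x"
  by (simp add: block_def)

lemma coord_in_alg:
  assumes "i < card (iso_class r)"
  shows "coord (obj r i) f x \<in> alg (hclass r)"
  using supp_coord[of "obj r i" f x] obj_in(2)[OF assms] by (simp add: alg_def)

lemma block_closed: "block x r \<in> carrier (block_algebra (R :: 'r::comm_ring_1 itself) r)"
  by (auto simp: matrix_algebra_def semigroup_algebra_simps block_def coord_in_alg)

lemma block_add:
  "block (x + y) r = block x r \<oplus>\<^bsub>block_algebra (R :: 'r::comm_ring_1 itself) r\<^esub> block y r"
  by (auto simp: matrix_algebra_def semigroup_algebra_simps block_def coord_add fun_eq_iff)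

lemma block_scale:
  "block (scale c x) r = c \<odot>\<^bsub>block_algebra (R :: 'r::comm_ring_1 itself) r\<^esub> block x r"
  by (auto simp: matrix_algebra_def semigroup_algebra_simps block_def coord_scale fun_eq_iff)

lemma block_gmult:
  "block (gmult x y) r = block x r \<otimes>\<^bsub>block_algebra (R :: 'r::comm_ring_1 itself) r\<^esub> block y r"
proof -
  let ?n = "card (iso_class r)"
  have entry: "coord (obj r i) (obj r j) (gmult x y) =
      finsum (semigroup_algebra R (hclass r)) (\<lambda>k. convolution (block x r (i, k)) (block y r (k, j))) {..<?n}"
    if ij: "i < ?n" "j < ?n" for i j
  proof -
    let ?f = "\<lambda>k. convolution (coord (obj r i) k x) (coord k (obj r j) y)"
    have r: "r \<in> idempotents"
      using link(3)[of "obj r i"] obj_in[OF ij(1)] by (simp add: E_def)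
    have "finsum (semigroup_algebra R (hclass r)) (\<lambda>k. convolution (block x r (i, k)) (block y r (k, j))) {..<?n} =
        (\<Sum>k<?n. convolution (block x r (i, k)) (block y r (k, j)))"
    proof (rule finsum_semigroup_algebra)
      fix k assume k: "k \<in> {..<?n}"
      have "supp (coord (obj r i) (obj r k) x) \<subseteq> hclass r" "supp (coord (obj r k) (obj r j) y) \<subseteq> hclass r"
        using coord_in_alg[OF ij(1)] coord_in_alg[of k r] k by (simp_all add: alg_def)
      then show "supp (convolution (block x r (i, k)) (block y r (k, j))) \<subseteq> hclass r"
        using supp_group_convolution[OF subgrp_hclass[of r]] r ij k by (simp add: block_apply idempotents_iff)
    qed
    also have "\<dots> = (\<Sum>k<?n. ?f (obj r k))"
      using ij by (intro sum.cong) (auto simp: block_apply)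
    also have "\<dots> = (\<Sum>k\<in>iso_class r. ?f k)"
      by (rule sum.reindex_bij_betw[OF obj])
    \<comment> \<open>Entries between different components vanish, so the sum over one component
      equals the sum over all idempotents in the product formula.\<close>
    also have "\<dots> = (\<Sum>k\<in>E. ?f k)"
    proof (rule sum.mono_neutral_left[OF finite_E])
      show "\<forall>k\<in>E - iso_class r. ?f k = 0"
      proof
        fix k assume "k \<in> E - iso_class r"
        then have "rep (obj r i) \<noteq> rep k"
          using obj_in[OF ij(1)] by (auto simp: iso_class_def)
        then have "coord (obj r i) k x = 0"
          by (rule coord_eq_0)
        then show "?f k = 0"
          by (simp add: convolution_simps)
      qed
    qed (auto simp: iso_class_def)
    finally show ?thesis
      by (simp add: coord_gmult)
  qed
  show ?thesis
    by (rule ext) (auto simp: matrix_algebra_def semigroup_algebra_simps block_def[of "gmult x y"] entry)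
qed

lemma coord_gunit:
  assumes "e \<in> E" "f \<in> E"
  shows "coord e f (gunit :: 's \<Rightarrow>\<^sub>0 'r::comm_ring_1) = (if e = f then basis (rep e) else 0)"
proof -
  have eI: "e \<in> idempotents" using assms by (simp add: E_def)
  have dmle: "sinv (link e) * e * link e = rep e"
  proof -
    have "sinv (link e) * e * link e = sinv (link e) * rg (link e) * link e"
      by (simp only: link(1)[OF eI])
    also have "\<dots> = dm (link e)"
      by (simp add: mult.assoc)
    finally show ?thesis
      by (simp only: link(2)[OF eI])
  qed
  have "coord e f (gunit :: 's \<Rightarrow>\<^sub>0 'r) = (\<Sum>k\<in>E. coord e f (basis k))"
    by (simp add: gunit_def coord_def lin_sum)
  also have "\<dots> = (\<Sum>k\<in>E. if k = e then if e = f then basis (rep e) else 0 else 0)"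
    by (intro sum.cong refl) (use dmle in \<open>auto simp: coord_def E_def dm_rg_idem\<close>)
  also have "\<dots> = (if e = f then basis (rep e) else 0)"
    using finite_E assms by simp
  finally show ?thesis .
qed

lemma block_gunit:
  assumes "r \<in> rep ` E"
  shows "block gunit r = \<one>\<^bsub>block_algebra (R :: 'r::comm_ring_1 itself) r\<^esub>"
proof -
  have "r \<in> idempotents"
    using assms link(3) by (auto simp: E_def)
  then have "\<one>\<^bsub>semigroup_algebra R (hclass r)\<^esub> = basis r"
    by (intro group_algebra_one subgrp_hclass) (simp add: idempotents_iff)
  then show ?thesis
    by (auto simp: matrix_algebra_def semigroup_algebra_simps block_def fun_eq_iff coord_gunit obj_in obj_eq_iff)
qed

lemma block_surj:
  fixes M :: "'s \<Rightarrow> nat \<times> nat \<Rightarrow> 's \<Rightarrow>\<^sub>0 'r::comm_ring_1"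
  assumes M: "\<And>r. r \<in> rep ` E \<Longrightarrow> M r \<in> carrier (block_algebra TYPE('r) r)"
  shows "\<exists>x. \<forall>r\<in>rep ` E. block x r = M r"
proof -
  define ix where "ix e = (SOME i. i < card (iso_class (rep e)) \<and> obj (rep e) i = e)" for e
  have ix: "ix e < card (iso_class (rep e))" "obj (rep e) (ix e) = e" if "e \<in> E" for e
    using someI_ex[OF obj_surj[OF that refl]] by (auto simp: ix_def)
  have ix_obj: "ix (obj r i) = i" if "i < card (iso_class r)" for r i
    using ix[of "obj r i"] obj_in[OF that] obj_eq_iff[of "ix (obj r i)" r i] that by simp
  \<comment> \<open>Places all given matrix entries at their positions; pairs of idempotents from
    different components get 0, since no block contains them.\<close>
  define x where "x = (\<Sum>e\<in>E. \<Sum>f\<in>E. if rep f = rep e then embed e f (M (rep e) (ix e, ix f)) else 0)"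
  have M_alg: "M r (i, j) \<in> alg (hclass r)"
    if "r \<in> rep ` E" "i < card (iso_class r)" "j < card (iso_class r)" for r i j
    using M[OF that(1)] that(2,3) by (auto simp: matrix_algebra_def semigroup_algebra_simps PiE_iff)
  have coord_x: "coord e' f' x = (if rep f' = rep e' then M (rep e') (ix e', ix f') else 0)"
    if ef': "e' \<in> E" "f' \<in> E" for e' f'
  proof -
    have "coord e' f' (if rep f = rep e then embed e f (M (rep e) (ix e, ix f)) else 0) =
        (if e = e' then if f = f' then if rep f' = rep e' then M (rep e') (ix e', ix f') else 0 else 0 else 0)"
      if ef: "e \<in> E" "f \<in> E" for e f
    proof (cases "rep f = rep e")
      case True
      have "ix f < card (iso_class (rep e))"
        using ix(1)[OF ef(2)] True by simp
      then have "supp (M (rep e) (ix e, ix f)) \<subseteq> hclass (rep e)"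
        using M_alg[of "rep e" "ix e" "ix f"] ix(1)[OF ef(1)] ef(1) by (simp add: alg_def)
      then have "coord e' f' (embed e f (M (rep e) (ix e, ix f))) =
          (if e' = e \<and> f' = f then M (rep e) (ix e, ix f) else 0)"
        using ef True by (intro coord_embed) (simp_all add: E_def)
      then show ?thesis
        using True by auto
    qed (auto simp: coord_0)
    then have "coord e' f' x = (\<Sum>e\<in>E. \<Sum>f\<in>E.
        if e = e' then if f = f' then if rep f' = rep e' then M (rep e') (ix e', ix f') else 0 else 0 else 0)"
      unfolding x_def coord_def lin_sum by (intro sum.cong refl) (simp add: coord_def)
    also have "\<dots> = (\<Sum>e\<in>E. if e = e' then if rep f' = rep e' then M (rep e') (ix e', ix f') else 0 else 0)"
      using finite_E ef'(2) by (intro sum.cong refl) auto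
    also have "\<dots> = (if rep f' = rep e' then M (rep e') (ix e', ix f') else 0)"
      using finite_E ef'(1) by simp
    finally show ?thesis .
  qed
  have "block x r = M r" if r: "r \<in> rep ` E" for r
  proof
    fix p
    have ext: "M r \<in> extensional (block_index r)"
      using M[OF r] by (auto simp: matrix_algebra_def PiE_iff)
    show "block x r p = M r p"
    proof (cases "p \<in> block_index r")
      case True
      then obtain i j where p: "p = (i, j)" "i < card (iso_class r)" "j < card (iso_class r)" by auto
      then show ?thesis
        by (simp add: block_apply coord_x obj_in ix_obj)
    next
      case False
      then show ?thesis
        using extensional_arb[OF ext False] by (simp add: block_def)
    qed
  qed
  then show ?thesis by blast
qed

text \<open>There is one block per component of the groupoid: its size is the number of idempotents
  in the component and its coefficients come from the maximal subgroup at the representative. The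
  isomorphism is \<open>hat\<close> followed by reading off the blocks.\<close>

theorem algebra_decomposition:
  fixes R :: "'r::comm_ring_1 itself"
  shows "\<exists>nGs :: (nat \<times> 's set) list. (\<forall>(n, G)\<in>set nGs. n \<ge> 1 \<and> G \<in> maximal_subgroups) \<and>
    algebra_isomorphic (semigroup_algebra R (UNIV :: 's set))
      (product_algebra (map (\<lambda>(n, G). matrix_algebra n (semigroup_algebra R G)) nGs))"
proof -
  let ?nGs = "map (\<lambda>r. (card (iso_class r), hclass r)) reps"
  let ?A = "semigroup_algebra R (UNIV :: 's set)"
  let ?Bs = "map (block_algebra R) reps"
  have Bs: "map (\<lambda>(n, G). matrix_algebra n (semigroup_algebra R G)) ?nGs = ?Bs"
    by simp
  obtain u :: "'s \<Rightarrow>\<^sub>0 'r" where u: "hat u = gunit"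
    using gunit_in_hat by blast
  have one: "\<one>\<^bsub>?A\<^esub> = u"
    by (rule semigroup_algebra_one) (simp_all add: hat_unit[OF u])
  have iso: "(\<lambda>x. map (\<lambda>r. block (hat x) r) reps) \<in> ring_iso ?A (RDirProd_list ?Bs)"
  proof (rule RDirProd_list_iso)
    show "(\<lambda>x. block (hat x) r) \<in> ring_hom ?A (block_algebra R r)" if "r \<in> set reps" for r
    proof (rule ring_hom_memI)
      show "block (hat \<one>\<^bsub>?A\<^esub>) r = \<one>\<^bsub>block_algebra R r\<^esub>"
        unfolding one u by (rule block_gunit) (use that reps(1) in simp)
    qed (simp_all add: semigroup_algebra_simps block_closed hat_convolution block_gmult[where R = R]
        hat_add block_add[where R = R])
    show "x = y" if eq: "\<And>r. r \<in> set reps \<Longrightarrow> block (hat x) r = block (hat y) r" for x y :: "'s \<Rightarrow>\<^sub>0 'r"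
    proof -
      have "hat x = hat y"
      proof (rule coord_eqI)
        fix e f assume ef: "e \<in> E" "f \<in> E"
        show "coord e f (hat x) = coord e f (hat y)"
        proof (cases "rep e = rep f")
          case True
          obtain i where i: "i < card (iso_class (rep e))" "obj (rep e) i = e"
            using obj_surj[OF ef(1) refl] by blast
          obtain j where j: "j < card (iso_class (rep e))" "obj (rep e) j = f"
            using obj_surj[OF ef(2), of "rep e"] True by auto
          have "block (hat x) (rep e) (i, j) = block (hat y) (rep e) (i, j)"
            using eq[of "rep e"] ef(1) reps(1) by simp
          then show ?thesis
            using i j by (simp add: block_apply)
        qed (simp add: coord_eq_0)
      qed
      then show ?thesis
        using injD[OF bij_is_inj[OF bij_hat]] by blast
    qed
    show "\<exists>x\<in>carrier ?A. \<forall>r\<in>set reps. block (hat x) r = M r"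
      if M: "\<And>r. r \<in> set reps \<Longrightarrow> M r \<in> carrier (block_algebra R r)" for M
    proof -
      have "M r \<in> carrier (block_algebra TYPE('r) r)" if "r \<in> rep ` E" for r
        using M[of r] that reps(1) by (simp add: matrix_algebra_def semigroup_algebra_simps)
      then obtain y where y: "\<forall>r\<in>rep ` E. block y r = M r"
        using block_surj by blast
      obtain x where "hat x = y"
        using bij_is_surj[OF bij_hat] by (metis surjD)
      then show ?thesis
        using y reps(1) by (intro bexI[of _ x]) (simp_all add: semigroup_algebra_simps)
    qed
  qed (rule reps(2))
  have iso': "(\<lambda>x. map (\<lambda>r. block (hat x) r) reps) \<in> ring_iso ?A (product_algebra ?Bs)"
    using iso by (simp add: ring_iso_def ring_hom_def product_algebra_simps)
  have smult: "map (\<lambda>r. block (hat (c \<odot>\<^bsub>?A\<^esub> x)) r) reps =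
      c \<odot>\<^bsub>product_algebra ?Bs\<^esub> map (\<lambda>r. block (hat x) r) reps" for c x
    by (simp add: product_algebra_simps semigroup_algebra_simps hat_scale block_scale[where R = R] map2_map_map)
  have "algebra_isomorphic ?A (product_algebra ?Bs)"
    unfolding algebra_isomorphic_def by (rule bexI[OF _ iso']) (intro allI ballI smult)
  moreover have "\<forall>(n, G)\<in>set ?nGs. n \<ge> 1 \<and> G \<in> maximal_subgroups"
  proof -
    have "card (iso_class r) \<ge> 1 \<and> hclass r \<in> maximal_subgroups" if r: "r \<in> rep ` E" for r
    proof -
      obtain e where e: "e \<in> E" "r = rep e"
        using r by blast
      then have "e \<in> iso_class r" "finite (iso_class r)"
        using finite_E by (auto simp: iso_class_def)
      then have "card (iso_class r) \<noteq> 0" by auto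
      moreover have "r \<in> idempotents"
        using e link(3) by (simp add: E_def)
      ultimately show ?thesis
        by (simp add: maximal_subgroups_eq)
    qed
    then show ?thesis
      using reps(1) by auto
  qed
  ultimately show ?thesis
    unfolding Bs[symmetric] by blast
qed

end

section \<open>The three equivalences\<close>

lemma artinian_iff:
  fixes R :: "'r::comm_ring_1 itself"
  shows "left_artinian (semigroup_algebra R (UNIV :: 's::inverse_semigroup set)) \<longleftrightarrow>
    left_artinian (ring_of_type_algebra :: 'r ring) \<and> finite (UNIV :: 's set)"
proof
  assume "left_artinian (semigroup_algebra R (UNIV :: 's set))"
  then have dcc: "chain_condition False convolution (UNIV :: ('s \<Rightarrow>\<^sub>0 'r) set)"
    by (simp add: left_artinian_iff)
  then show "left_artinian (ring_of_type_algebra :: 'r ring) \<and> finite (UNIV :: 's set)"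
    using artinian_finite[OF dcc] coefficients_chain_condition[OF dcc] by (simp add: left_artinian_iff)
next
  assume R: "left_artinian (ring_of_type_algebra :: 'r ring) \<and> finite (UNIV :: 's set)"
  interpret finite_idempotents "idempotents :: 's set"
    by unfold_locales (use R finite_subset[OF subset_UNIV, of "idempotents :: 's set"] in auto)
  show "left_artinian (semigroup_algebra R (UNIV :: 's set))"
    unfolding left_artinian_iff alg_UNIV
    by (rule chain_condition_hat[OF chain_condition_gmult_finite]) (use R in \<open>auto simp: left_artinian_iff\<close>)
qed

lemma noetherian_iff:
  fixes R :: "'r::comm_ring_1 itself"
  shows "left_noetherian (semigroup_algebra R (UNIV :: 's::inverse_semigroup set)) \<longleftrightarrow>
    finite (idempotents :: 's set) \<and>
    (\<forall>G \<in> (maximal_subgroups :: 's set set). left_noetherian (semigroup_algebra R G))"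
proof
  assume "left_noetherian (semigroup_algebra R (UNIV :: 's set))"
  then have acc: "chain_condition True convolution (UNIV :: ('s \<Rightarrow>\<^sub>0 'r) set)"
    by (simp add: left_noetherian_iff)
  have "chain_condition True convolution (alg (hclass e) :: ('s \<Rightarrow>\<^sub>0 'r) set)" if "e \<in> idempotents" for e :: 's
    by (rule subgroup_chain_condition[OF acc subgrp_hclass]) (use that in \<open>simp add: idempotents_iff\<close>)
  then show "finite (idempotents :: 's set) \<and>
      (\<forall>G \<in> (maximal_subgroups :: 's set set). left_noetherian (semigroup_algebra R G))"
    using finite_idempotents[OF acc] by (auto simp: maximal_subgroups_eq left_noetherian_iff)
next
  assume R: "finite (idempotents :: 's set) \<and>
    (\<forall>G \<in> (maximal_subgroups :: 's set set). left_noetherian (semigroup_algebra R G))"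
  interpret finite_idempotents "idempotents :: 's set"
    by unfold_locales (use R in auto)
  have "chain_condition True convolution (alg (hclass e) :: ('s \<Rightarrow>\<^sub>0 'r) set)" if "e \<in> idempotents" for e :: 's
    using R that by (auto simp: maximal_subgroups_eq left_noetherian_iff)
  then show "left_noetherian (semigroup_algebra R (UNIV :: 's set))"
    unfolding left_noetherian_iff alg_UNIV by (rule chain_condition_hat[OF chain_condition_gmult])
qed

text \<open>Right units give the ascending chain condition and thereby finitely many idempotents;
  the right unit of the augmentation ideal of each maximal subgroup makes that subgroup
  finite.\<close>

lemma semisimple_finite:
  assumes ru: "right_units convolution (UNIV :: ('s::inverse_semigroup \<Rightarrow>\<^sub>0 'r::comm_ring_1) set)"
  shows "finite (UNIV :: 's set)"
proof (rule finite_inverse_semigroup)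
  show "finite (idempotents :: 's set)"
    by (rule finite_idempotents[OF right_units_ascending[OF ru]])
  show "finite (hclass e)" if "e \<in> idempotents" for e :: 's
  proof -
    have G: "subgrp e (hclass e)"
      using that by (simp add: idempotents_iff subgrp_hclass)
    show ?thesis
      by (rule right_units_finite_group[OF G subgroup_right_units[OF ru G]])
  qed
qed

lemma semisimple_iff:
  fixes R :: "'r::comm_ring_1 itself"
  shows "semisimple_ring (semigroup_algebra R (UNIV :: 's::inverse_semigroup set)) \<longleftrightarrow>
    finite (UNIV :: 's set) \<and>
    (\<exists>Fs :: 'r ring list.
       (\<forall>F\<in>set Fs. field F) \<and>
       (ring_of_type_algebra :: 'r ring) \<simeq> RDirProd_list Fs \<and>
       (\<forall>F\<in>set Fs. \<forall>G \<in> (maximal_subgroups :: 's set set). \<not> ring_characteristic F dvd card G))"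
proof
  assume "semisimple_ring (semigroup_algebra R (UNIV :: 's set))"
  then have ru: "right_units convolution (UNIV :: ('s \<Rightarrow>\<^sub>0 'r) set)"
    by (rule semisimple_right_units)
  have fin: "finite (UNIV :: 's set)"
    by (rule semisimple_finite[OF ru])
  obtain F where F: "field_decomposition (1 :: 'r) F"
    using right_units_field_decomposition[OF coefficients_right_units[OF ru], of 1] by auto
  obtain es where es: "set es = F" "(ring_of_type_algebra :: 'r ring) \<simeq> RDirProd_list (map idem_field es)"
    using field_decomposition_iso[OF F] .
  have e: "field_idem e" if "e \<in> F" for e
    using F that by (simp add: field_decomposition_def)
  have "\<not> ring_characteristic (idem_field e) dvd card (hclass i)" if "e \<in> F" "i \<in> idempotents" for e and i :: 's
  proof -
    have G: "subgrp i (hclass i)" "finite (hclass i)"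
      using that(2) finite_subset[OF subset_UNIV fin] by (simp_all add: idempotents_iff subgrp_hclass)
    have "card (hclass i) > 0"
      using G subgrpD(1) card_gt_0_iff by blast
    moreover have "of_nat (card (hclass i)) * e \<noteq> 0"
      using right_units_order[OF G subgroup_right_units[OF ru G(1)]] e[OF that(1)] by (auto simp: field_idem_def)
    ultimately show ?thesis
      by (simp add: idem_field_characteristic)
  qed
  then show "finite (UNIV :: 's set) \<and>
    (\<exists>Fs :: 'r ring list.
       (\<forall>F\<in>set Fs. field F) \<and>
       (ring_of_type_algebra :: 'r ring) \<simeq> RDirProd_list Fs \<and>
       (\<forall>F\<in>set Fs. \<forall>G \<in> (maximal_subgroups :: 's set set). \<not> ring_characteristic F dvd card G))"
    using fin es field_idem_field[OF e] by (intro conjI exI[of _ "map idem_field es"]) (auto simp: maximal_subgroups_eq)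
next
  assume R: "finite (UNIV :: 's set) \<and>
    (\<exists>Fs :: 'r ring list.
       (\<forall>F\<in>set Fs. field F) \<and>
       (ring_of_type_algebra :: 'r ring) \<simeq> RDirProd_list Fs \<and>
       (\<forall>F\<in>set Fs. \<forall>G \<in> (maximal_subgroups :: 's set set). \<not> ring_characteristic F dvd card G))"
  then have fin: "finite (UNIV :: 's set)" by blast
  from R obtain Fs :: "'r ring list" where Fs: "\<forall>F\<in>set Fs. field F"
    "(ring_of_type_algebra :: 'r ring) \<simeq> RDirProd_list Fs"
    "\<forall>F\<in>set Fs. \<forall>G \<in> (maximal_subgroups :: 's set set). \<not> ring_characteristic F dvd card G"
    by blast
  interpret finite_idempotents "idempotents :: 's set"
    by unfold_locales (use finite_subset[OF subset_UNIV fin] in auto)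
  obtain F where F: "field_decomposition (1 :: 'r) F"
    and ch: "\<And>e. e \<in> F \<Longrightarrow> \<exists>K\<in>set Fs. \<forall>m>0. ring_characteristic K dvd m \<longleftrightarrow> of_nat m * e = 0"
    using field_list_decomposition[OF Fs(1)[rule_format] Fs(2)] by blast
  have inv: "\<exists>r :: 'r. r * of_nat (card (hclass i)) = 1" if i: "i \<in> idempotents" for i :: 's
  proof (rule field_decomposition_invertible[OF F])
    fix e assume "e \<in> F"
    then obtain K where K: "K \<in> set Fs" "\<forall>m>0. ring_characteristic K dvd m \<longleftrightarrow> of_nat m * e = 0"
      using ch by blast
    have G: "subgrp i (hclass i)" "finite (hclass i)"
      using i finite_subset[OF subset_UNIV fin] by (simp_all add: idempotents_iff subgrp_hclass)
    have "card (hclass i) > 0"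
      using G subgrpD(1) card_gt_0_iff by blast
    moreover have "hclass i \<in> maximal_subgroups"
      using i by (simp add: maximal_subgroups_eq)
    ultimately show "of_nat (card (hclass i)) * e \<noteq> 0"
      using K Fs(3) by blast
  qed
  have ru: "right_units convolution (UNIV :: ('s \<Rightarrow>\<^sub>0 'r) set)"
    by (rule right_units_hat[OF right_units_gmult[OF fin field_decomposition_right_units[OF F] inv]])
  have dcc: "chain_condition False convolution (UNIV :: ('s \<Rightarrow>\<^sub>0 'r) set)"
    by (rule chain_condition_hat[OF chain_condition_gmult_finite[OF fin field_decomposition_artinian[OF F]]])
  obtain u :: "'s \<Rightarrow>\<^sub>0 'r" where u: "hat u = gunit"
    using gunit_in_hat by blast
  show "semisimple_ring (semigroup_algebra R (UNIV :: 's set))"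
    by (rule semisimpleI[OF hat_unit[OF u] dcc ru])
qed

theorem theorem8:
  fixes R :: "'r::comm_ring_1 itself"
  shows
    "(left_noetherian (semigroup_algebra R (UNIV :: 's::inverse_semigroup set)) \<longleftrightarrow>
        finite (idempotents :: 's set) \<and>
        (\<forall>G \<in> (maximal_subgroups :: 's set set). left_noetherian (semigroup_algebra R G)))
     \<and>
     (left_artinian (semigroup_algebra R (UNIV :: 's set)) \<longleftrightarrow>
        left_artinian (ring_of_type_algebra :: 'r ring) \<and> finite (UNIV :: 's set))
     \<and>
     (semisimple_ring (semigroup_algebra R (UNIV :: 's set)) \<longleftrightarrow>
        finite (UNIV :: 's set) \<and>
        (\<exists>Fs :: 'r ring list.
           (\<forall>F\<in>set Fs. field F) \<and>
           (ring_of_type_algebra :: 'r ring) \<simeq> RDirProd_list Fs \<and>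
           (\<forall>F\<in>set Fs. \<forall>G \<in> (maximal_subgroups :: 's set set).
              \<not> ring_characteristic F dvd card G)))
     \<and>
     (left_noetherian (semigroup_algebra R (UNIV :: 's set)) \<or>
      left_artinian (semigroup_algebra R (UNIV :: 's set)) \<or>
      semisimple_ring (semigroup_algebra R (UNIV :: 's set)) \<longrightarrow>
        (\<exists>nGs :: (nat \<times> 's set) list.
           (\<forall>(n, G)\<in>set nGs. n \<ge> 1 \<and> G \<in> maximal_subgroups) \<and>
           algebra_isomorphic (semigroup_algebra R (UNIV :: 's set))
             (product_algebra (map (\<lambda>(n, G). matrix_algebra n (semigroup_algebra R G)) nGs))))"
proof (intro conjI impI)
  assume "left_noetherian (semigroup_algebra R (UNIV :: 's set)) \<or>
    left_artinian (semigroup_algebra R (UNIV :: 's set)) \<or>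
    semisimple_ring (semigroup_algebra R (UNIV :: 's set))"
  \<comment> \<open>Each of the three conditions implies that there are finitely many idempotents,
    which is all that the decomposition requires.\<close>
  then have "finite (idempotents :: 's set)"
    unfolding noetherian_iff artinian_iff semisimple_iff
    using finite_subset[OF subset_UNIV, of "idempotents :: 's set"] by (elim disjE conjE) assumption+
  then interpret finite_idempotents "idempotents :: 's set"
    by unfold_locales auto
  show "\<exists>nGs :: (nat \<times> 's set) list.
      (\<forall>(n, G)\<in>set nGs. n \<ge> 1 \<and> G \<in> maximal_subgroups) \<and>
      algebra_isomorphic (semigroup_algebra R (UNIV :: 's set))
        (product_algebra (map (\<lambda>(n, G). matrix_algebra n (semigroup_algebra R G)) nGs))"
    by (rule algebra_decomposition)
qed (rule noetherian_iff artinian_iff semisimple_iff)+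

end
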